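(* There exists an absolute constant $C$ such that the following holds. Let $X$ and $Y$ be independent random variables with distribution functions $F$ and $G$, with $\mathbf{E}X=\mathbf{E}Y=0$ and $\mathrm{Var}(X+Y)=1$, and put $v_1^2=\mathrm{Var}(X)$, $v_2^2=\mathrm{Var}(Y)$ with $v_1,v_2>0$. If $0<\varepsilon<1$ and $\|F*G-\Phi\|\le\varepsilon$, then $$\|F-\Phi_{v_1}\|\le\frac{C\,m(v_1,\varepsilon)}{v_1\sqrt{\log\frac1\varepsilon}}\qquad\text{and}\qquad \|G-\Phi_{v_2}\|\le\frac{C\,m(v_2,\varepsilon)}{v_2\sqrt{\log\frac1\varepsilon}}.$$
   Context: $\|F-G\|=\sup_{x\in\mathbb{R}}|F(x)-G(x)|$ is the Kolmogorov distance between distribution functions; $F*G$ is the convolution, i.e. the distribution function of $X+Y$. $\Phi_v$ is the distribution function of the normal law $N(0,v^2)$ with mean $0$ and standard deviation $v$, and $\Phi=\Phi_1$. For $v>0$ and $0<\varepsilon\le1$, $$m(v,\varepsilon)=\min\Big\{\frac{1}{\sqrt v},\ \log\log\frac{e^e}{\varepsilon}\Big\}.$$ $\log$ is the natural logarithm. *)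

theory Defs
  imports "HOL-Probability.Probability"
begin

(* Applied to distribution functions only, where the supremum is over a set bounded by 1. *)
definition kolmogorov_dist :: "(real \<Rightarrow> real) \<Rightarrow> (real \<Rightarrow> real) \<Rightarrow> real" where
  "kolmogorov_dist F G = (SUP x. \<bar>F x - G x\<bar>)"

(* The parameter is the standard deviation, not the variance; meant for v > 0. *)
definition normal_cdf :: "real \<Rightarrow> real \<Rightarrow> real" where
  "normal_cdf v = cdf (density lborel (normal_density 0 v))"

definition m_fun :: "real \<Rightarrow> real \<Rightarrow> real" where
  "m_fun v \<epsilon> = min (1 / sqrt v) (ln (ln (exp (exp 1) / \<epsilon>)))"

(* An absolute constant C must not depend on the sample space, but HOL cannot quantify over the
   type 'a of sample points inside a formula.  Hence the theorem requires one and the same C to work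
   both for all pairs of laws P, Q of X, Y (no type variable; F * G = cdf (P \<star> Q)) and for all
   independent random variables X, Y on a probability space over 'a. *)

end

theory Submission
  imports Defs "HOL-Complex_Analysis.Complex_Analysis"
begin

text \<open>
  Why the bound holds.  Put \<open>N = sqrt (ln (1 / \<epsilon>))\<close>.  It suffices to show that the law of \<open>X\<close> is within
  \<open>C (1 + ln (1 / v)) / (v N)\<close> of the normal law: the factor \<open>1 + ln (1 / v)\<close> is dominated by
  \<open>1 / sqrt v\<close>, and by \<open>ln (ln (exp (exp 1) / \<epsilon>))\<close> when \<open>v N \<ge> 1\<close>; when \<open>v N\<close> is bounded the claim is
  trivial.

  Clipping.  The sum has the second moment of the standard normal law and is close to it, hence the part
  of its second moment beyond \<open>2 N\<close> is exponentially small in \<open>N\<^sup>2\<close>.  By convexity and independence the same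
  holds for \<open>X\<close> and \<open>Y\<close> (\<open>expectation_excess_mono\<close>), so both may be clipped at \<open>2 N\<close>.

  Absence of zeros.  The clipped summands have entire moment generating functions, whose product is so close to
  \<open>exp (z\<^sup>2 / 2)\<close> for \<open>norm z \<le> N / 16\<close> that it has no zeros there (\<open>mX_nonzero\<close>).  Hence
  \<open>E exp (z X') = exp (a z + z\<^sup>2 h z)\<close> with \<open>h\<close> holomorphic and bounded and with \<open>2 h 0\<close> equal to the variance
  of \<open>X'\<close>, about \<open>v\<^sup>2\<close>.  Cauchy's estimates give only \<open>h z = h 0 + O(norm z / N)\<close>, an error that for small
  \<open>v\<close> is large against \<open>h 0\<close>.

  The key estimate (\<open>ridge_constant_exists\<close>) is that \<open>h = O(h 0)\<close> up to \<open>norm z\<close> of order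
  \<open>N / (1 + ln (1 / v))\<close>.  It rests on the ridge property: \<open>Re (z\<^sup>2 h z)\<close> attains its maximum over a
  vertical line at the real point.  Suppose \<open>h\<close> grows at most with exponential rate \<open>b\<close>.  In a strip around the imaginary
  axis the ridge property bounds \<open>Re (z\<^sup>2 h z)\<close> from above, and Harnack's inequality along the axis
  improves the growth there to \<open>exp (O(sqrt (b \<bar>t\<bar>)))\<close> (\<open>ridge_imaginary_bound\<close>).  A Phragmen-Lindelof
  argument in the two half discs carries this to all directions (\<open>ridge_half_disc\<close>), at the price of a
  rate proportional to \<open>ln (1 / v)\<close>.  Close to the origin, where additive constants in the exponent matter, a
  normal family argument takes over (\<open>ridge_compactness\<close>): a ridge function with \<open>h 0 = 0\<close> vanishes
  identically.  Together these lower every rate \<open>b\<close> that is large against \<open>ln (1 / v)\<close>.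

  Conclusion.  Now \<open>h z = h 0 + O(v\<^sup>2 norm z / \<rho>)\<close> with \<open>\<rho>\<close> of order \<open>N / (1 + ln (1 / v))\<close>, so the
  characteristic function of \<open>X\<close> is close to that of the normal law on frequencies up to a multiple of \<open>\<rho>\<close>,
  and Esseen's smoothing inequality (\<open>smoothing_constant_exists\<close>) yields a distance of order \<open>1 / (v \<rho>)\<close>.
\<close>

section \<open>Growth of ridge functions\<close>

text \<open>
  Both sides are compared with the Cayley transform \<open>(G - G c) / (G + cnj (G c))\<close>: it maps into the
  unit disc because \<open>Re G > 0\<close>, so the Schwarz lemma bounds it by \<open>1/2\<close> on the half ball, and solving
  for \<open>G\<close> gives the factor \<open>(1 + 1/2) / (1 - 1/2) = 3\<close>.  Bounding \<open>norm G\<close> rather than \<open>Re G\<close> lets the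
  estimate be chained along a sequence of balls.
\<close>
lemma harnack_half_ball:
  fixes G :: "complex \<Rightarrow> complex"
  assumes hol: "G holomorphic_on ball c r" and r: "r > 0"
    and pos: "\<And>z. z \<in> ball c r \<Longrightarrow> 0 \<le> Re (G z)"
    and w: "dist c w \<le> r / 2"
  shows "norm (G w) \<le> 3 * norm (G c)"
proof -
  \<comment> \<open>Strict positivity keeps the denominator away from zero; the general case follows by adding a constant that tends to zero.\<close>
  have strict: "norm (H w) \<le> 3 * norm (H c)"
    if H: "H holomorphic_on ball c r" and Hp: "\<And>z. z \<in> ball c r \<Longrightarrow> 0 < Re (H z)" for H
  proof -
    define q where "q z = (H (c + of_real r * z) - H c) / (H (c + of_real r * z) + cnj (H c))" for z
    have inb: "c + of_real r * z \<in> ball c r" if "norm z < 1" for z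
      using that r by (simp add: dist_norm norm_mult)
    have den: "H (c + of_real r * z) + cnj (H c) \<noteq> 0" if "norm z < 1" for z
    proof
      assume "H (c + of_real r * z) + cnj (H c) = 0"
      then have "Re (H (c + of_real r * z)) + Re (H c) = 0"
        by (metis plus_complex.sel(1) cnj.sel(1) zero_complex.sel(1))
      moreover have "0 < Re (H (c + of_real r * z))" "0 < Re (H c)"
        using Hp inb[OF that] r by auto
      ultimately show False by simp
    qed
    have hq: "q holomorphic_on ball 0 1"
    proof -
      have "(\<lambda>z. H (c + of_real r * z)) holomorphic_on ball 0 1"
        by (rule holomorphic_on_compose_gen[OF _ H, unfolded o_def])
           (use inb in \<open>auto intro!: holomorphic_intros\<close>)
      then show ?thesis unfolding q_def
        by (auto intro!: holomorphic_intros simp: den)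
    qed
    have q0: "q 0 = 0" by (simp add: q_def)
    have q1: "norm (q z) < 1" if "norm z < 1" for z
    proof -
      let ?a = "H (c + of_real r * z)" and ?b = "H c"
      have "0 < Re ?a" "0 < Re ?b" using Hp inb[OF that] r by auto
      then have "0 < Re ?a * Re ?b" by simp
      then have "(norm (?a - ?b))\<^sup>2 < (norm (?a + cnj ?b))\<^sup>2"
        unfolding cmod_power2 by (simp add: power2_eq_square algebra_simps)
      then have "norm (?a - ?b) < norm (?a + cnj ?b)"
        by (simp add: power_less_imp_less_base)
      then show ?thesis using den[OF that] by (simp add: q_def norm_divide)
    qed
    define z where "z = (w - c) / of_real r"
    have z: "norm z \<le> 1/2" using w r by (simp add: z_def norm_divide dist_norm norm_minus_commute field_simps)
    have wz: "w = c + of_real r * z" using r by (simp add: z_def)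
    have "norm (q z) \<le> norm z" using Schwarz_Lemma(1)[OF hq q0 q1, of z] z by simp
    with z have qz: "norm (q z) \<le> 1/2" by simp
    have "H w - H c = q z * (H w + cnj (H c))"
      using den[of z] z by (simp add: q_def wz)
    then have "norm (H w - H c) \<le> 1/2 * norm (H w + cnj (H c))"
      using mult_right_mono[OF qz norm_ge_zero, of "H w + cnj (H c)"] by (simp add: norm_mult)
    moreover have "norm (H w + cnj (H c)) \<le> norm (H w) + norm (H c)"
      by (metis complex_mod_cnj norm_triangle_ineq)
    moreover have "norm (H w) \<le> norm (H w - H c) + norm (H c)"
      by (metis norm_triangle_sub add.commute)
    ultimately show ?thesis by linarith
  qed
  have "norm (G w + of_real e) \<le> 3 * norm (G c + of_real e)" if e: "e > 0" for e :: real
  proof (rule strict)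
    show "(\<lambda>z. G z + of_real e) holomorphic_on ball c r" using hol by (auto intro!: holomorphic_intros)
    show "0 < Re (G z + of_real e)" if "z \<in> ball c r" for z
      using pos[OF that] e by simp
  qed
  then have ev: "eventually (\<lambda>e::real. norm (G w + of_real e) \<le> 3 * norm (G c + of_real e)) (at_right 0)"
    by (auto simp: eventually_at_right_less intro: eventually_at_rightI[of 0 1])
  have l1: "((\<lambda>e::real. norm (G w + of_real e)) \<longlongrightarrow> norm (G w + of_real 0)) (at_right 0)"
    and l2: "((\<lambda>e::real. 3 * norm (G c + of_real e)) \<longlongrightarrow> 3 * norm (G c + of_real 0)) (at_right 0)"
    by (intro tendsto_intros)+
  have "norm (G w + of_real 0) \<le> 3 * norm (G c + of_real 0)"
    by (rule tendsto_le[OF _ l2 l1 ev]) simp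
  then show ?thesis by simp
qed

lemma Re_of_real_mult: "Re (of_real x * z) = x * Re z"
  by simp

text \<open>
  The function \<open>h\<close> stands for the exponent in \<open>E exp(z X) = exp(a z + z\<^sup>2 h z)\<close>.  The inequality
  \<open>norm (E exp(z X)) \<le> E exp(Re z X)\<close> says that on every vertical line the real part of \<open>z\<^sup>2 h z\<close> is
  largest at the real point.  This is the only trace of positivity that the complex-analytic part uses.
\<close>
definition ridge :: "real \<Rightarrow> (complex \<Rightarrow> complex) \<Rightarrow> bool" where
  "ridge r h \<longleftrightarrow> h holomorphic_on ball 0 r \<and>
     (\<forall>z\<in>ball 0 r. Re (z\<^sup>2 * h z) \<le> Re ((complex_of_real (Re z))\<^sup>2 * h (complex_of_real (Re z))))"

lemma ridgeD:
  assumes "ridge r h"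
  shows "h holomorphic_on ball 0 r"
    and "norm z < r \<Longrightarrow> Re (z\<^sup>2 * h z) \<le> Re ((complex_of_real (Re z))\<^sup>2 * h (complex_of_real (Re z)))"
  using assms by (auto simp: ridge_def)

lemma ridge_reflect:
  assumes "ridge r h"
  shows "ridge r (\<lambda>z. h (- z))"
  unfolding ridge_def
proof
  show "(\<lambda>z. h (- z)) holomorphic_on ball 0 r"
    by (rule holomorphic_on_compose_gen[OF _ ridgeD(1)[OF assms], unfolded o_def])
       (auto intro!: holomorphic_intros)
  show "\<forall>z\<in>ball 0 r. Re (z\<^sup>2 * h (- z)) \<le> Re ((of_real (Re z))\<^sup>2 * h (- of_real (Re z)))"
  proof
    fix z :: complex assume "z \<in> ball 0 r"
    then show "Re (z\<^sup>2 * h (- z)) \<le> Re ((of_real (Re z))\<^sup>2 * h (- of_real (Re z)))"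
      using ridgeD(2)[OF assms, of "-z"] by simp
  qed
qed

lemma ridge_rescale:
  assumes h: "ridge r h" and s: "s > 0" and c: "c > 0"
  shows "ridge (r / s) (\<lambda>z. h (of_real s * z) / of_real c)"
  unfolding ridge_def
proof
  have inb: "of_real s * z \<in> ball 0 r" if "z \<in> ball 0 (r / s)" for z :: complex
    using that s by (simp add: norm_mult field_simps)
  show "(\<lambda>z. h (of_real s * z) / of_real c) holomorphic_on ball 0 (r / s)"
  proof -
    have "(\<lambda>z. h (of_real s * z)) holomorphic_on ball 0 (r / s)"
      by (rule holomorphic_on_compose_gen[OF _ ridgeD(1)[OF h], unfolded o_def])
         (use inb in \<open>auto intro!: holomorphic_intros\<close>)
    then show ?thesis using c by (auto intro!: holomorphic_intros)
  qed
  show "\<forall>z\<in>ball 0 (r / s). Re (z\<^sup>2 * (h (of_real s * z) / of_real c))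
      \<le> Re ((of_real (Re z))\<^sup>2 * (h (of_real s * of_real (Re z)) / of_real c))"
  proof
    fix z :: complex assume z: "z \<in> ball 0 (r / s)"
    have *: "w\<^sup>2 * (h (of_real s * w) / of_real c)
        = of_real (1 / (s\<^sup>2 * c)) * ((of_real s * w)\<^sup>2 * h (of_real s * w))" for w
      using s c by (simp add: field_simps power2_eq_square)
    have "Re ((of_real s * z)\<^sup>2 * h (of_real s * z))
       \<le> Re ((of_real s * of_real (Re z))\<^sup>2 * h (of_real s * of_real (Re z)))"
      using ridgeD(2)[OF h, of "of_real s * z"] inb[OF z] by simp
    then show "Re (z\<^sup>2 * (h (of_real s * z) / of_real c))
      \<le> Re ((of_real (Re z))\<^sup>2 * (h (of_real s * of_real (Re z)) / of_real c))"
      unfolding * Re_of_real_mult using s c by (intro mult_left_mono) (auto simp del: of_real_mult)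
  qed
qed

text \<open>
  In the strip \<open>\<bar>Re z\<bar> < Y\<close> the ridge property makes \<open>\<alpha> - Re (z\<^sup>2 h z)\<close> nonnegative, however high up
  \<open>z\<close> lies.  Hence Harnack's inequality can be iterated along balls of radius \<open>Y\<close> centred on the
  imaginary axis; climbing to height \<open>t\<close> takes about \<open>2 \<bar>t\<bar> / Y\<close> steps and costs a factor \<open>3\<close> for each.
\<close>
lemma ridge_imaginary_chain:
  assumes h: "ridge 1 h" and Y: "0 < Y" and tY: "\<bar>t\<bar> + Y \<le> 1" and \<alpha>: "0 \<le> \<alpha>"
    and le: "\<And>y::real. \<bar>y\<bar> < Y \<Longrightarrow> Re ((of_real y)\<^sup>2 * h (of_real y)) \<le> \<alpha>"
  shows "t\<^sup>2 * norm (h (\<i> * of_real t)) \<le> 4 * \<alpha> * exp (3 * \<bar>t\<bar> / Y)"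
proof -
  define G where "G z = of_real \<alpha> - z\<^sup>2 * h z" for z
  define n where "n = nat \<lceil>2 * \<bar>t\<bar> / Y\<rceil>"
  have n1: "2 * \<bar>t\<bar> / Y \<le> real n" unfolding n_def by linarith
  have "0 \<le> 2 * \<bar>t\<bar> / Y" using Y by simp
  then have n2: "real n \<le> 2 * \<bar>t\<bar> / Y + 1" unfolding n_def by linarith
  have step: "norm (G (\<i> * of_real (real (Suc k) * (t / n)))) \<le> 3 * norm (G (\<i> * of_real (real k * (t / n))))"
    if k: "k < n" for k
  proof (rule harnack_half_ball[where r = Y and G = G and c = "\<i> * of_real (real k * (t / n))"])
    have kt: "\<bar>real k * (t / n)\<bar> \<le> \<bar>t\<bar>"
      using k mult_left_mono[of "real k" "real n" "\<bar>t\<bar>"] by (simp add: abs_mult field_simps)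
    have sub: "norm z < 1 \<and> \<bar>Re z\<bar> < Y" if "z \<in> ball (\<i> * of_real (real k * (t / n))) Y" for z
    proof -
      have d: "norm (z - \<i> * of_real (real k * (t / n))) < Y" using that by (simp add: dist_norm norm_minus_commute)
      have "norm z \<le> norm (z - \<i> * of_real (real k * (t / n))) + norm (\<i> * of_real (real k * (t / n)))"
        by (metis norm_triangle_sub add.commute)
      moreover have "norm (\<i> * of_real (real k * (t / n)) :: complex) = \<bar>real k * (t / n)\<bar>"
        by (simp add: norm_mult abs_mult norm_divide)
      ultimately have "norm z < 1" using d kt tY by linarith
      moreover have "\<bar>Re (z - \<i> * of_real (real k * (t / n)))\<bar> < Y" using d abs_Re_le_cmod le_less_trans by blast
      ultimately show ?thesis by simp
    qed
    have "ball (\<i> * of_real (real k * (t / n))) Y \<subseteq> ball 0 1" using sub by auto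
    then have hb: "h holomorphic_on ball (\<i> * of_real (real k * (t / n))) Y"
      by (rule holomorphic_on_subset[OF ridgeD(1)[OF h]])
    show "G holomorphic_on ball (\<i> * of_real (real k * (t / n))) Y"
      unfolding G_def by (intro holomorphic_intros hb)
    show "0 < Y" by (rule Y)
    show "0 \<le> Re (G z)" if "z \<in> ball (\<i> * of_real (real k * (t / n))) Y" for z
      using sub[OF that] ridgeD(2)[OF h, of z] le[of "Re z"] unfolding G_def by simp
    have "dist (\<i> * of_real (real k * (t / n))) (\<i> * of_real (real (Suc k) * (t / n)) :: complex)
       = norm (\<i> * of_real (t / n) :: complex)"
      by (simp add: dist_norm algebra_simps norm_minus_commute add_divide_distrib norm_divide norm_mult)
    also have "\<dots> = \<bar>t\<bar> / n" by (simp add: norm_mult norm_divide)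
    also have "\<dots> \<le> Y / 2" using n1 Y k by (simp add: field_simps)
    finally show "dist (\<i> * of_real (real k * (t / n))) (\<i> * of_real (real (Suc k) * (t / n)) :: complex) \<le> Y / 2" .
  qed
  have "k \<le> n \<Longrightarrow> norm (G (\<i> * of_real (real k * (t / n)))) \<le> 3 ^ k * \<alpha>" for k
  proof (induction k)
    case 0 then show ?case using \<alpha> by (simp add: G_def)
  next
    case (Suc k)
    have "norm (G (\<i> * of_real (real (Suc k) * (t / n)))) \<le> 3 * norm (G (\<i> * of_real (real k * (t / n))))"
      using step Suc by simp
    also have "\<dots> \<le> 3 * (3 ^ k * \<alpha>)" using Suc by simp
    finally show ?case by (simp only: power_Suc mult.assoc)
  qed
  from this[of n] have Gn: "norm (G (\<i> * of_real (real n * (t / n)))) \<le> 3 ^ n * \<alpha>" by simp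
  have nt: "real n * (t / n) = t"
  proof (cases "n = 0")
    case True
    with n1 Y have "t = 0" by (simp add: divide_le_0_iff)
    then show ?thesis by simp
  qed simp
  have "t\<^sup>2 * norm (h (\<i> * of_real t)) = norm (of_real \<alpha> - G (\<i> * of_real t))"
    by (simp add: G_def norm_mult norm_power power_mult_distrib)
  also have "\<dots> \<le> \<alpha> + norm (G (\<i> * of_real t))"
    using norm_triangle_ineq4[of "of_real \<alpha> :: complex" "G (\<i> * of_real t)"] \<alpha> by simp
  also have "\<dots> \<le> \<alpha> + 3 ^ n * \<alpha>" using Gn nt by simp
  also have "\<dots> \<le> \<alpha> * (1 + 3 * exp (3 * \<bar>t\<bar> / Y))"
  proof -
    \<comment> \<open>Rounding the number of steps up and converting powers of three into exponentials.\<close>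
    have "(3::real)\<^sup>2 \<le> exp 3"
    proof -
      have "(3::real) \<le> exp (3/2)"
        using exp_lower_Taylor_quadratic[of "3/2::real"] by (simp add: power2_eq_square)
      then have "(3::real)\<^sup>2 \<le> (exp (3/2))\<^sup>2" by (intro power_mono) auto
      also have "(exp (3/2))\<^sup>2 = exp (3::real)" by (simp flip: exp_double)
      finally show ?thesis .
    qed
    then have l3: "2 * ln (3::real) \<le> 3"
      by (metis ln_exp ln_le_cancel_iff ln_realpow of_nat_numeral exp_gt_zero zero_less_numeral zero_less_power)
    have "(3::real) ^ n = exp (real n * ln 3)" by (simp add: exp_of_nat_mult)
    also have "\<dots> \<le> exp ((2 * \<bar>t\<bar> / Y + 1) * ln 3)" using n2 by (simp add: mult_right_mono)
    also have "(2 * \<bar>t\<bar> / Y + 1) * ln 3 = ln 3 + (\<bar>t\<bar> / Y) * (2 * ln (3::real))" by (simp add: algebra_simps)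
    also have "exp \<dots> = 3 * exp ((\<bar>t\<bar> / Y) * (2 * ln 3))" by (simp only: exp_add) simp
    also have "\<dots> \<le> 3 * exp ((\<bar>t\<bar> / Y) * 3)"
    proof -
      have "(\<bar>t\<bar> / Y) * (2 * ln 3) \<le> (\<bar>t\<bar> / Y) * 3" using Y by (intro mult_left_mono l3) simp
      then show ?thesis by simp
    qed
    finally have "(3::real) ^ n \<le> 3 * exp (3 * \<bar>t\<bar> / Y)" by (simp add: mult.commute)
    then have "(3::real) ^ n * \<alpha> \<le> 3 * exp (3 * \<bar>t\<bar> / Y) * \<alpha>" using \<alpha> by (rule mult_right_mono)
    then show ?thesis by (simp add: algebra_simps)
  qed
  also have "\<dots> \<le> \<alpha> * (4 * exp (3 * \<bar>t\<bar> / Y))"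
    using \<alpha> Y by (intro mult_left_mono) (auto simp: divide_nonneg_pos)
  finally show ?thesis by (simp add: mult_ac)
qed

text \<open>
  A wide strip keeps the Harnack cost \<open>exp (3 \<bar>t\<bar> / Y)\<close> small but lets the bound \<open>exp (b Y)\<close> on the real
  segment grow.  The choice \<open>Y = \<bar>t\<bar> / (1 + sqrt (b \<bar>t\<bar>))\<close> balances the two, and the exponential rate
  \<open>b \<bar>t\<bar>\<close> drops to its square root on the imaginary axis.
\<close>
lemma ridge_imaginary_bound:
  assumes h: "ridge 1 h" and b: "0 < b" and \<kappa>: "0 < \<kappa>" and \<beta>: "0 \<le> \<beta>"
    and maj: "\<And>z. norm z < 1 \<Longrightarrow> norm (h z) \<le> \<kappa> * exp (\<beta> + b * norm z)"
    and h0: "norm (h 0) \<le> \<kappa>" and t: "\<bar>t\<bar> \<le> 1 / 2"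
  shows "norm (h (\<i> * of_real t)) \<le> \<kappa> * exp (\<beta> + 5 + 4 * sqrt (b * \<bar>t\<bar>))"
proof (cases "t = 0")
  case True
  have "\<kappa> * 1 \<le> \<kappa> * exp (\<beta> + 5)" using \<kappa> \<beta> by (intro mult_left_mono) auto
  then show ?thesis using True h0 by simp
next
  case False
  define s where "s = sqrt (b * \<bar>t\<bar>)"
  have s: "s > 0" "s\<^sup>2 = b * \<bar>t\<bar>" using False b by (auto simp: s_def)
  define Y where "Y = \<bar>t\<bar> / (1 + s)"
  have Y: "0 < Y" "Y \<le> \<bar>t\<bar>" using False s by (auto simp: Y_def field_simps)
  have bY: "b * Y \<le> s" using s by (simp add: Y_def field_simps power2_eq_square)
  have tY: "\<bar>t\<bar> / Y = 1 + s" using False s by (simp add: Y_def)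
  have "t\<^sup>2 * norm (h (\<i> * of_real t)) \<le> 4 * (Y\<^sup>2 * (\<kappa> * exp (\<beta> + b * Y))) * exp (3 * \<bar>t\<bar> / Y)"
  proof (rule ridge_imaginary_chain[OF h Y(1)])
    show "\<bar>t\<bar> + Y \<le> 1" using Y t by simp
    show "0 \<le> Y\<^sup>2 * (\<kappa> * exp (\<beta> + b * Y))" using \<kappa> by simp
    show "Re ((of_real y)\<^sup>2 * h (of_real y)) \<le> Y\<^sup>2 * (\<kappa> * exp (\<beta> + b * Y))" if y: "\<bar>y\<bar> < Y" for y :: real
    proof -
      have "Re ((of_real y)\<^sup>2 * h (of_real y)) \<le> norm ((of_real y)\<^sup>2 * h (of_real y))" by (rule complex_Re_le_cmod)
      also have "\<dots> = y\<^sup>2 * norm (h (of_real y))" by (simp add: norm_mult norm_power)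
      also have "\<dots> \<le> Y\<^sup>2 * (\<kappa> * exp (\<beta> + b * Y))"
      proof (rule mult_mono)
        show "y\<^sup>2 \<le> Y\<^sup>2" using y by (metis abs_le_square_iff abs_of_pos Y(1) less_imp_le)
        have "norm (h (of_real y)) \<le> \<kappa> * exp (\<beta> + b * \<bar>y\<bar>)" using maj[of "of_real y"] y Y t by simp
        also have "\<dots> \<le> \<kappa> * exp (\<beta> + b * Y)" using \<kappa> b y by simp
        finally show "norm (h (of_real y)) \<le> \<kappa> * exp (\<beta> + b * Y)" .
      qed auto
      finally show ?thesis .
    qed
  qed
  also have "\<dots> = Y\<^sup>2 * (4 * (\<kappa> * exp (\<beta> + b * Y + 3 * (1 + s))))"
  proof -
    have "3 * \<bar>t\<bar> / Y = 3 * (1 + s)" by (simp add: tY flip: times_divide_eq_right)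
    then show ?thesis by (simp only: exp_add mult_ac)
  qed
  also have "\<dots> \<le> t\<^sup>2 * (\<kappa> * exp (\<beta> + 5 + 4 * s))"
  proof (rule mult_mono)
    show "Y\<^sup>2 \<le> t\<^sup>2" using Y by (metis abs_le_square_iff abs_of_pos)
    have "4 \<le> exp (2::real)" using exp_lower_Taylor_quadratic[of "2::real"] by (simp add: power2_eq_square)
    then have "4 * (\<kappa> * exp (\<beta> + b * Y + 3 * (1 + s))) \<le> exp 2 * (\<kappa> * exp (\<beta> + b * Y + 3 * (1 + s)))"
      using \<kappa> by (intro mult_right_mono) auto
    also have "\<dots> = \<kappa> * exp (2 + (\<beta> + b * Y + 3 * (1 + s)))" by (simp only: exp_add mult_ac)
    also have "\<dots> \<le> \<kappa> * exp (\<beta> + 5 + 4 * s)" using \<kappa> bY by simp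
    finally show "4 * (\<kappa> * exp (\<beta> + b * Y + 3 * (1 + s))) \<le> \<kappa> * exp (\<beta> + 5 + 4 * s)" .
  qed (use \<kappa> in auto)
  finally show ?thesis using False by (simp add: s_def)
qed

lemma csqrt_one_plus_bounds:
  assumes z: "0 \<le> Re z" and b: "0 < b"
  shows "sqrt (b * \<bar>Im z\<bar>) * (2/3) \<le> Re (csqrt (1 + of_real b * z))"
    and "norm (csqrt (1 + of_real b * z)) \<le> 1 + sqrt (b * norm z)"
proof -
  let ?w = "1 + of_real b * z"
  have "b * \<bar>Im z\<bar> = \<bar>Im ?w\<bar>" using b by (simp add: abs_mult)
  also have "\<dots> \<le> norm ?w" by (rule abs_Im_le_cmod)
  finally have 1: "b * \<bar>Im z\<bar> \<le> norm ?w" .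
  have "0 \<le> Re ?w" using z b by simp
  moreover have "x * (4/9) \<le> (y + u) / 2" if "x \<le> y" "0 \<le> y" "0 \<le> u" for x y u :: real
    using that by simp
  ultimately have "b * \<bar>Im z\<bar> * (4/9) \<le> (norm ?w + Re ?w) / 2" using 1 norm_ge_zero by blast
  then have "sqrt (b * \<bar>Im z\<bar> * (4/9)) \<le> sqrt ((norm ?w + Re ?w) / 2)" by (rule real_sqrt_le_mono)
  moreover have "sqrt (b * \<bar>Im z\<bar> * (4/9)) = sqrt (b * \<bar>Im z\<bar>) * sqrt ((2/3)\<^sup>2)"
    by (subst real_sqrt_mult[symmetric]) (simp add: power2_eq_square)
  moreover have "sqrt ((2/3)\<^sup>2) = (2/3::real)" by simp
  ultimately show "sqrt (b * \<bar>Im z\<bar>) * (2/3) \<le> Re (csqrt ?w)" by (simp only: csqrt.sel)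
  have "norm ?w \<le> 1 + b * norm z" using norm_triangle_ineq[of 1 "of_real b * z"] b by (simp add: norm_mult)
  then have "norm (csqrt ?w) \<le> sqrt (1 + b * norm z)" by simp
  also have "\<dots> \<le> sqrt 1 + sqrt (b * norm z)" using b by (intro sqrt_add_le_add_sqrt) auto
  finally show "norm (csqrt ?w) \<le> 1 + sqrt (b * norm z)" by simp
qed

text \<open>
  A Phragmen-Lindelof argument.  On the imaginary axis \<open>h\<close> grows at most like \<open>exp (4 sqrt (b \<bar>t\<bar>))\<close>,
  which \<open>exp (6 csqrt (1 + b z))\<close> dominates; on the arc it is at most \<open>1 \<le> \<kappa> exp K\<close>, which
  \<open>exp (K (4 z - 4 z\<^sup>2))\<close> dominates, since \<open>Re (4 z - 4 z\<^sup>2)\<close> is at least \<open>1\<close> there and nonnegative on the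
  axis.  Both weights are harmless near the origin: there the second exponent is only linear in \<open>z\<close>, with
  a slope proportional to \<open>K\<close> instead of the rate \<open>b\<close> of the hypothesis.
\<close>
lemma ridge_right_half_disc:
  assumes h: "ridge 1 h" and h1: "\<And>z. norm z < 1 \<Longrightarrow> norm (h z) \<le> 1"
    and b: "0 < b" and \<kappa>: "0 < \<kappa>" and \<beta>: "0 \<le> \<beta>"
    and maj: "\<And>z. norm z < 1 \<Longrightarrow> norm (h z) \<le> \<kappa> * exp (\<beta> + b * norm z)"
    and h0: "norm (h 0) \<le> \<kappa>" and K: "1 \<le> \<kappa> * exp K" "0 \<le> K"
    and z: "0 \<le> Re z" "norm z \<le> 1 / 2"
  shows "norm (h z) \<le> \<kappa> * exp (\<beta> + 11 + 6 * sqrt (b * norm z) + 6 * K * norm z)"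
proof -
  define E where "E z = 6 * csqrt (1 + of_real b * z) + of_real K * (4 * z - 4 * z\<^sup>2)" for z
  define S where "S = {z. 0 \<le> Re z} \<inter> cball 0 (1/2)"
  have S1: "norm z < 1" "norm z \<le> 1/2" "0 \<le> Re z" if "z \<in> S" for z using that by (auto simp: S_def)
  have hS: "h holomorphic_on S"
    by (rule holomorphic_on_subset[OF ridgeD(1)[OF h]]) (auto simp: S1)
  have ES: "E holomorphic_on S"
  proof -
    have "1 + of_real b * z \<notin> \<real>\<^sub>\<le>\<^sub>0" if "z \<in> S" for z
    proof -
      have "0 < Re (1 + of_real b * z)" using S1(3)[OF that] b by (simp add: add_pos_nonneg)
      then show ?thesis by (auto simp: complex_nonpos_Reals_iff)
    qed
    then show ?thesis unfolding E_def by (auto intro!: holomorphic_intros)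
  qed
  have FS: "(\<lambda>z. h z * exp (- E z)) holomorphic_on S"
    by (intro holomorphic_intros hS ES)
  have cS: "closed S" unfolding S_def by (intro closed_Int closed_cball closed_halfspace_Re_ge)
  have front: "norm (h z * exp (- E z)) \<le> \<kappa> * exp (\<beta> + 5)" if zf: "z \<in> frontier S" for z
  proof -
    have zS: "z \<in> S" using zf cS frontier_subset_closed by blast
    have "z \<in> frontier {z. 0 \<le> Re z} \<union> frontier (cball 0 (1/2))"
      using zf frontier_Int_subset[of "{z. 0 \<le> Re z}" "cball 0 (1/2)"] unfolding S_def by auto
    then have or: "Re z = 0 \<or> norm z = 1/2"
    proof
      assume "z \<in> frontier {z. 0 \<le> Re z}"
      then have "z \<notin> interior {z. 0 \<le> Re z}" by (simp add: frontier_def)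
      moreover have "z \<in> interior {z. 0 \<le> Re z}" if "0 < Re z"
        by (rule interiorI[of "{z. 0 < Re z}"]) (use that in \<open>auto intro: open_halfspace_Re_gt\<close>)
      ultimately show ?thesis using S1(3)[OF zS] by fastforce
    next
      assume "z \<in> frontier (cball 0 (1/2))"
      then show ?thesis by simp
    qed
    have nE: "norm (h z * exp (- E z)) = norm (h z) * exp (- Re (E z))" by (simp add: norm_mult)
    have ReE: "Re (E z) = 6 * Re (csqrt (1 + of_real b * z)) + K * (4 * Re z - 4 * (Re z)\<^sup>2 + 4 * (Im z)\<^sup>2)"
      unfolding E_def by (simp only: plus_complex.sel Re_of_real_mult minus_complex.sel
          mult_numeral_1 numeral_One) (simp add: power2_eq_square)
    have cs: "sqrt (b * \<bar>Im z\<bar>) * (2/3) \<le> Re (csqrt (1 + of_real b * z))"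
      by (rule csqrt_one_plus_bounds(1)[OF S1(3)[OF zS] b])
    from or show ?thesis
    proof
      assume r0: "Re z = 0"
      then have zi: "z = \<i> * of_real (Im z)" by (simp add: complex_eq_iff)
      have "norm z = \<bar>Im z\<bar>" using r0 by (simp add: cmod_def)
      then have "\<bar>Im z\<bar> \<le> 1/2" using S1(2)[OF zS] by simp
      from ridge_imaginary_bound[OF h b \<kappa> \<beta> maj h0 this] zi
      have "norm (h z) \<le> \<kappa> * exp (\<beta> + 5 + 4 * sqrt (b * \<bar>Im z\<bar>))" by simp
      moreover have "4 * sqrt (b * \<bar>Im z\<bar>) \<le> Re (E z)"
        using cs K(2) r0 unfolding ReE by (simp add: add_increasing2)
      ultimately have "norm (h z) * exp (- Re (E z)) \<le> \<kappa> * exp (\<beta> + 5 + 4 * sqrt (b * \<bar>Im z\<bar>)) * exp (- (4 * sqrt (b * \<bar>Im z\<bar>)))"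
        using \<kappa> by (intro mult_mono) auto
      also have "\<dots> = \<kappa> * exp (\<beta> + 5)" by (simp add: exp_add exp_minus)
      finally show ?thesis using nE by simp
    next
      assume n: "norm z = 1/2"
      then have sq: "(Re z)\<^sup>2 + (Im z)\<^sup>2 = 1/4" using cmod_power2[of z] unfolding n by (simp add: power_divide)
      have "Re z \<le> 1/2" using n complex_Re_le_cmod[of z] by simp
      then have "0 \<le> Re z * (1/2 - Re z)" using S1(3)[OF zS] by simp
      then have "1 \<le> 4 * Re z - 4 * (Re z)\<^sup>2 + 4 * (Im z)\<^sup>2"
        using sq by (simp add: algebra_simps power2_eq_square)
      then have "K * 1 \<le> K * (4 * Re z - 4 * (Re z)\<^sup>2 + 4 * (Im z)\<^sup>2)" using K(2) by (rule mult_left_mono)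
      moreover have "0 \<le> sqrt (b * \<bar>Im z\<bar>) * (2/3)" using b by simp
      ultimately have "K \<le> Re (E z)" using cs unfolding ReE by linarith
      then have "norm (h z) * exp (- Re (E z)) \<le> 1 * exp (- K)"
        using h1[OF S1(1)[OF zS]] by (intro mult_mono) auto
      also have "\<dots> \<le> \<kappa>" using K(1) by (simp add: exp_minus field_simps)
      also have "\<dots> \<le> \<kappa> * exp (\<beta> + 5)" using \<kappa> \<beta> by simp
      finally show ?thesis using nE by simp
    qed
  qed
  have "norm (h z * exp (- E z)) \<le> \<kappa> * exp (\<beta> + 5)"
  proof (rule maximum_modulus_frontier[of "\<lambda>z. h z * exp (- E z)" S])
    show "(\<lambda>z. h z * exp (- E z)) holomorphic_on interior S"
      using FS holomorphic_on_subset interior_subset by blast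
    show "continuous_on (closure S) (\<lambda>z. h z * exp (- E z))"
      using FS cS holomorphic_on_imp_continuous_on by (simp add: closure_closed)
    show "bounded S" unfolding S_def by (auto intro: bounded_Int)
    show "z \<in> S" using z by (auto simp: S_def)
  qed (use front in auto)
  then have "norm (h z) * exp (- Re (E z)) \<le> \<kappa> * exp (\<beta> + 5)" by (simp add: norm_mult)
  then have "norm (h z) \<le> \<kappa> * exp (\<beta> + 5) * exp (Re (E z))" by (simp add: exp_minus field_simps)
  also have "\<dots> = \<kappa> * exp (\<beta> + 5 + Re (E z))" by (simp only: exp_add mult.assoc)
  also have "\<dots> \<le> \<kappa> * exp (\<beta> + 11 + 6 * sqrt (b * norm z) + 6 * K * norm z)"
  proof -
    have "Re (csqrt (1 + of_real b * z)) \<le> 1 + sqrt (b * norm z)"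
      by (rule order_trans[OF complex_Re_le_cmod csqrt_one_plus_bounds(2)[OF z(1) b]])
    moreover have "Re (of_real K * (4 * z - 4 * z\<^sup>2)) \<le> K * (6 * norm z)"
    proof -
      have "Re (4 * z - 4 * z\<^sup>2) \<le> norm (4 * z - 4 * z\<^sup>2)" by (rule complex_Re_le_cmod)
      also have "\<dots> \<le> 4 * norm z + 4 * (norm z)\<^sup>2"
        using norm_triangle_ineq4[of "4*z" "4*z\<^sup>2"] by (simp add: norm_mult norm_power)
      also have "\<dots> \<le> 6 * norm z" using mult_right_mono[OF z(2), of "norm z"] by (simp add: power2_eq_square)
      finally show ?thesis unfolding Re_of_real_mult using K(2) by (rule mult_left_mono)
    qed
    ultimately have "Re (E z) \<le> 6 * (1 + sqrt (b * norm z)) + K * (6 * norm z)"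
      unfolding E_def by simp
    then have "\<beta> + 5 + Re (E z) \<le> \<beta> + 11 + 6 * sqrt (b * norm z) + 6 * K * norm z" by (simp add: algebra_simps)
    then show ?thesis using \<kappa> by (simp only: mult_le_cancel_left_pos exp_le_cancel_iff)
  qed
  finally show ?thesis .
qed

lemma ridge_half_disc:
  assumes h: "ridge 1 h" and h1: "\<And>z. norm z < 1 \<Longrightarrow> norm (h z) \<le> 1"
    and b: "0 < b" and \<kappa>: "0 < \<kappa>" and \<beta>: "0 \<le> \<beta>"
    and maj: "\<And>z. norm z < 1 \<Longrightarrow> norm (h z) \<le> \<kappa> * exp (\<beta> + b * norm z)"
    and h0: "norm (h 0) \<le> \<kappa>" and K: "1 \<le> \<kappa> * exp K" "0 \<le> K"
    and z: "norm z \<le> 1 / 2"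
  shows "norm (h z) \<le> \<kappa> * exp (\<beta> + 11 + 6 * sqrt (b * norm z) + 6 * K * norm z)"
proof (cases "0 \<le> Re z")
  case True
  show ?thesis by (rule ridge_right_half_disc[OF h h1 b \<kappa> \<beta> maj h0 K True z])
next
  case False
  have "norm (h (- (- z))) \<le> \<kappa> * exp (\<beta> + 11 + 6 * sqrt (b * norm (- z)) + 6 * K * norm (- z))"
    by (rule ridge_right_half_disc[OF ridge_reflect[OF h] _ b \<kappa> \<beta> _ _ K])
       (use False z h0 h1 maj[of "- w" for w] in auto)
  then show ?thesis by simp
qed

section \<open>Rigidity of ridge functions near the origin\<close>

text \<open>
  There are \<open>k \<ge> 3\<close> solutions \<open>w\<close> and at most two of them are \<open>\<plusminus>1\<close>.
\<close>
lemma nonreal_unimodular_root: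
  fixes a :: complex
  assumes a: "a \<noteq> 0" and k: "3 \<le> k"
  obtains w where "w ^ k * a = of_real (norm a)" "norm w = 1" "\<bar>Re w\<bar> < 1"
proof -
  let ?c = "of_real (norm a) / a"
  have c: "?c \<noteq> 0" "norm ?c = 1" using a by (auto simp: norm_divide)
  have card: "card {w. w ^ k = ?c} = k" using card_nth_roots[of ?c k] c k by auto
  have "\<not> {w. w ^ k = ?c} \<subseteq> {1, -1}"
  proof
    assume "{w. w ^ k = ?c} \<subseteq> {1, -1}"
    then have "card {w. w ^ k = ?c} \<le> card {1, -1::complex}" by (intro card_mono) auto
    also have "\<dots> \<le> 2" by (simp add: card_insert_if)
    finally show False using card k by simp
  qed
  then obtain w where w: "w ^ k = ?c" "w \<noteq> 1" "w \<noteq> -1" by auto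
  have "norm w ^ k = 1" using w(1) c(2) by (metis norm_power)
  then have nw: "norm w = 1" using k power_eq_imp_eq_base[of "norm w" k 1] by simp
  have "\<bar>Re w\<bar> \<le> 1" using abs_Re_le_cmod[of w] nw by simp
  moreover have "\<bar>Re w\<bar> \<noteq> 1"
  proof
    assume r: "\<bar>Re w\<bar> = 1"
    have "(Re w)\<^sup>2 + (Im w)\<^sup>2 = 1" using nw by (metis cmod_power2 one_power2)
    moreover have "(Re w)\<^sup>2 = 1" using r by (metis one_power2 power2_abs)
    ultimately have "Im w = 0" by simp
    with r w show False by (auto simp: complex_eq_iff abs_if split: if_splits)
  qed
  moreover have "w ^ k * a = of_real (norm a)" using w(1) a by simp
  ultimately show ?thesis using that nw by force
qed

text \<open>
  Near the origin a nonzero \<open>z\<^sup>2 h z\<close> behaves like \<open>a z\<^sup>k\<close> with \<open>k \<ge> 3\<close>.  Along a non-real direction in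
  which \<open>a z\<^sup>k\<close> is positive its real part exceeds that at the projected real point, against the ridge
  property.  For \<open>k = 2\<close> no such contradiction arises, which is why \<open>h 0\<close> controls \<open>h\<close>.
\<close>
lemma ridge_vanishing_at_0:
  assumes h: "ridge r h" and r: "0 < r" and h0: "h 0 = 0" and z: "norm z < r"
  shows "h z = 0"
proof (rule ccontr)
  assume nz: "h z \<noteq> 0"
  have nc: "\<not> h constant_on ball 0 r"
    using nz h0 z r unfolding constant_on_def by (metis centre_in_ball mem_ball_0)
  obtain g s n where n: "0 < n" and s: "0 < s" "ball (0::complex) s \<subseteq> ball 0 r"
    and g: "g holomorphic_on ball 0 s" and hg: "\<And>w. w \<in> ball 0 s \<Longrightarrow> h w = (w - 0) ^ n * g w"
    and gnz: "\<And>w. w \<in> ball 0 s \<Longrightarrow> g w \<noteq> 0"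
  proof (rule holomorphic_factor_zero_nonconstant[OF ridgeD(1)[OF h] open_ball connected_ball _ h0 nc])
    show "0 \<in> ball (0::complex) r" using r by simp
  qed (rule that)
  have "g 0 \<noteq> 0" using gnz s by simp
  then obtain w where w: "w ^ (n + 2) * g 0 = of_real (norm (g 0))" "norm w = 1" "\<bar>Re w\<bar> < 1"
    using nonreal_unimodular_root[of "g 0" "n + 2"] n by auto
  have ineq: "Re (w ^ (n + 2) * g (of_real e * w)) \<le> Re ((of_real (Re w)) ^ (n + 2) * g (of_real e * of_real (Re w)))"
    if e: "0 < e" "e < s" for e :: real
  proof -
    have in1: "of_real e * w \<in> ball 0 s" using e w by (simp add: norm_mult)
    have in2: "of_real e * of_real (Re w) \<in> ball (0::complex) s"
    proof -
      have "e * \<bar>Re w\<bar> \<le> e * 1" using e w by (intro mult_left_mono) auto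
      then have "e * \<bar>Re w\<bar> < s" using e by linarith
      then show ?thesis using e by (simp add: norm_mult)
    qed
    have "Re ((of_real e * w)\<^sup>2 * h (of_real e * w))
       \<le> Re ((of_real e * of_real (Re w))\<^sup>2 * h (of_real e * of_real (Re w)))"
      using ridgeD(2)[OF h, of "of_real e * w"] in1 s(2) by auto
    also have "(of_real e * w)\<^sup>2 * h (of_real e * w) = of_real (e ^ (n + 2)) * (w ^ (n + 2) * g (of_real e * w))"
      using hg[OF in1] by (simp add: power_mult_distrib power_add power2_eq_square mult_ac)
    also have "(of_real e * of_real (Re w))\<^sup>2 * h (of_real e * of_real (Re w))
        = of_real (e ^ (n + 2)) * ((of_real (Re w)) ^ (n + 2) * g (of_real e * of_real (Re w)))"
      using hg[OF in2] by (simp add: power_mult_distrib power_add power2_eq_square mult_ac)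
    finally show ?thesis unfolding Re_of_real_mult using e by (simp del: power_Suc add_2_eq_Suc')
  qed
  have gc: "continuous (at 0) g"
    using g s by (metis holomorphic_on_imp_continuous_on continuous_on_eq_continuous_at open_ball centre_in_ball)
  have lim: "((\<lambda>e::real. Re (c ^ (n + 2) * g (of_real e * c))) \<longlongrightarrow> Re (c ^ (n + 2) * g 0)) (at_right 0)" for c :: complex
  proof -
    have "((\<lambda>e::real. of_real e * c) \<longlongrightarrow> 0) (at_right 0)"
      by (rule tendsto_eq_intros refl | simp)+
    then have "((\<lambda>e::real. g (of_real e * c)) \<longlongrightarrow> g 0) (at_right 0)"
      using gc isCont_tendsto_compose by blast
    then show ?thesis by (intro tendsto_intros)
  qed
  have "Re (w ^ (n + 2) * g 0) \<le> Re ((of_real (Re w)) ^ (n + 2) * g 0)"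
    by (rule tendsto_le[OF _ lim lim])
       (use s ineq in \<open>auto intro!: eventually_at_rightI[of 0 s]\<close>)
  also have "\<dots> \<le> norm ((of_real (Re w)) ^ (n + 2) * g 0)" by (rule complex_Re_le_cmod)
  also have "\<dots> = \<bar>Re w\<bar> ^ (n + 2) * norm (g 0)" by (simp add: norm_mult norm_power power_abs)
  also have "\<dots> < 1 * norm (g 0)"
    using w \<open>g 0 \<noteq> 0\<close> by (intro mult_strict_right_mono power_less_one_iff[THEN iffD2]) auto
  finally show False unfolding w(1) by simp
qed

text \<open>
  The quantitative form of the preceding rigidity: by Montel's theorem a sequence of ridge functions with
  \<open>h 0\<close> tending to \<open>0\<close> would have a limit that is again ridge and vanishes at \<open>0\<close>, hence everywhere.
\<close>
lemma ridge_compactness: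
  "\<exists>\<beta>\<ge>0. \<forall>h. ridge 2 h \<longrightarrow> (\<forall>z\<in>ball 0 2. norm (h z) \<le> M) \<longrightarrow> (\<exists>z. norm z \<le> 1 \<and> 1 \<le> norm (h z))
     \<longrightarrow> exp (- \<beta>) \<le> norm (h 0)"
proof (rule ccontr)
  assume "\<not> ?thesis"
  then have "\<forall>n::nat. \<exists>h. ridge 2 h \<and> (\<forall>z\<in>ball 0 2. norm (h z) \<le> M) \<and> (\<exists>z. norm z \<le> 1 \<and> 1 \<le> norm (h z))
     \<and> norm (h 0) < exp (- real n)"
    by (metis not_le of_nat_0_le_iff)
  then obtain f where f: "\<And>n. ridge 2 (f n)" "\<And>n z. z \<in> ball 0 2 \<Longrightarrow> norm (f n z) \<le> M"
     "\<And>n. \<exists>z. norm z \<le> 1 \<and> 1 \<le> norm (f n z)" "\<And>n. norm (f n 0) < exp (- real n)"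
    by metis
  obtain g r where g: "g holomorphic_on ball 0 2" and r: "strict_mono (r :: nat \<Rightarrow> nat)"
    and lim: "\<And>x. x \<in> ball 0 2 \<Longrightarrow> (\<lambda>n. f (r n) x) \<longlonglongrightarrow> g x"
    and ul: "\<And>K. \<lbrakk>compact K; K \<subseteq> ball 0 2\<rbrakk> \<Longrightarrow> uniform_limit K (f \<circ> r) g sequentially"
  proof (rule Montel[of "ball 0 2" "range f" f])
    show "\<And>h. h \<in> range f \<Longrightarrow> h holomorphic_on ball 0 2" using f(1) ridgeD(1) by blast
    show "\<exists>B. \<forall>h\<in>range f. \<forall>z\<in>K. norm (h z) \<le> B" if "compact K" "K \<subseteq> ball 0 2" for K
      using f(2) that by blast
  qed auto
  have g0: "g 0 = 0"
  proof -
    have "(\<lambda>n. exp (- real (r n))) \<longlonglongrightarrow> 0"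
      using filterlim_compose[OF exp_at_bot filterlim_uminus_at_top[THEN iffD1,
          OF filterlim_compose[OF filterlim_real_sequentially filterlim_subseq[OF r]]]] .
    then have "(\<lambda>n. f (r n) 0) \<longlonglongrightarrow> 0"
      by (rule Lim_null_comparison[rotated]) (use f(4) less_imp_le in \<open>auto intro!: always_eventually\<close>)
    then show ?thesis using lim[of 0] LIMSEQ_unique by auto
  qed
  have "ridge 2 g"
    unfolding ridge_def
  proof (intro conjI ballI)
    fix z :: complex assume z: "z \<in> ball 0 2"
    then have z': "of_real (Re z) \<in> ball (0::complex) 2"
      using abs_Re_le_cmod[of z] by simp
    show "Re (z\<^sup>2 * g z) \<le> Re ((of_real (Re z))\<^sup>2 * g (of_real (Re z)))"
    proof (rule LIMSEQ_le)
      show "(\<lambda>n. Re (z\<^sup>2 * f (r n) z)) \<longlonglongrightarrow> Re (z\<^sup>2 * g z)" by (intro tendsto_intros lim z)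
      show "(\<lambda>n. Re ((of_real (Re z))\<^sup>2 * f (r n) (of_real (Re z)))) \<longlonglongrightarrow> Re ((of_real (Re z))\<^sup>2 * g (of_real (Re z)))"
        by (intro tendsto_intros lim z')
      show "\<exists>N. \<forall>n\<ge>N. Re (z\<^sup>2 * f (r n) z) \<le> Re ((of_real (Re z))\<^sup>2 * f (r n) (of_real (Re z)))"
        using ridgeD(2)[OF f(1)] z by auto
    qed
  qed (rule g)
  then have gz: "g z = 0" if "norm z < 2" for z
    using ridge_vanishing_at_0[of 2 g z] g0 that by auto
  have "uniform_limit (cball 0 1) (f \<circ> r) g sequentially" by (rule ul) auto
  then have "eventually (\<lambda>n. \<forall>x\<in>cball 0 1. dist ((f \<circ> r) n x) (g x) < 1) sequentially"
    by (rule uniform_limitD) simp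
  then obtain n :: nat where n: "\<forall>x\<in>cball 0 1. dist ((f \<circ> r) n x) (g x) < 1"
    by (auto simp: eventually_sequentially)
  obtain z where "norm z \<le> 1" "1 \<le> norm (f (r n) z)" using f(3) by blast
  moreover have "g z = 0" by (rule gz) (use \<open>norm z \<le> 1\<close> in simp)
  moreover have "dist ((f \<circ> r) n z) (g z) < 1" using n \<open>norm z \<le> 1\<close> by simp
  ultimately show False by simp
qed

section \<open>Self-improvement of the growth rate\<close>

text \<open>
  If \<open>norm (h z)\<close> exceeded \<open>norm (h 0) exp \<beta>\<close>, then up to radius \<open>2 norm z\<close> the function would be at
  most \<open>exp (2 L)\<close> times its size at \<open>z\<close>.  Rescaling \<open>norm z\<close> to \<open>1\<close> and dividing by that size puts
  it in the position of \<open>ridge_compactness\<close>, which bounds it at \<open>0\<close> from below.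
\<close>
lemma ridge_small_growth:
  assumes h: "ridge 1 h" and \<kappa>: "0 < norm (h 0)" and b: "0 \<le> b" and \<beta>: "0 \<le> \<beta>"
    and maj: "\<And>z. norm z < 1 \<Longrightarrow> norm (h z) \<le> norm (h 0) * exp (\<beta> + b * norm z)"
    and comp: "\<And>g. ridge 2 g \<Longrightarrow> (\<And>z. z \<in> ball 0 2 \<Longrightarrow> norm (g z) \<le> exp (2 * L)) \<Longrightarrow>
       (\<exists>z. norm z \<le> 1 \<and> 1 \<le> norm (g z)) \<Longrightarrow> exp (- \<beta>) \<le> norm (g 0)"
    and z: "norm z < 1 / 2" "b * norm z \<le> L"
  shows "norm (h z) \<le> norm (h 0) * exp \<beta>"
proof (rule ccontr)
  assume neg: "\<not> ?thesis"
  define Y where "Y = norm z"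
  have Y: "0 < Y"
  proof (rule ccontr)
    assume "\<not> 0 < Y"
    then have "z = 0" by (simp add: Y_def)
    then show False using neg \<kappa> \<beta> by simp
  qed
  define s where "s = norm (h z)"
  have s: "s > norm (h 0) * exp \<beta>" using neg by (simp add: s_def)
  have s0: "s > 0" using s \<kappa> by (smt (verit) exp_gt_zero mult_pos_pos)
  define g where "g w = h (of_real Y * w) / of_real s" for w
  have "ridge (1 / Y) g" unfolding g_def by (rule ridge_rescale[OF h Y s0])
  moreover have "2 \<le> 1 / Y" using z(1) Y by (simp add: Y_def field_simps)
  ultimately have rg: "ridge 2 g"
    unfolding ridge_def using holomorphic_on_subset[of g "ball 0 (1/Y)" "ball 0 2"] by force
  have "exp (- \<beta>) \<le> norm (g 0)"
  proof (rule comp[OF rg])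
    fix w :: complex assume w: "w \<in> ball 0 2"
    have nw: "norm (of_real Y * w) = Y * norm w" using Y by (simp add: norm_mult)
    have "Y * norm w \<le> Y * 2" using w Y by (intro mult_left_mono) auto
    then have l: "Y * norm w < 1" "b * (Y * norm w) \<le> 2 * L"
      using z b mult_left_mono[of "Y * norm w" "Y * 2" b] by (auto simp: Y_def)
    have "norm (h (of_real Y * w)) \<le> norm (h 0) * exp (\<beta> + b * (Y * norm w))"
      using maj[of "of_real Y * w"] nw l by simp
    also have "\<dots> \<le> norm (h 0) * exp (\<beta> + 2 * L)" using l \<kappa> by simp
    also have "\<dots> = norm (h 0) * exp \<beta> * exp (2 * L)" by (simp add: exp_add)
    also have "\<dots> \<le> s * exp (2 * L)" using s by simp
    finally show "norm (g w) \<le> exp (2 * L)" using s0 by (simp add: g_def norm_divide field_simps)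
  next
    have "norm (z / of_real Y) \<le> 1" by (simp add: norm_divide Y_def)
    moreover have "norm (g (z / of_real Y)) = 1" using Y s0 by (simp add: g_def norm_divide s_def)
    ultimately show "\<exists>z. norm z \<le> 1 \<and> 1 \<le> norm (g z)" by fastforce
  qed
  also have "norm (g 0) = norm (h 0) / s" using s0 by (simp add: g_def norm_divide)
  finally have "s \<le> norm (h 0) * exp \<beta>" using s0 by (simp add: exp_minus field_simps)
  with s show False by simp
qed

text \<open>
  This self-improvement is the heart of the argument.  The rate \<open>b\<close> enters the half-disc bound only
  through \<open>sqrt (b norm z)\<close>, so as long as \<open>b\<close> is large against \<open>K\<close> the rate can be lowered without
  touching \<open>\<beta>\<close>: for \<open>b norm z \<ge> 1024\<close> the gain absorbs the additive constants, and for smaller \<open>b norm z\<close>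
  compactness provides the bound \<open>exp \<beta>\<close> directly.
\<close>
lemma ridge_majorant_improve:
  assumes h: "ridge 1 h" and h1: "\<And>z. norm z < 1 \<Longrightarrow> norm (h z) \<le> 1"
    and \<kappa>: "0 < norm (h 0)" and K: "1 \<le> norm (h 0) * exp K" "1024 \<le> K" and \<beta>: "0 \<le> \<beta>"
    and comp: "\<And>g. ridge 2 g \<Longrightarrow> (\<And>z. z \<in> ball 0 2 \<Longrightarrow> norm (g z) \<le> exp (2 * 1024)) \<Longrightarrow>
       (\<exists>z. norm z \<le> 1 \<and> 1 \<le> norm (g z)) \<Longrightarrow> exp (- \<beta>) \<le> norm (g 0)"
    and b: "24 * K \<le> b"
    and maj: "\<And>z. norm z < 1 \<Longrightarrow> norm (h z) \<le> norm (h 0) * exp (\<beta> + b * norm z)"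
    and z: "norm z < 1"
  shows "norm (h z) \<le> norm (h 0) * exp (\<beta> + 3 / 4 * b * norm z)"
proof -
  have b0: "0 < b" using b K by simp
  consider (far) "norm z \<ge> 1/2" | (mid) "norm z < 1/2" "b * norm z \<ge> 1024"
    | (near) "norm z < 1/2" "b * norm z \<le> 1024" by linarith
  then show ?thesis
  proof cases
    case far
    have "K * 1 \<le> (3 / 4 * b) * (2 * norm z * (1/2))" using far b K
      by (intro order_trans[OF _ mult_left_mono[of "1/2" "2 * norm z * (1/2)" "3/4 * b"]]) auto
    then have "K \<le> \<beta> + 3 / 4 * b * norm z" using \<beta> by simp
    then have "norm (h 0) * exp K \<le> norm (h 0) * exp (\<beta> + 3 / 4 * b * norm z)" using \<kappa> by simp
    then show ?thesis using h1[OF z] K(1) by linarith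
  next
    case mid
    define x where "x = sqrt (b * norm z)"
    have x2: "x * x = b * norm z" using b0 by (simp add: x_def)
    have "sqrt (32\<^sup>2) \<le> x" unfolding x_def using mid by (intro real_sqrt_le_mono) simp
    then have x: "32 \<le> x" by simp
    have "11 + 6 * x \<le> x * x / 4"
      using mult_right_mono[OF x, of x] x by linarith
    moreover have "6 * K * norm z \<le> b * norm z / 4"
      using mult_right_mono[OF b, of "norm z"] by simp
    ultimately have "\<beta> + 11 + 6 * sqrt (b * norm z) + 6 * K * norm z \<le> \<beta> + 3 / 4 * b * norm z"
      using x2 zero_le_square[of x] unfolding x_def[symmetric] by linarith
    then have "norm (h 0) * exp (\<beta> + 11 + 6 * sqrt (b * norm z) + 6 * K * norm z) \<le> norm (h 0) * exp (\<beta> + 3 / 4 * b * norm z)"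
      using \<kappa> by simp
    moreover have "norm (h z) \<le> norm (h 0) * exp (\<beta> + 11 + 6 * sqrt (b * norm z) + 6 * K * norm z)"
      by (rule ridge_half_disc[OF h h1 b0 \<kappa> \<beta> maj order_refl K(1)]) (use K mid in auto)
    ultimately show ?thesis by linarith
  next
    case near
    have "norm (h z) \<le> norm (h 0) * exp \<beta>"
    proof (rule ridge_small_growth[where L = 1024 and b = b, OF h \<kappa> less_imp_le[OF b0] \<beta>])
      show "norm (h w) \<le> norm (h 0) * exp (\<beta> + b * norm w)" if "norm w < 1" for w
        by (rule maj[OF that])
      show "exp (- \<beta>) \<le> norm (g 0)"
        if "ridge 2 g" "\<And>z. z \<in> ball 0 2 \<Longrightarrow> norm (g z) \<le> exp (2 * 1024)" "\<exists>z. norm z \<le> 1 \<and> 1 \<le> norm (g z)" for g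
        by (rule comp[OF that])
    qed (rule near)+
    also have "\<dots> \<le> norm (h 0) * exp (\<beta> + 3 / 4 * b * norm z)" using \<kappa> b0 by simp
    finally show ?thesis .
  qed
qed

text \<open>
  The bound \<open>h = O(h 0)\<close> on a disc whose radius shrinks only logarithmically in \<open>h 0\<close>.  The order is
  sharp: for \<open>z\<^sup>2 h z = \<kappa> (exp (x z) - 1 - x z) / x\<^sup>2\<close> the normalisation \<open>norm h \<le> 1\<close> on the unit disc
  permits \<open>x\<close> of order \<open>ln (1 / \<kappa>)\<close>.  The constant is named by a predicate because it is shared by
  statements about different probability spaces.
\<close>
definition ridge_constant :: "real \<Rightarrow> bool" where
  "ridge_constant C \<longleftrightarrow> 1 \<le> C \<and> (\<forall>h z. ridge 1 h \<longrightarrow> (\<forall>w. norm w < 1 \<longrightarrow> norm (h w) \<le> 1) \<longrightarrow> h 0 \<noteq> 0 \<longrightarrow>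
     C * norm z * (1 + ln (1 / norm (h 0))) \<le> 1 \<longrightarrow> norm (h z) \<le> C * norm (h 0))"

text \<open>
  The rates \<open>b\<close> for which \<open>norm h \<le> \<kappa> exp (\<beta> + b norm z)\<close> form a nonempty set that, by
  \<open>ridge_majorant_improve\<close>, contains with every \<open>b \<ge> 24 K\<close> also \<open>3/4 b\<close>.  So it contains a rate at most
  \<open>24 K\<close>, where \<open>K = 1024 + ln (1 / \<kappa>)\<close>, and then the exponent is bounded for \<open>norm z\<close> up to a multiple
  of \<open>1 / K\<close>.
\<close>
theorem ridge_constant_exists: "\<exists>C. ridge_constant C"
proof -
  obtain \<beta>0 where \<beta>0: "0 \<le> \<beta>0" and comp00: "\<forall>h. ridge 2 h \<longrightarrow> (\<forall>z\<in>ball 0 2. norm (h z) \<le> exp (2 * 1024)) \<longrightarrow>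
     (\<exists>z. norm z \<le> 1 \<and> 1 \<le> norm (h z)) \<longrightarrow> exp (- \<beta>0) \<le> norm (h 0)"
    using ridge_compactness[of "exp (2 * 1024)"] by (elim exE conjE)
  \<comment> \<open>The extra one leaves room for the continuity of the function at the origin, so that some rate is admissible at all.\<close>
  define \<beta> where "\<beta> = \<beta>0 + 1"
  have \<beta>: "0 \<le> \<beta>" "1 \<le> \<beta>" using \<beta>0 by (auto simp: \<beta>_def)
  have comp0: "exp (- \<beta>) \<le> norm (h 0)"
    if "ridge 2 h" "\<forall>z\<in>ball 0 2. norm (h z) \<le> exp (2 * 1024)" "\<exists>z. norm z \<le> 1 \<and> 1 \<le> norm (h z)" for h
  proof -
    have "exp (- \<beta>0) \<le> norm (h 0)" using comp00[rule_format, OF that(1) _ that(3)] that(2) by blast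
    moreover have "exp (- \<beta>) \<le> exp (- \<beta>0)" by (simp add: \<beta>_def)
    ultimately show ?thesis by linarith
  qed
  define C where "C = exp (\<beta> + 25 * 1024)"
  have C: "1 + (\<beta> + 25 * 1024) \<le> C" unfolding C_def by (rule exp_ge_add_one_self)
  have "norm (h z) \<le> C * norm (h 0)"
    if h: "ridge 1 h" and h1: "\<forall>w. norm w < 1 \<longrightarrow> norm (h w) \<le> 1" and nz: "h 0 \<noteq> 0"
      and z: "C * norm z * (1 + ln (1 / norm (h 0))) \<le> 1" for h z
  proof -
    define \<kappa> where "\<kappa> = norm (h 0)"
    have \<kappa>: "0 < \<kappa>" "\<kappa> \<le> 1" using nz h1 by (auto simp: \<kappa>_def)
    define K where "K = 1024 + ln (1 / \<kappa>)"
    have lnp: "0 \<le> ln (1 / \<kappa>)" using \<kappa> by simp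
    have K: "1024 \<le> K" "1 \<le> norm (h 0) * exp K"
    proof -
      show "1024 \<le> K" using lnp by (simp add: K_def)
      have "norm (h 0) * exp K = exp 1024"
        using \<kappa> unfolding K_def \<kappa>_def[symmetric] exp_add by simp
      then show "1 \<le> norm (h 0) * exp K" by simp
    qed
    define S where "S = {b. 0 \<le> b \<and> (\<forall>z. norm z < 1 \<longrightarrow> norm (h z) \<le> \<kappa> * exp (\<beta> + b * norm z))}"
    have "\<exists>b. b \<in> S"
    proof -
      have "isCont h 0"
        using ridgeD(1)[OF h] holomorphic_on_imp_continuous_on continuous_on_eq_continuous_at[of "ball 0 1" h] by auto
      moreover have "0 < (exp 1 - 1) * \<kappa>" using \<kappa> by simp
      ultimately obtain d where d: "d > 0" "\<And>z. norm z < d \<Longrightarrow> norm (h z - h 0) < (exp 1 - 1) * \<kappa>"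
        unfolding continuous_at_eps_delta dist_norm by (metis diff_zero)
      define b where "b = 1 / d + K / d"
      have b0: "0 \<le> b" using d K by (simp add: b_def)
      have "norm (h z) \<le> \<kappa> * exp (\<beta> + b * norm z)" if z: "norm z < 1" for z
      proof (cases "norm z < d")
        case True
        have "norm (h z) \<le> norm (h z - h 0) + norm (h 0)" by (metis norm_triangle_sub add.commute)
        also have "\<dots> \<le> \<kappa> * exp 1" using d(2)[OF True] by (simp add: \<kappa>_def algebra_simps)
        also have "\<dots> \<le> \<kappa> * exp (\<beta> + b * norm z)" using \<kappa> \<beta>(2) b0 by (simp add: add_increasing2)
        finally show ?thesis .
      next
        case False
        have "K \<le> b * d" using d by (simp add: b_def field_simps)
        also have "b * d \<le> b * norm z" using False d K by (intro mult_left_mono) (auto simp: b_def)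
        finally have "K \<le> \<beta> + b * norm z" using \<beta> by simp
        then have "\<kappa> * exp K \<le> \<kappa> * exp (\<beta> + b * norm z)" using \<kappa> by simp
        moreover have "norm (h z) \<le> 1" using h1 z by blast
        ultimately show ?thesis using K(2) unfolding \<kappa>_def by linarith
      qed
      with b0 show ?thesis unfolding S_def by blast
    qed
    have improve: "3 / 4 * b \<in> S" if "b \<in> S" "24 * K \<le> b" for b
      unfolding S_def mem_Collect_eq
    proof (intro conjI allI impI)
      show "0 \<le> 3 / 4 * b" using that(2) K(1) by simp
      fix z :: complex assume z: "norm z < 1"
      have b: "norm (h w) \<le> norm (h 0) * exp (\<beta> + b * norm w)" if "norm w < 1" for w
        using \<open>b \<in> S\<close> that unfolding S_def \<kappa>_def by blast
      show "norm (h z) \<le> \<kappa> * exp (\<beta> + 3 / 4 * b * norm z)"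
        unfolding \<kappa>_def
      proof (rule ridge_majorant_improve[OF h _ _ K(2,1) \<beta>(1) _ \<open>24 * K \<le> b\<close> b z])
        show "norm (h w) \<le> 1" if "norm w < 1" for w using h1 that by blast
        show "0 < norm (h 0)" using nz by simp
        show "exp (- \<beta>) \<le> norm (g 0)"
          if "ridge 2 g" "\<And>z. z \<in> ball 0 2 \<Longrightarrow> norm (g z) \<le> exp (2 * 1024)" "\<exists>z. norm z \<le> 1 \<and> 1 \<le> norm (g z)" for g
          by (rule comp0) (use that in blast)+
      qed
    qed
    have bdd: "bdd_below S" by (rule bdd_belowI[of _ 0]) (auto simp: S_def)
    have "\<exists>b\<in>S. b \<le> 24 * K"
    proof (rule ccontr)
      assume "\<not> ?thesis"
      then have big: "\<And>b. b \<in> S \<Longrightarrow> 24 * K < b" by force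
      have "24 * K \<le> Inf S" using \<open>\<exists>b. b \<in> S\<close> big by (intro cInf_greatest) (auto intro: less_imp_le)
      then have "Inf S < Inf S * (4/3)" using K by simp
      then obtain b where "b \<in> S" "b < Inf S * (4/3)"
        using cInf_less_iff[OF _ bdd] \<open>\<exists>b. b \<in> S\<close> by blast
      moreover have "Inf S \<le> 3 / 4 * b" using improve[OF \<open>b \<in> S\<close>] big[OF \<open>b \<in> S\<close>] bdd
        by (intro cInf_lower) auto
      ultimately show False by simp
    qed
    then obtain b where b: "b \<in> S" "b \<le> 24 * K" by blast
    have nz1: "C * norm z \<le> 1" "C * norm z * ln (1 / \<kappa>) \<le> 1"
      using z lnp C \<beta> unfolding \<kappa>_def[symmetric] by (auto simp: distrib_left intro: order_trans[rotated])
    have "norm z < 1"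
    proof -
      have "25 * norm z \<le> C * norm z" using C \<beta> by (intro mult_right_mono) auto
      then show ?thesis using nz1(1) by linarith
    qed
    then have "norm (h z) \<le> \<kappa> * exp (\<beta> + b * norm z)" using b by (simp add: S_def)
    also have "\<dots> \<le> \<kappa> * C"
    proof -
      have "b * norm z \<le> 24 * K * norm z" using b by (intro mult_right_mono) auto
      also have "\<dots> = 24 * 1024 * norm z + 24 * (norm z * ln (1 / \<kappa>))" by (simp add: K_def algebra_simps)
      also have "\<dots> \<le> C * norm z * 1 + C * (norm z * ln (1 / \<kappa>))"
        using C \<beta> lnp by (intro add_mono mult_right_mono) (auto intro!: mult_right_mono)
      also have "\<dots> \<le> 2" using nz1 by (simp add: mult.assoc)
      finally have "exp (\<beta> + b * norm z) \<le> C" unfolding C_def by simp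
      then show ?thesis using \<kappa> by simp
    qed
    finally show ?thesis by (simp add: \<kappa>_def mult.commute)
  qed
  moreover have "1 \<le> C" using C \<beta> by simp
  ultimately show ?thesis unfolding ridge_constant_def by blast
qed

section \<open>The smoothing inequality\<close>

text \<open>
  The Fejer kernel, given by its Fourier transform \<open>1 - \<bar>t\<bar>\<close> on \<open>[-1, 1]\<close>.  In this form smoothing with it
  turns into an integral over bounded frequencies by Fubini's theorem alone, without Fourier inversion.
  The point \<open>0\<close> is left out of the range to make \<open>(sin (t B) - sin (t A)) / t\<close> meaningful below.
\<close>
definition fejer :: "real \<Rightarrow> real" where
  "fejer u = (1 / pi) * (LBINT t. indicator {0<..1} t * ((1 - t) * cos (t * u)))"

lemma fejer_eq:
  assumes "u \<noteq> 0"
  shows "fejer u = (1 - cos u) / (pi * u\<^sup>2)"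
proof -
  define F where "F t = (1 - t) * sin (t * u) / u - cos (t * u) / u\<^sup>2" for t
  have "(LBINT t. indicator {0..1} t *\<^sub>R ((1 - t) * cos (t * u))) = F 1 - F 0"
  proof (rule integral_FTC_Icc)
    show "(F has_vector_derivative (1 - t) * cos (t * u)) (at t within {0..1})" if "0 \<le> t" "t \<le> 1" for t
      unfolding F_def using assms
      by (auto intro!: derivative_eq_intros simp: has_real_derivative_iff_has_vector_derivative[symmetric] field_simps power2_eq_square)
  qed (auto intro!: continuous_intros)
  also have "(LBINT t. indicator {0..1} t *\<^sub>R ((1 - t) * cos (t * u)))
      = (LBINT t. indicator {0<..1} t * ((1 - t) * cos (t * u)))"
    by (rule integral_cong_AE) (use AE_lborel_singleton[of "0::real"] in \<open>auto elim!: eventually_mono split: split_indicator\<close>)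
  finally show ?thesis using assms by (simp add: fejer_def F_def field_simps)
qed

lemma fejer_nonneg: "0 \<le> fejer u"
proof (cases "u = 0")
  case True
  have "0 \<le> (LBINT t. indicator {0<..1} t * ((1 - t) * cos (t * (0::real))))"
    by (rule integral_nonneg_AE) (auto split: split_indicator)
  then show ?thesis using True by (simp add: fejer_def)
qed (simp add: fejer_eq)

lemma fejer_measurable [measurable]: "fejer \<in> borel_measurable borel"
  unfolding fejer_def by measurable

lemma integrable_inverse_one_plus_square: "integrable lborel (\<lambda>u::real. 1 / (1 + u\<^sup>2))"
  using integrable_inverse_1_plus_square by (simp add: set_integrable_def inverse_eq_divide)

lemma fejer_le: "u \<noteq> 0 \<Longrightarrow> fejer u \<le> 2 * (1 / (1 + u\<^sup>2))"
proof -
  assume u: "u \<noteq> 0"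
  have "1 - cos u \<le> u\<^sup>2 / 2"
  proof -
    have "(sin (u / 2))\<^sup>2 \<le> (u / 2)\<^sup>2" by (rule abs_le_square_iff[THEN iffD1, OF abs_sin_x_le_abs_x])
    then show ?thesis using cos_double_sin[of "u / 2"] by (simp add: power_divide)
  qed
  moreover have "1 - cos u \<le> 2" using cos_ge_minus_one[of u] by linarith
  ultimately have "(1 + u\<^sup>2) * (1 - cos u) \<le> u\<^sup>2 / 2 + 2 * u\<^sup>2"
    unfolding distrib_right using mult_left_mono[of "1 - cos u" 2 "u\<^sup>2"] by simp
  also have "\<dots> \<le> 3 * u\<^sup>2" by simp
  also have "\<dots> \<le> pi * u\<^sup>2" using pi_gt3 by (intro mult_right_mono) auto
  also have "\<dots> \<le> 2 * (pi * u\<^sup>2)" by simp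
  finally show ?thesis using u by (simp add: fejer_eq field_simps add_pos_nonneg)
qed

lemma fejer_integrable: "integrable lborel fejer"
proof (rule Bochner_Integration.integrable_bound)
  show "integrable lborel (\<lambda>u::real. 2 * (1 / (1 + u\<^sup>2)))"
    by (intro integrable_mult_right integrable_inverse_one_plus_square)
  show "AE u in lborel. norm (fejer u) \<le> norm (2 * (1 / (1 + u\<^sup>2)))"
    using AE_lborel_singleton[of "0::real"]
  proof eventually_elim
    case (elim u)
    then show ?case using fejer_le[of u] fejer_nonneg[of u] by (simp add: add_nonneg_nonneg)
  qed
qed simp

lemma fejer_integral_pos: "0 < integral\<^sup>L lborel fejer"
proof -
  have "integral\<^sup>L lborel fejer \<noteq> 0"
  proof
    assume "integral\<^sup>L lborel fejer = 0"
    then have "AE u in lborel. fejer u = 0"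
      using integral_nonneg_eq_0_iff_AE[OF fejer_integrable] fejer_nonneg by auto
    then have "AE u::real in lborel. u \<notin> {1<..<2}"
    proof eventually_elim
      case (elim u)
      show ?case
      proof
        assume u: "u \<in> {1<..<2}"
        have "cos u < cos 0" using u pi_gt3 by (intro cos_monotone_0_pi) auto
        then have "fejer u \<noteq> 0" using u by (simp add: fejer_eq)
        with elim show False by simp
      qed
    qed
    then have "{1<..<2::real} \<in> null_sets lborel" by (simp add: AE_iff_null_sets)
    then show False by (simp add: null_sets_def)
  qed
  moreover have "0 \<le> integral\<^sup>L lborel fejer" using fejer_nonneg by (intro integral_nonneg_AE) auto
  ultimately show ?thesis by linarith
qed

lemma fejer_tail:
  obtains a where "0 < a" "19 / 20 * integral\<^sup>L lborel fejer \<le> (LBINT u. indicator {-a..a} u * fejer u)"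
proof -
  have "(\<lambda>n::nat. LBINT u. indicator {- real n..real n} u * fejer u) \<longlonglongrightarrow> integral\<^sup>L lborel fejer"
  proof (rule integral_dominated_convergence[OF _ _ fejer_integrable])
    show "AE u in lborel. (\<lambda>n. indicator {- real n..real n} u * fejer u) \<longlonglongrightarrow> fejer u"
    proof (rule always_eventually, rule allI, rule tendsto_eventually)
      fix u :: real
      show "\<forall>\<^sub>F n in sequentially. indicator {- real n..real n} u * fejer u = fejer u"
      proof (rule eventually_sequentiallyI)
        fix n assume "nat \<lceil>\<bar>u\<bar>\<rceil> \<le> n"
        then have "\<bar>u\<bar> \<le> real n" by linarith
        then have "u \<in> {- real n..real n}" by auto
        then show "indicator {- real n..real n} u * fejer u = fejer u" by simp
      qed
    qed
    show "AE u in lborel. norm (indicator {- real n..real n} u * fejer u) \<le> fejer u" for n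
      using fejer_nonneg by (auto split: split_indicator)
  qed auto
  moreover have "19 / 20 * integral\<^sup>L lborel fejer < integral\<^sup>L lborel fejer" using fejer_integral_pos by simp
  ultimately have "\<forall>\<^sub>F n in sequentially. 19 / 20 * integral\<^sup>L lborel fejer < (LBINT u. indicator {- real n..real n} u * fejer u)"
    by (rule order_tendstoD)
  then obtain N :: nat where N: "\<And>n. n \<ge> N \<Longrightarrow> 19 / 20 * integral\<^sup>L lborel fejer < (LBINT u. indicator {- real n..real n} u * fejer u)"
    by (auto simp: eventually_sequentially)
  show ?thesis by (rule that[of "real (Suc N)"]) (use N[of "Suc N"] in auto)
qed

text \<open>
  Integrating \<open>cos (t u)\<close> over \<open>u\<close> first.
\<close>
lemma fejer_interval:
  assumes "A \<le> B"
  shows "(LBINT u. indicator {A<..B} u * fejer u)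
     = (1 / pi) * (LBINT t. indicator {0<..1} t * ((1 - t) * ((sin (t * B) - sin (t * A)) / t)))"
proof -
  let ?f = "\<lambda>(u, t). indicator {A<..B} u * (indicator {0<..1} t * ((1 - t) * cos (t * u))) :: real"
  have int: "integrable (lborel \<Otimes>\<^sub>M lborel) ?f"
  proof (rule Bochner_Integration.integrable_bound)
    show "integrable (lborel \<Otimes>\<^sub>M lborel) (indicator ({A<..B} \<times> {0<..1}) :: real \<times> real \<Rightarrow> real)"
      using assms by (auto simp: integrable_indicator_iff lborel.emeasure_pair_measure_Times ennreal_mult_less_top)
    show "AE x in lborel \<Otimes>\<^sub>M lborel. norm (?f x) \<le> norm (indicator ({A<..B} \<times> {0<..1}) x :: real)"
    proof (intro always_eventually allI)
      fix x :: "real \<times> real"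
      show "norm (?f x) \<le> norm (indicator ({A<..B} \<times> {0<..1}) x :: real)"
        by (cases x) (auto split: split_indicator simp: abs_mult intro!: mult_le_one)
    qed
  qed measurable
  have "(LBINT u. indicator {A<..B} u * fejer u)
      = (1 / pi) * (LBINT u. (LBINT t. ?f (u, t)))"
    unfolding fejer_def by (simp add: mult.left_commute flip: integral_mult_right_zero)
  also have "(LBINT u. (LBINT t. ?f (u, t))) = (LBINT t. (LBINT u. ?f (u, t)))"
    using lborel_pair.Fubini_integral[of "\<lambda>u t. ?f (u, t)"] int by simp
  also have "\<dots> = (LBINT t. indicator {0<..1} t * ((1 - t) * ((sin (t * B) - sin (t * A)) / t)))"
  proof (rule Bochner_Integration.integral_cong[OF refl])
    fix t :: real
    show "(LBINT u. ?f (u, t)) = indicator {0<..1} t * ((1 - t) * ((sin (t * B) - sin (t * A)) / t))"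
    proof (cases "t \<in> {0<..1}")
      case True
      have "(LBINT u. indicator {A..B} u *\<^sub>R cos (t * u)) = sin (t * B) / t - sin (t * A) / t"
      proof (rule integral_FTC_Icc[OF assms])
        show "((\<lambda>u. sin (t * u) / t) has_vector_derivative cos (t * u)) (at u within {A..B})" for u
          using True by (auto intro!: derivative_eq_intros simp: has_real_derivative_iff_has_vector_derivative[symmetric])
      qed (auto intro!: continuous_intros)
      also have "(LBINT u. indicator {A..B} u *\<^sub>R cos (t * u)) = (LBINT u. indicator {A<..B} u * cos (t * u))"
        by (rule integral_cong_AE) (use AE_lborel_singleton[of A] in \<open>auto elim!: eventually_mono split: split_indicator\<close>)
      finally have *: "(LBINT u. indicator {A<..B} u * cos (t * u)) = (sin (t * B) - sin (t * A)) / t"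
        by (simp add: diff_divide_distrib)
      have "(LBINT u. ?f (u, t)) = (LBINT u. (1 - t) * (indicator {A<..B} u * cos (t * u)))"
        using True by (intro Bochner_Integration.integral_cong) auto
      then show ?thesis using True * by simp
    qed simp
  qed
  finally show ?thesis .
qed

lemma (in real_distribution) cdf_measurable [measurable]: "cdf M \<in> borel_measurable borel"
  by (rule borel_measurable_mono) (auto intro: monoI cdf_nondecreasing)

lemma abs_cdf_diff_le_1:
  assumes "real_distribution \<mu>" "real_distribution \<nu>"
  shows "\<bar>cdf \<mu> x - cdf \<nu> y\<bar> \<le> 1"
proof -
  interpret m: real_distribution \<mu> by fact
  interpret n: real_distribution \<nu> by fact
  show ?thesis
    using m.cdf_bounded_prob[of x] n.cdf_bounded_prob[of y] m.cdf_nonneg[of x] n.cdf_nonneg[of y] by linarith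
qed

lemma (in real_distribution) integral_sin_char:
  "(LINT x|M. sin (\<theta> - s * x)) = Im (iexp \<theta> * char M (- s))"
proof -
  have int: "integrable M (\<lambda>x. iexp (- s * x))"
    by (intro integrable_iexp) auto
  have "iexp \<theta> * char M (- s) = (CLINT x|M. iexp \<theta> * iexp (- s * x))"
    unfolding char_def by simp
  also have "\<dots> = (CLINT x|M. iexp (\<theta> - s * x))"
    by (simp add: exp_add[symmetric] algebra_simps)
  also have "Im \<dots> = (LINT x|M. Im (iexp (\<theta> - s * x)))"
  proof (rule integral_Im[symmetric])
    have "integrable M (\<lambda>x. iexp \<theta> * iexp (- s * x))" using int by (rule integrable_mult_right)
    then show "integrable M (\<lambda>x. iexp (\<theta> - s * x))" by (simp add: exp_add[symmetric] algebra_simps)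
  qed
  finally show ?thesis by (simp add: Im_exp)
qed

lemma abs_sin_diff_le: "\<bar>sin p - sin q\<bar> \<le> \<bar>p - q\<bar>" for p q :: real
proof -
  have "\<bar>sin p - sin q\<bar> = 2 * \<bar>sin ((p - q) / 2)\<bar> * \<bar>cos ((p + q) / 2)\<bar>"
    by (simp add: sin_diff_sin abs_mult)
  also have "\<dots> \<le> 2 * \<bar>(p - q) / 2\<bar> * 1"
    using abs_sin_x_le_abs_x[of "(p - q) / 2"] by (intro mult_mono) auto
  finally show ?thesis by simp
qed

lemma (in real_distribution) borel_measurable_fst_snd:
  "fst \<in> borel_measurable (lborel \<Otimes>\<^sub>M M)" "snd \<in> borel_measurable (lborel \<Otimes>\<^sub>M M)"
  "fst \<in> borel_measurable (M \<Otimes>\<^sub>M lborel)" "snd \<in> borel_measurable (M \<Otimes>\<^sub>M lborel)"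
  using measurable_compose[OF measurable_fst[of lborel M], of "\<lambda>x. x" borel]
    measurable_compose[OF measurable_snd[of lborel M], of "\<lambda>x. x" borel]
    measurable_compose[OF measurable_fst[of M lborel], of "\<lambda>x. x" borel]
    measurable_compose[OF measurable_snd[of M lborel], of "\<lambda>x. x" borel] by auto

lemma (in real_distribution) integrable_strip:
  fixes c :: real and A :: "real set"
  assumes A: "A \<in> sets borel" "emeasure lborel A < \<infinity>"
  shows "integrable (M \<Otimes>\<^sub>M lborel) (\<lambda>z. indicator A (snd z) * c)"
proof -
  have S: "space M \<times> A \<in> sets (M \<Otimes>\<^sub>M lborel)" using A by (intro pair_measureI) auto
  have "emeasure (M \<Otimes>\<^sub>M lborel) (space M \<times> A) = emeasure M (space M) * emeasure lborel A"
    using A by (intro lborel.emeasure_pair_measure_Times) auto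
  also have "\<dots> < \<infinity>" using A by (simp add: emeasure_space_1 del: space_eq_univ)
  finally have "integrable (M \<Otimes>\<^sub>M lborel) (indicator (space M \<times> A) :: real \<times> real \<Rightarrow> real)"
    using S by (intro integrable_real_indicator)
  then have "integrable (M \<Otimes>\<^sub>M lborel) (\<lambda>z. indicator (space M \<times> A) z * c)" by (rule integrable_mult_left)
  moreover have "indicator (space M \<times> A) z = (indicator A (snd z) :: real)" for z
    by (cases z) (simp add: indicator_def)
  ultimately show ?thesis by (simp only:)
qed

text \<open>
  An increment of the smoothed distribution function is an average of kernel integrals over the intervals
  \<open>T (a - x) < u \<le> T (b - x)\<close>.  Two applications of Fubini's theorem express it through the
  characteristic function on frequencies up to \<open>T\<close>.
\<close>
lemma (in real_distribution) fejer_smoothed_increment: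
  assumes ab: "a \<le> b" and T: "0 < T"
  shows "(LBINT u. fejer u * (cdf M (b - u / T) - cdf M (a - u / T)))
     = (1 / pi) * (LBINT t. indicator {0<..1} t * ((1 - t) / t * Im ((iexp (t * (T * b)) - iexp (t * (T * a))) * char M (- (t * T)))))"
    and "integrable lborel (\<lambda>t. indicator {0<..1} t * ((1 - t) / t * Im ((iexp (t * (T * b)) - iexp (t * (T * a))) * char M (- (t * T)))))"
proof -
  interpret P: pair_sigma_finite lborel M by standard
  interpret P': pair_sigma_finite M lborel by standard
  let ?A = "\<lambda>x. T * (a - x)" and ?B = "\<lambda>x. T * (b - x)"
  have AB: "?A x \<le> ?B x" for x using ab T by simp
  let ?f = "\<lambda>(u, x). indicator {?A x<..?B x} u * fejer u"
  have ind: "indicator {?A x<..?B x} u = (indicator {a - u / T<..b - u / T} x :: real)" for u x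
    using T by (auto split: split_indicator simp: field_simps)
  have fm: "?f \<in> borel_measurable (lborel \<Otimes>\<^sub>M M)"
  proof -
    \<comment> \<open>The indicator is rewritten as a condition on the two coordinates, whose measurability is visible.\<close>
    note [measurable] = borel_measurable_fst_snd
    have "?f = (\<lambda>z. if a - fst z / T < snd z \<and> snd z \<le> b - fst z / T then fejer (fst z) else 0)"
      by (auto simp: fun_eq_iff ind split: split_indicator)
    then show ?thesis by simp
  qed
  have inner: "(LINT x|M. ?f (u, x)) = fejer u * (cdf M (b - u / T) - cdf M (a - u / T))" for u
  proof -
    have "(LINT x|M. ?f (u, x)) = fejer u * measure M {a - u / T<..b - u / T}"
      unfolding ind by (simp add: mult.commute)
    also have "measure M {a - u / T<..b - u / T} = cdf M (b - u / T) - cdf M (a - u / T)"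
    proof (cases "a = b")
      case False
      then show ?thesis using ab by (subst cdf_diff_eq) auto
    qed simp
    finally show ?thesis .
  qed
  have int1: "integrable (lborel \<Otimes>\<^sub>M M) ?f"
  proof (rule P.Fubini_integrable[OF fm])
    show "integrable lborel (\<lambda>u. LINT x|M. norm (?f (u, x)))"
    proof (rule Bochner_Integration.integrable_bound[OF fejer_integrable])
      show "(\<lambda>u. LINT x|M. norm (?f (u, x))) \<in> borel_measurable lborel"
        using fm by (intro borel_measurable_lebesgue_integral) auto
      have "norm (LINT x|M. norm (?f (u, x))) \<le> norm (fejer u)" for u
      proof -
        have "(LINT x|M. norm (?f (u, x))) = (LINT x|M. ?f (u, x))"
          by (intro Bochner_Integration.integral_cong) (auto simp: fejer_nonneg split: split_indicator)
        also have "\<dots> = fejer u * (cdf M (b - u / T) - cdf M (a - u / T))" by (rule inner)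
        also have "\<bar>\<dots>\<bar> \<le> fejer u * 1"
        proof -
          have "\<bar>cdf M (b - u / T) - cdf M (a - u / T)\<bar> \<le> 1"
            by (rule abs_cdf_diff_le_1[OF real_distribution_axioms real_distribution_axioms])
          then show ?thesis unfolding abs_mult using fejer_nonneg[of u] by (intro mult_mono) auto
        qed
        finally show ?thesis using fejer_nonneg[of u] by simp
      qed
      then show "AE u in lborel. norm (LINT x|M. norm (?f (u, x))) \<le> norm (fejer u)" by auto
    qed
    have "integrable M (\<lambda>x. indicator {a - u / T<..b - u / T} x * fejer u)" for u
      by (intro integrable_mult_left integrable_real_indicator) (auto simp: emeasure_eq_measure)
    then show "AE u in lborel. integrable M (\<lambda>x. ?f (u, x))"
      unfolding ind prod.case by (intro always_eventually allI)
  qed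
  let ?g = "\<lambda>(x, t). indicator {0<..1} t * ((1 - t) * ((sin (t * ?B x) - sin (t * ?A x)) / t))"
  have g_bound: "norm (?g (x, t)) \<le> indicator {0<..1} t * (T * (b - a))" for x t
  proof (cases "t \<in> {0<..1}")
    case True
    have "\<bar>sin (t * ?B x) - sin (t * ?A x)\<bar> \<le> \<bar>t * ?B x - t * ?A x\<bar>" by (rule abs_sin_diff_le)
    also have "t * ?B x - t * ?A x = t * (T * (b - a))" by (simp add: algebra_simps)
    also have "\<bar>\<dots>\<bar> = t * (T * (b - a))" using True T ab by simp
    finally have "\<bar>sin (t * ?B x) - sin (t * ?A x)\<bar> \<le> t * (T * (b - a))" .
    moreover have "\<bar>p / t\<bar> \<le> c" if "\<bar>p\<bar> \<le> t * c" for p c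
      using that True by (simp add: pos_divide_le_eq mult.commute)
    ultimately have "\<bar>(sin (t * ?B x) - sin (t * ?A x)) / t\<bar> \<le> T * (b - a)" by blast
    from mult_mono[OF _ this, of "\<bar>1 - t\<bar>" 1]
    have "\<bar>1 - t\<bar> * \<bar>(sin (t * ?B x) - sin (t * ?A x)) / t\<bar> \<le> 1 * (T * (b - a))"
      using True by simp
    then show ?thesis using True by (simp only: prod.case norm_mult indicator_simps real_norm_def abs_one mult_1_left abs_mult)
  qed simp
  have int2: "integrable (M \<Otimes>\<^sub>M lborel) ?g"
  proof (rule Bochner_Integration.integrable_bound)
    show "integrable (M \<Otimes>\<^sub>M lborel) (\<lambda>z::real \<times> real. indicator {0<..1} (snd z) * (T * (b - a)))"
      using integrable_strip[of "{0<..1}" "T * (b - a)"] by simp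
    show "AE z in M \<Otimes>\<^sub>M lborel. norm (?g z) \<le> norm (indicator {0<..1} (snd z) * (T * (b - a)))"
    proof (intro always_eventually allI)
      fix z :: "real \<times> real"
      obtain x t where z: "z = (x, t)" by (cases z)
      have "norm (?g (x, t)) \<le> \<bar>indicator {0<..1} t * (T * (b - a))\<bar>" using g_bound abs_ge_self order_trans by blast
      then show "norm (?g z) \<le> norm (indicator {0<..1} (snd z) * (T * (b - a)))"
        unfolding z by (simp only: snd_conv real_norm_def)
    qed
    note [measurable] = borel_measurable_fst_snd
    show "?g \<in> borel_measurable (M \<Otimes>\<^sub>M lborel)"
      unfolding case_prod_beta by measurable
  qed
  have Phi: "(LINT x|M. ?g (x, t)) = indicator {0<..1} t * ((1 - t) / t * Im ((iexp (t * (T * b)) - iexp (t * (T * a))) * char M (- (t * T))))" for t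
  proof -
    have i: "integrable M (\<lambda>x. sin (\<theta> - s * x))" for \<theta> s
      by (rule integrable_const_bound[where B = 1]) auto
    have "(LINT x|M. ?g (x, t)) = (indicator {0<..1} t * ((1 - t) / t)) * (LINT x|M. sin (t * (T * b) - t * T * x) - sin (t * (T * a) - t * T * x))"
    proof (subst integral_mult_right_zero[symmetric], rule Bochner_Integration.integral_cong[OF refl])
      fix x
      have 1: "t * ?B x = t * (T * b) - t * T * x" "t * ?A x = t * (T * a) - t * T * x" by (simp_all add: algebra_simps)
      show "?g (x, t) = (indicator {0<..1} t * ((1 - t) / t)) * (sin (t * (T * b) - t * T * x) - sin (t * (T * a) - t * T * x))"
        unfolding prod.case 1 by simp
    qed
    also have "(LINT x|M. sin (t * (T * b) - t * T * x) - sin (t * (T * a) - t * T * x))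
       = Im ((iexp (t * (T * b)) - iexp (t * (T * a))) * char M (- (t * T)))"
      by (subst Bochner_Integration.integral_diff[OF i i]) (simp only: integral_sin_char left_diff_distrib minus_complex.sel)
    finally show ?thesis by (simp only: mult.assoc)
  qed
  have "(LBINT u. fejer u * (cdf M (b - u / T) - cdf M (a - u / T))) = (LBINT u. (LINT x|M. ?f (u, x)))"
    by (simp only: inner)
  also have "\<dots> = (LINT x|M. (LBINT u. ?f (u, x)))"
    using P.Fubini_integral[of "\<lambda>u x. ?f (u, x)"] int1 by simp
  also have "\<dots> = (LINT x|M. (1 / pi) * (LBINT t. ?g (x, t)))"
    using fejer_interval[OF AB] by (simp only: prod.case)
  also have "\<dots> = (1 / pi) * (LINT x|M. (LBINT t. ?g (x, t)))" by simp
  also have "(LINT x|M. (LBINT t. ?g (x, t))) = (LBINT t. (LINT x|M. ?g (x, t)))"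
    using P'.Fubini_integral[of "\<lambda>x t. ?g (x, t)"] int2 by simp
  finally show "(LBINT u. fejer u * (cdf M (b - u / T) - cdf M (a - u / T)))
     = (1 / pi) * (LBINT t. indicator {0<..1} t * ((1 - t) / t * Im ((iexp (t * (T * b)) - iexp (t * (T * a))) * char M (- (t * T)))))"
    by (simp only: Phi)
  show "integrable lborel (\<lambda>t. indicator {0<..1} t * ((1 - t) / t * Im ((iexp (t * (T * b)) - iexp (t * (T * a))) * char M (- (t * T)))))"
    using P'.integrable_snd[of "\<lambda>x t. ?g (x, t)"] int2 unfolding Phi by simp
qed

text \<open>
  The increment formula bounds the difference of the smoothed functions between \<open>a\<close> and \<open>b\<close>, and both
  smoothed functions tend to \<open>0\<close> as \<open>a\<close> tends to \<open>-\<infinity>\<close>.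
\<close>
lemma smoothed_difference_bound:
  assumes \<mu>: "real_distribution \<mu>" and \<nu>: "real_distribution \<nu>" and T: "0 < T"
    and H: "integrable lborel H" and H0: "\<And>s. 0 \<le> H s"
    and le: "\<And>s. \<bar>s\<bar> \<le> T \<Longrightarrow> norm (char \<mu> s - char \<nu> s) \<le> \<bar>s\<bar> * H s"
  shows "\<bar>LBINT u. fejer u * (cdf \<mu> (b - u / T) - cdf \<nu> (b - u / T))\<bar> \<le> integral\<^sup>L lborel H"
proof -
  interpret m: real_distribution \<mu> by fact
  interpret n: real_distribution \<nu> by fact
  define D where "D x = cdf \<mu> x - cdf \<nu> x" for x
  have Dm [measurable]: "D \<in> borel_measurable borel"
    unfolding D_def by measurable
  have D1: "\<bar>D x\<bar> \<le> 1" for x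
    unfolding D_def by (rule abs_cdf_diff_le_1[OF \<mu> \<nu>])
  have Dint: "integrable lborel (\<lambda>u. fejer u * D (c - u / T))" for c
  proof (rule Bochner_Integration.integrable_bound[OF fejer_integrable])
    show "AE u in lborel. norm (fejer u * D (c - u / T)) \<le> norm (fejer u)"
      using D1 by (intro always_eventually allI) (simp add: abs_mult mult_left_le)
  qed measurable
  have HT: "integrable lborel (\<lambda>t. T * H (- (t * T)))" "(LBINT t. T * H (- (t * T))) = integral\<^sup>L lborel H"
    using lborel_integrable_real_affine[OF H, of "-T" 0] lborel_integral_real_affine[of "-T" H 0] T
    by (auto simp: mult.commute)
  have incr: "\<bar>LBINT u. fejer u * (D (b - u / T) - D (a - u / T))\<bar> \<le> integral\<^sup>L lborel H" if ab: "a \<le> b" for a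
  proof -
    define e where "e t = iexp (t * (T * b)) - iexp (t * (T * a))" for t
    define w where "w M t = indicator {0<..1} t * ((1 - t) / t * Im (e t * char M (- (t * T))))" for M :: "real measure" and t
    note incr_eq = real_distribution.fejer_smoothed_increment[OF _ ab T, folded e_def, folded w_def]
    have cint: "integrable lborel (\<lambda>u. fejer u * (cdf M (b - u / T) - cdf M (a - u / T)))" if M: "real_distribution M" for M
    proof (rule Bochner_Integration.integrable_bound[OF fejer_integrable])
      interpret M: real_distribution M by fact
      have [measurable]: "cdf M \<in> borel_measurable borel" by (rule M.cdf_measurable)
      show "(\<lambda>u. fejer u * (cdf M (b - u / T) - cdf M (a - u / T))) \<in> borel_measurable lborel" by measurable
      have "\<bar>cdf M x - cdf M y\<bar> \<le> 1" for x y by (rule abs_cdf_diff_le_1[OF M M])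
      then show "AE u in lborel. norm (fejer u * (cdf M (b - u / T) - cdf M (a - u / T))) \<le> norm (fejer u)"
        by (intro always_eventually allI) (simp add: abs_mult mult_left_le)
    qed
    have "(LBINT u. fejer u * (D (b - u / T) - D (a - u / T)))
      = (LBINT u. fejer u * (cdf \<mu> (b - u / T) - cdf \<mu> (a - u / T))) - (LBINT u. fejer u * (cdf \<nu> (b - u / T) - cdf \<nu> (a - u / T)))"
      by (subst Bochner_Integration.integral_diff[symmetric, OF cint[OF \<mu>] cint[OF \<nu>]])
         (simp add: D_def algebra_simps)
    also have "\<dots> = (1 / pi) * (LBINT t. w \<mu> t - w \<nu> t)"
      unfolding incr_eq(1)[OF \<mu>] incr_eq(1)[OF \<nu>]
      by (subst Bochner_Integration.integral_diff[OF incr_eq(2)[OF \<mu>] incr_eq(2)[OF \<nu>]])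
         (simp only: right_diff_distrib)
    also have "\<bar>\<dots>\<bar> = (1 / pi) * \<bar>LBINT t. w \<mu> t - w \<nu> t\<bar>" by (simp add: abs_mult)
    also have "(1 / pi) * \<bar>LBINT t. w \<mu> t - w \<nu> t\<bar> \<le> (1 / pi) * (LBINT t. 2 * (T * H (- (t * T))))"
    proof -
      have "norm (LBINT t. w \<mu> t - w \<nu> t) \<le> (LBINT t. 2 * (T * H (- (t * T))))"
      proof (rule Bochner_Integration.integral_norm_bound_integral)
        show "integrable lborel (\<lambda>t. w \<mu> t - w \<nu> t)"
          by (intro Bochner_Integration.integrable_diff incr_eq(2) \<mu> \<nu>)
        show "integrable lborel (\<lambda>t. 2 * (T * H (- (t * T))))" by (intro integrable_mult_right HT)
        show "norm (w \<mu> t - w \<nu> t) \<le> 2 * (T * H (- (t * T)))" for t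
        proof (cases "t \<in> {0<..1}")
          case True
          let ?d = "char \<mu> (- (t * T)) - char \<nu> (- (t * T))"
          have "\<bar>- (t * T)\<bar> \<le> T" using True T by (simp add: abs_mult)
          from le[OF this] have d: "norm ?d \<le> t * T * H (- (t * T))" using True T by (simp add: abs_mult)
          have "norm (e t) \<le> norm (iexp (t * (T * b))) + norm (iexp (t * (T * a)))"
            unfolding e_def by (rule norm_triangle_ineq4)
          then have e: "norm (e t) \<le> 2" by simp
          have "w \<mu> t - w \<nu> t = (1 - t) / t * Im ((e t) * ?d)"
            using True unfolding w_def by (simp only: indicator_simps mult_1_left right_diff_distrib minus_complex.sel)
          also have "norm \<dots> \<le> 1 / t * (2 * (t * T * H (- (t * T))))"
            unfolding norm_mult
          proof (rule mult_mono)
            show "norm ((1 - t) / t) \<le> 1 / t" using True by (simp add: divide_right_mono)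
            have "norm (Im ((e t) * ?d)) \<le> norm ((e t) * ?d)" unfolding real_norm_def by (rule abs_Im_le_cmod)
            also have "\<dots> \<le> 2 * (t * T * H (- (t * T)))" unfolding norm_mult using d e by (intro mult_mono) auto
            finally show "norm (Im ((e t) * ?d)) \<le> 2 * (t * T * H (- (t * T)))" .
          qed (use True in auto)
          also have "\<dots> = 2 * (T * H (- (t * T)))" using True by simp
          finally show ?thesis .
        next
          case False
          then show ?thesis using H0[of "- (t * T)"] T by (simp add: w_def)
        qed
      qed
      then show ?thesis by (intro mult_left_mono) simp_all
    qed
    also have "(LBINT t. 2 * (T * H (- (t * T)))) = 2 * integral\<^sup>L lborel H"
      using HT by simp
    also have "1 / pi * (2 * integral\<^sup>L lborel H) \<le> 1 * integral\<^sup>L lborel H"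
    proof -
      have "0 \<le> integral\<^sup>L lborel H" using H0 by (intro integral_nonneg_AE) auto
      moreover have "2 / pi \<le> 1" using pi_gt3 by simp
      ultimately have "2 / pi * integral\<^sup>L lborel H \<le> 1 * integral\<^sup>L lborel H" by (rule mult_right_mono[rotated])
      then show ?thesis by simp
    qed
    finally show ?thesis by (simp only: mult_1_left)
  qed
  have lim: "(\<lambda>k::nat. LBINT u. fejer u * D (- real k - u / T)) \<longlonglongrightarrow> (LBINT u::real. 0)"
  proof (rule integral_dominated_convergence[OF _ _ fejer_integrable])
    show "AE u in lborel. (\<lambda>k::nat. fejer u * D (- real k - u / T)) \<longlonglongrightarrow> 0"
    proof (intro always_eventually allI)
      fix u
      have f: "filterlim (\<lambda>k::nat. - real k - u / T) at_bot sequentially"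
      proof -
        have "filterlim (\<lambda>k::nat. u / T + real k) at_top sequentially"
          by (rule filterlim_tendsto_add_at_top[OF tendsto_const filterlim_real_sequentially])
        then have "filterlim (\<lambda>k::nat. - (u / T + real k)) at_bot sequentially"
          by (simp only: filterlim_uminus_at_bot minus_minus)
        moreover have "(\<lambda>k::nat. - (u / T + real k)) = (\<lambda>k. - real k - u / T)" by auto
        ultimately show ?thesis by (simp only:)
      qed
      have "(\<lambda>k::nat. fejer u * (cdf \<mu> (- real k - u / T) - cdf \<nu> (- real k - u / T))) \<longlonglongrightarrow> fejer u * (0 - 0)"
        by (intro tendsto_intros filterlim_compose[OF m.cdf_lim_at_bot f] filterlim_compose[OF n.cdf_lim_at_bot f])
      then show "(\<lambda>k::nat. fejer u * D (- real k - u / T)) \<longlonglongrightarrow> 0" by (simp add: D_def)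
    qed
    show "AE u in lborel. norm (fejer u * D (- real k - u / T)) \<le> fejer u" for k
      using D1 fejer_nonneg by (intro always_eventually allI) (simp add: abs_mult mult_left_le)
  qed auto
  have "(\<lambda>k::nat. \<bar>(LBINT u. fejer u * D (b - u / T)) - (LBINT u. fejer u * D (- real k - u / T))\<bar>)
     \<longlonglongrightarrow> \<bar>(LBINT u. fejer u * D (b - u / T)) - (LBINT u::real. 0)\<bar>"
    by (intro tendsto_intros lim)
  moreover have "\<exists>N. \<forall>k\<ge>N. \<bar>(LBINT u. fejer u * D (b - u / T)) - (LBINT u. fejer u * D (- real k - u / T))\<bar> \<le> integral\<^sup>L lborel H"
  proof (intro exI allI impI)
    fix k assume "nat \<lceil>- b\<rceil> \<le> k"
    then have "- real k \<le> b" by linarith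
    from incr[OF this] show "\<bar>(LBINT u. fejer u * D (b - u / T)) - (LBINT u. fejer u * D (- real k - u / T))\<bar> \<le> integral\<^sup>L lborel H"
      by (simp add: right_diff_distrib Bochner_Integration.integral_diff[OF Dint Dint])
  qed
  ultimately have "\<bar>(LBINT u. fejer u * D (b - u / T)) - (LBINT u::real. 0)\<bar> \<le> integral\<^sup>L lborel H"
    by (rule LIMSEQ_le_const2)
  then show ?thesis by (simp add: D_def)
qed

text \<open>
  Esseen's smoothing inequality.  The function \<open>H\<close> majorizes the difference quotient of the
  characteristic functions at \<open>0\<close>, so that no singular integrand appears.
\<close>
definition smoothing_constant :: "real \<Rightarrow> bool" where
  "smoothing_constant A \<longleftrightarrow> 0 < A \<and> (\<forall>\<mu> \<nu> L T H x. real_distribution \<mu> \<longrightarrow> real_distribution \<nu> \<longrightarrow>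
     0 \<le> L \<longrightarrow> 0 < T \<longrightarrow> (\<forall>x y. x \<le> y \<longrightarrow> cdf \<nu> y - cdf \<nu> x \<le> L * (y - x)) \<longrightarrow>
     integrable lborel H \<longrightarrow> (\<forall>s. 0 \<le> H s) \<longrightarrow>
     (\<forall>s. \<bar>s\<bar> \<le> T \<longrightarrow> norm (char \<mu> s - char \<nu> s) \<le> \<bar>s\<bar> * H s) \<longrightarrow>
     \<bar>cdf \<mu> x - cdf \<nu> x\<bar> \<le> A * (integral\<^sup>L lborel H + L / T))"

text \<open>
  Let \<open>\<eta>\<close> be the supremum of \<open>\<bar>D\<bar>\<close>, where \<open>D\<close> is the difference of the distribution functions.  One of them
  is monotone and the other is Lipschitz, so \<open>D\<close> cannot drop quickly to the right of a point where it is
  close to \<open>\<eta>\<close> (nor rise quickly to the left of one where it is close to \<open>-\<eta>\<close>).  If \<open>\<eta>\<close> is large against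
  \<open>L / T\<close>, the kernel window around a neighbouring point sees only values of size at least \<open>13/20 \<eta>\<close>, and
  the smoothed difference is at least a fixed multiple of \<open>\<eta>\<close>.
\<close>
theorem smoothing_constant_exists: "\<exists>A. smoothing_constant A"
proof -
  define I where "I = integral\<^sup>L lborel fejer"
  have I: "0 < I" unfolding I_def by (rule fejer_integral_pos)
  obtain a where a: "0 < a" "19 / 20 * I \<le> (LBINT u. indicator {-a..a} u * fejer u)"
    unfolding I_def by (rule fejer_tail)
  have main: "\<bar>cdf \<mu> x - cdf \<nu> x\<bar> \<le> (2 / I + 8 * a) * (integral\<^sup>L lborel H + L / T)"
    if \<mu>: "real_distribution \<mu>" and \<nu>: "real_distribution \<nu>" and L: "0 \<le> L" and T: "0 < T"
      and lip: "\<And>x y. x \<le> y \<Longrightarrow> cdf \<nu> y - cdf \<nu> x \<le> L * (y - x)"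
      and H: "integrable lborel H" and H0: "\<And>s. 0 \<le> H s"
      and le: "\<And>s. \<bar>s\<bar> \<le> T \<Longrightarrow> norm (char \<mu> s - char \<nu> s) \<le> \<bar>s\<bar> * H s"
    for \<mu> \<nu> L T H x
  proof -
    interpret m: real_distribution \<mu> by fact
    interpret n: real_distribution \<nu> by fact
    define D where "D x = cdf \<mu> x - cdf \<nu> x" for x
    have Dm [measurable]: "D \<in> borel_measurable borel"
      unfolding D_def by measurable
    have D1: "\<bar>D x\<bar> \<le> 1" for x
      unfolding D_def by (rule abs_cdf_diff_le_1[OF \<mu> \<nu>])
    define J where "J = integral\<^sup>L lborel H"
    have J0: "0 \<le> J" unfolding J_def using H0 by (intro integral_nonneg_AE) auto
    have DT: "\<bar>LBINT u. fejer u * D (c - u / T)\<bar> \<le> J" for c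
      unfolding D_def J_def by (rule smoothed_difference_bound[OF \<mu> \<nu> T H H0 le])
    have bdd: "bdd_above (range (\<lambda>x. \<bar>D x\<bar>))" using D1 by (auto intro!: bdd_aboveI)
    define \<eta> where "\<eta> = (SUP x. \<bar>D x\<bar>)"
    have D\<eta>: "\<bar>D x\<bar> \<le> \<eta>" for x unfolding \<eta>_def by (rule cSUP_upper[OF _ bdd]) simp
    have \<eta>0: "0 \<le> \<eta>" using D\<eta>[of 0] by linarith
    have "\<eta> \<le> 2 / I * J + 8 * a * (L / T)"
    proof (rule ccontr)
      assume neg: "\<not> ?thesis"
      have pos: "0 \<le> 2 / I * J" "0 \<le> 8 * a * (L / T)" using I J0 a L T by auto
      then have \<eta>: "0 < \<eta>" "8 * a * (L / T) < \<eta>" "2 / I * J < \<eta>" using neg by linarith+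
      have "9 / 10 * \<eta> < \<eta>" using \<eta> by simp
      then obtain x0 where x0: "9 / 10 * \<eta> < \<bar>D x0\<bar>"
        using less_cSUP_iff[OF _ bdd, of "9 / 10 * \<eta>"] unfolding \<eta>_def[symmetric] by blast
      define \<sigma> :: real where "\<sigma> = (if 0 \<le> D x0 then 1 else - 1)"
      have \<sigma>: "\<sigma> * D x0 = \<bar>D x0\<bar>" "\<bar>\<sigma>\<bar> = 1" "\<sigma> = 1 \<or> \<sigma> = - 1" by (auto simp: \<sigma>_def)
      have mono: "\<sigma> * D x0 - L * s \<le> \<sigma> * D (x0 + \<sigma> * s)" if "0 \<le> s" for s
        using \<sigma>(3)
      proof
        assume "\<sigma> = 1"
        then show ?thesis using lip[of x0 "x0 + s"] m.cdf_nondecreasing[of x0 "x0 + s"] that by (simp add: D_def)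
      next
        assume "\<sigma> = - 1"
        then show ?thesis using lip[of "x0 - s" x0] m.cdf_nondecreasing[of "x0 - s" x0] that by (simp add: D_def)
      qed
      \<comment> \<open>The window of radius a / T around this point lies on the side of x0 on which the difference cannot change quickly.\<close>
      define c where "c = x0 + \<sigma> * (a / T)"
      have near: "13 / 20 * \<eta> \<le> \<sigma> * D (c - u / T)" if u: "u \<in> {-a..a}" for u
      proof -
        define s where "s = (a - \<sigma> * u) / T"
        have s: "0 \<le> s" "s \<le> 2 * a / T" using u T \<sigma>(3) by (auto simp: s_def divide_right_mono)
        have "c - u / T = x0 + \<sigma> * s" using \<sigma>(3) T by (auto simp: c_def s_def field_simps)
        then have "\<sigma> * D x0 - L * s \<le> \<sigma> * D (c - u / T)" using mono[OF s(1)] by simp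
        moreover have "L * s \<le> 2 * a * (L / T)" using mult_left_mono[OF s(2) L] by (simp add: mult_ac)
        ultimately show ?thesis using x0 \<eta>(2) \<sigma>(1) by linarith
      qed
      \<comment> \<open>Inside the window the kernel sees at least 13/20 of the supremum, outside at least minus the supremum.\<close>
      have lower: "(13 / 20 * \<eta> + \<eta>) * (indicator {-a..a} u * fejer u) - \<eta> * fejer u \<le> fejer u * (\<sigma> * D (c - u / T))" for u
      proof (cases "u \<in> {-a..a}")
        case True
        then show ?thesis using mult_left_mono[OF near[OF True] fejer_nonneg[of u]] by (simp add: algebra_simps)
      next
        case False
        have "- \<eta> \<le> \<sigma> * D (c - u / T)" using D\<eta>[of "c - u / T"] \<sigma>(3) by (auto simp: abs_le_iff)
        from mult_left_mono[OF this fejer_nonneg[of u]] show ?thesis using False by (simp add: algebra_simps)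
      qed
      have i1: "integrable lborel (\<lambda>u. indicator {-a..a} u * fejer u)"
        using integrable_mult_indicator[OF _ fejer_integrable, of "{-a..a}"] by simp
      have i2: "integrable lborel (\<lambda>u. fejer u * (\<sigma> * D (c - u / T)))"
      proof (rule Bochner_Integration.integrable_bound[OF fejer_integrable])
        show "AE u in lborel. norm (fejer u * (\<sigma> * D (c - u / T))) \<le> norm (fejer u)"
          using D1 \<sigma>(2) by (intro always_eventually allI) (simp add: abs_mult mult_left_le)
      qed measurable
      have "(LBINT u. (13 / 20 * \<eta> + \<eta>) * (indicator {-a..a} u * fejer u) - \<eta> * fejer u)
          \<le> (LBINT u. fejer u * (\<sigma> * D (c - u / T)))"
        by (intro integral_mono Bochner_Integration.integrable_diff integrable_mult_right i1 i2 fejer_integrable lower)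
      also have "(LBINT u. (13 / 20 * \<eta> + \<eta>) * (indicator {-a..a} u * fejer u) - \<eta> * fejer u)
          = (13 / 20 * \<eta> + \<eta>) * (LBINT u. indicator {-a..a} u * fejer u) - \<eta> * I"
        by (subst Bochner_Integration.integral_diff) (auto intro!: integrable_mult_right i1 fejer_integrable simp: I_def)
      also have "(LBINT u. fejer u * (\<sigma> * D (c - u / T))) = \<sigma> * (LBINT u. fejer u * D (c - u / T))"
        by (subst integral_mult_right_zero[symmetric]) (simp add: mult_ac)
      also have "\<dots> \<le> J" using DT[of c] \<sigma>(3) by (auto simp: abs_le_iff)
      finally have "(13 / 20 * \<eta> + \<eta>) * (LBINT u. indicator {-a..a} u * fejer u) - \<eta> * I \<le> J" .
      moreover have "(13 / 20 * \<eta> + \<eta>) * (19 / 20 * I) \<le> (13 / 20 * \<eta> + \<eta>) * (LBINT u. indicator {-a..a} u * fejer u)"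
        using a(2) \<eta>(1) by (intro mult_left_mono) auto
      moreover have "\<eta> * I / 2 \<le> (13 / 20 * \<eta> + \<eta>) * (19 / 20 * I) - \<eta> * I"
        using mult_pos_pos[OF \<eta>(1) I] by (simp add: algebra_simps)
      ultimately have "\<eta> * I / 2 \<le> J" by linarith
      then have "\<eta> \<le> 2 / I * J" using I by (simp add: field_simps)
      with \<eta>(3) show False by simp
    qed
    also have "\<dots> \<le> (2 / I + 8 * a) * J + (2 / I + 8 * a) * (L / T)"
      using I J0 a L T by (intro add_mono mult_right_mono) auto
    finally have "\<eta> \<le> (2 / I + 8 * a) * (J + L / T)" by (simp add: distrib_left)
    with D\<eta>[of x] show ?thesis unfolding D_def J_def by linarith
  qed
  show ?thesis unfolding smoothing_constant_def
    by (rule exI[of _ "2 / I + 8 * a"]) (use main I a in \<open>auto simp: add_pos_pos\<close>)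
qed

section \<open>Clipped random variables\<close>

lemma norm_integral_le:
  fixes f :: "'a \<Rightarrow> 'b::{banach, second_countable_topology}" and g :: "'a \<Rightarrow> real"
  assumes "integrable M f" "integrable M g" "\<And>x. norm (f x) \<le> g x"
  shows "norm (integral\<^sup>L M f) \<le> integral\<^sup>L M g"
proof -
  have "norm (integral\<^sup>L M f) \<le> (\<integral>x. norm (f x) \<partial>M)" by (rule integral_norm_bound)
  also have "\<dots> \<le> integral\<^sup>L M g" using assms by (intro integral_mono) auto
  finally show ?thesis .
qed

definition clip :: "real \<Rightarrow> real \<Rightarrow> real" where
  "clip T x = max (- T) (min T x)"

text \<open>
  A convex function of \<open>x\<close>, which is what carries tail bounds from a sum over to its summands.
\<close>
definition excess :: "real \<Rightarrow> real \<Rightarrow> real" where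
  "excess T x = max 0 (x\<^sup>2 - T\<^sup>2)"

lemma clip_measurable [measurable]: "clip T \<in> borel_measurable borel"
  unfolding clip_def by measurable

lemma excess_measurable [measurable]: "excess T \<in> borel_measurable borel"
  unfolding excess_def by measurable

lemma abs_clip_le: "0 \<le> T \<Longrightarrow> \<bar>clip T x\<bar> \<le> T"
  by (auto simp: clip_def)

lemma clip_eq: "\<bar>x\<bar> \<le> T \<Longrightarrow> clip T x = x"
  by (auto simp: clip_def)

lemma clip_lipschitz: "\<bar>clip T x - clip T y\<bar> \<le> \<bar>x - y\<bar>"
  by (auto simp: clip_def max_def min_def)

lemma excess_nonneg: "0 \<le> excess T x"
  by (simp add: excess_def)

lemma square_clip: "0 \<le> T \<Longrightarrow> (clip T x)\<^sup>2 = x\<^sup>2 - excess T x"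
proof (cases "\<bar>x\<bar> \<le> T")
  case True
  then have "x\<^sup>2 \<le> T\<^sup>2" by (metis abs_le_square_iff abs_ge_self order_trans)
  then show ?thesis using True by (simp add: clip_eq excess_def)
next
  case False
  assume T: "0 \<le> T"
  with False have "T\<^sup>2 \<le> x\<^sup>2" by (metis abs_le_square_iff abs_of_nonneg le_cases)
  moreover have "(clip T x)\<^sup>2 = T\<^sup>2" using False T by (auto simp: clip_def max_def min_def)
  ultimately show ?thesis by (simp add: excess_def)
qed

lemma square_diff_clip_le: "0 \<le> T \<Longrightarrow> (x - clip T x)\<^sup>2 \<le> excess T x"
proof (cases "\<bar>x\<bar> \<le> T")
  case True
  then show ?thesis by (simp add: clip_eq excess_nonneg)
next
  case False
  assume T: "0 \<le> T"
  have "(x - clip T x)\<^sup>2 = (\<bar>x\<bar> - T)\<^sup>2"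
    using False T by (auto simp: clip_def max_def min_def abs_if power2_commute power2_eq_square algebra_simps)
  also have "\<dots> \<le> (\<bar>x\<bar> - T) * (\<bar>x\<bar> + T)"
    using False T unfolding power2_eq_square by (intro mult_left_mono) auto
  also have "\<dots> = x\<^sup>2 - T\<^sup>2" by (simp add: algebra_simps power2_eq_square)
  also have "\<dots> \<le> excess T x" by (simp add: excess_def)
  finally show ?thesis .
qed

text \<open>
  Jensen's inequality conditionally on \<open>X\<close>: the function \<open>g\<close> is a subgradient of \<open>excess T\<close>, and
  \<open>g(X) Y\<close> has mean \<open>0\<close>.
\<close>
lemma (in prob_space) expectation_excess_mono:
  assumes ind: "indep_var borel X borel Y"
    and X: "integrable M (\<lambda>\<omega>. (X \<omega>)\<^sup>2)" and Y1: "integrable M Y" and Y2: "integrable M (\<lambda>\<omega>. (Y \<omega>)\<^sup>2)"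
    and X1: "integrable M X" and EY: "expectation Y = 0" and XY: "integrable M (\<lambda>\<omega>. (X \<omega> + Y \<omega>)\<^sup>2)"
  shows "expectation (\<lambda>\<omega>. excess T (X \<omega>)) \<le> expectation (\<lambda>\<omega>. excess T (X \<omega> + Y \<omega>))"
proof -
  define g where "g x = (if x\<^sup>2 > T\<^sup>2 then 2 * x else 0)" for x :: real
  have gm [measurable]: "g \<in> borel_measurable borel" unfolding g_def by measurable
  have [measurable]: "X \<in> borel_measurable M" "Y \<in> borel_measurable M"
    using X1 Y1 by auto
  have indg: "indep_var borel (g \<circ> X) borel (id \<circ> Y)"
    by (rule indep_var_compose[OF ind]) auto
  have gint: "integrable M (g \<circ> X)"
    by (rule Bochner_Integration.integrable_bound[of M "\<lambda>\<omega>. 2 * X \<omega>"]) (use X1 in \<open>auto simp: g_def o_def\<close>)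
  have gYint: "integrable M (\<lambda>\<omega>. g (X \<omega>) * Y \<omega>)"
    using indep_var_integrable[OF indg gint] Y1 by (simp add: o_def)
  have gY: "expectation (\<lambda>\<omega>. g (X \<omega>) * Y \<omega>) = 0"
    using indep_var_lebesgue_integral[OF indg gint] Y1 EY by (simp add: o_def)
  have exint: "integrable M (\<lambda>\<omega>. excess T (W \<omega>))" if "integrable M (\<lambda>\<omega>. (W \<omega>)\<^sup>2)" "W \<in> borel_measurable M" for W
    by (rule Bochner_Integration.integrable_bound[OF that(1)]) (use that(2) in \<open>auto simp: excess_def\<close>)
  have pt: "excess T x + g x * y \<le> excess T (x + y)" for x y
  proof (cases "x\<^sup>2 > T\<^sup>2")
    case True
    have "excess T x + g x * y \<le> (x + y)\<^sup>2 - T\<^sup>2" using True by (simp add: excess_def g_def power2_sum)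
    then show ?thesis by (simp add: excess_def)
  next
    case False
    then show ?thesis by (simp add: excess_def g_def)
  qed
  have "expectation (\<lambda>\<omega>. excess T (X \<omega>)) = expectation (\<lambda>\<omega>. excess T (X \<omega>) + g (X \<omega>) * Y \<omega>)"
    using exint[OF X] gYint gY by simp
  also have "\<dots> \<le> expectation (\<lambda>\<omega>. excess T (X \<omega> + Y \<omega>))"
    using exint[OF X] exint[OF XY] gYint pt by (intro integral_mono) auto
  finally show ?thesis .
qed

text \<open>
  Integration by parts, written as Fubini's theorem for \<open>g L - g (clip L x) = \<integral> g' t dt\<close> over the range
  \<open>x \<le> t \<le> L\<close>.  Consequently a Kolmogorov bound controls expectations of smooth functions of the clipped
  variable.
\<close>
lemma (in real_distribution) integral_clip_eq:
  fixes g g' :: "real \<Rightarrow> complex"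
  assumes L: "0 \<le> L" and g: "\<And>x. (g has_vector_derivative g' x) (at x)" and g': "continuous_on UNIV g'"
  shows "(CLINT x|M. g (clip L x)) = g L - (CLBINT t. indicator {-L..L} t *\<^sub>R (of_real (cdf M t) * g' t))"
proof -
  interpret P: pair_sigma_finite M lborel by standard
  let ?f = "\<lambda>(x, t). indicator {-L..L} t *\<^sub>R ((if x \<le> t then 1 else 0) * g' t)"
  have [measurable]: "g' \<in> borel_measurable borel" using g' by (rule borel_measurable_continuous_onI)
  have "compact (g' ` {-L..L})" using g' by (intro compact_continuous_image) (auto intro: continuous_on_subset)
  then obtain B where B: "\<And>t. t \<in> {-L..L} \<Longrightarrow> norm (g' t) \<le> B" and B0: "0 < B"
    by (metis bounded_pos compact_imp_bounded imageI)
  note [measurable] = borel_measurable_fst_snd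
  have fm: "?f \<in> borel_measurable (M \<Otimes>\<^sub>M lborel)"
    unfolding case_prod_beta by measurable
  have int: "integrable (M \<Otimes>\<^sub>M lborel) ?f"
  proof (rule Bochner_Integration.integrable_bound[OF _ fm])
    show "integrable (M \<Otimes>\<^sub>M lborel) (\<lambda>z. indicator {-L..L} (snd z) * B)"
      using integrable_strip[of "{-L..L}" B] L by simp
    show "AE z in M \<Otimes>\<^sub>M lborel. norm (?f z) \<le> norm (indicator {-L..L} (snd z) * B)"
    proof (intro always_eventually allI)
      fix z :: "real \<times> real"
      obtain x t where z: "z = (x, t)" by (cases z)
      show "norm (?f z) \<le> norm (indicator {-L..L} (snd z) * B)"
        using B[of t] B0 unfolding z by (cases "t \<in> {-L..L}") auto
    qed
  qed
  have inner1: "(CLINT x|M. ?f (x, t)) = indicator {-L..L} t *\<^sub>R (of_real (cdf M t) * g' t)" for t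
  proof -
    have "(CLINT x|M. ?f (x, t)) = (CLINT x|M. of_real (indicator {..t} x) * (indicator {-L..L} t *\<^sub>R g' t))"
      by (intro Bochner_Integration.integral_cong) (auto split: split_indicator)
    also have "\<dots> = of_real (cdf M t) * (indicator {-L..L} t *\<^sub>R g' t)"
      by (simp add: cdf_def2)
    finally show ?thesis by simp
  qed
  have inner2: "(CLBINT t. ?f (x, t)) = g L - g (clip L x)" for x
  proof -
    have cl: "clip L x \<le> L" "- L \<le> clip L x" using abs_clip_le[OF L, of x] by auto
    have "(CLBINT t. indicator {clip L x..L} t *\<^sub>R g' t) = g L - g (clip L x)"
      by (rule integral_FTC_Icc[OF cl(1)])
         (use g g' in \<open>auto intro: has_vector_derivative_at_within continuous_on_subset\<close>)
    also have "(CLBINT t. indicator {clip L x..L} t *\<^sub>R g' t) = (CLBINT t. ?f (x, t))"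
    proof (rule integral_cong_AE)
      show "AE t in lborel. indicator {clip L x..L} t *\<^sub>R g' t = ?f (x, t)"
        using AE_lborel_singleton[of L]
        by eventually_elim (use L in \<open>auto simp: clip_def split: split_indicator\<close>)
    qed auto
    finally show ?thesis by simp
  qed
  have gm: "g \<in> borel_measurable borel"
    using g by (intro borel_measurable_continuous_onI continuous_at_imp_continuous_on ballI has_vector_derivative_continuous)
  have ig: "integrable M (\<lambda>x. g (clip L x))"
  proof -
    have "compact (g ` {-L..L})" using g
      by (intro compact_continuous_image continuous_at_imp_continuous_on ballI has_vector_derivative_continuous) auto
    then obtain B' where B': "\<And>t. t \<in> {-L..L} \<Longrightarrow> norm (g t) \<le> B'"
      by (metis bounded_pos compact_imp_bounded imageI)
    show ?thesis
    proof (rule integrable_const_bound[where B = B'])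
      have "norm (g (clip L x)) \<le> B'" for x
        using B'[of "clip L x"] abs_clip_le[OF L, of x] by (simp add: abs_le_iff)
      then show "AE x in M. norm (g (clip L x)) \<le> B'" by simp
      show "(\<lambda>x. g (clip L x)) \<in> borel_measurable M"
        using measurable_compose[OF clip_measurable gm] by simp
    qed
  qed
  have "(CLINT x|M. (CLBINT t. ?f (x, t))) = (CLBINT t. (CLINT x|M. ?f (x, t)))"
    using P.Fubini_integral[of "\<lambda>x t. ?f (x, t)"] int by simp
  then have "(CLINT x|M. g L - g (clip L x)) = (CLBINT t. indicator {-L..L} t *\<^sub>R (of_real (cdf M t) * g' t))"
    by (simp only: inner1 inner2)
  moreover have "(CLINT x|M. g L - g (clip L x)) = g L - (CLINT x|M. g (clip L x))"
    using ig prob_space by simp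
  moreover have "b = a - c" if "a - b = c" for a b c :: complex using that by auto
  ultimately show ?thesis by metis
qed

lemma integral_clip_diff_le:
  fixes g g' :: "real \<Rightarrow> complex"
  assumes \<mu>: "real_distribution \<mu>" and \<nu>: "real_distribution \<nu>"
    and d: "\<And>x. \<bar>cdf \<mu> x - cdf \<nu> x\<bar> \<le> \<epsilon>"
    and L: "0 \<le> L" and g: "\<And>x. (g has_vector_derivative g' x) (at x)" and g': "continuous_on UNIV g'"
    and B: "\<And>x. \<bar>x\<bar> \<le> L \<Longrightarrow> norm (g' x) \<le> B"
  shows "norm ((CLINT x|\<mu>. g (clip L x)) - (CLINT x|\<nu>. g (clip L x))) \<le> 2 * L * B * \<epsilon>"
proof -
  interpret m: real_distribution \<mu> by fact
  interpret n: real_distribution \<nu> by fact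
  have [measurable]: "g' \<in> borel_measurable borel" using g' by (rule borel_measurable_continuous_onI)
  note cm = real_distribution.cdf_measurable
  note [measurable] = cm[OF \<mu>] cm[OF \<nu>]
  have B0: "0 \<le> B" using B[of 0] L norm_ge_zero[of "g' 0"] by linarith
  have \<epsilon>0: "0 \<le> \<epsilon>" using d[of 0] by linarith
  have indint: "integrable lborel (\<lambda>t. indicator {-L..L} t * c)" for c :: real
    using L by (intro integrable_mult_left integrable_real_indicator) auto
  have int: "integrable lborel (\<lambda>t. indicator {-L..L} t *\<^sub>R (of_real (cdf M t) * g' t))" if M: "real_distribution M" for M
  proof (rule Bochner_Integration.integrable_bound[OF indint[of B]])
    interpret real_distribution M by fact
    note [measurable] = cm[OF M]
    show "(\<lambda>t. indicator {-L..L} t *\<^sub>R (of_real (cdf M t) * g' t)) \<in> borel_measurable lborel" by measurable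
    show "AE t in lborel. norm (indicator {-L..L} t *\<^sub>R (of_real (cdf M t) * g' t)) \<le> norm (indicator {-L..L} t * B)"
    proof (intro always_eventually allI)
      fix t
      have "\<bar>cdf M t\<bar> \<le> 1" using cdf_nonneg cdf_bounded_prob by simp
      then have "t \<in> {-L..L} \<Longrightarrow> \<bar>cdf M t\<bar> * norm (g' t) \<le> 1 * B"
        using B[of t] by (intro mult_mono) auto
      then show "norm (indicator {-L..L} t *\<^sub>R (of_real (cdf M t) * g' t)) \<le> norm (indicator {-L..L} t * B)"
        using B0 by (cases "t \<in> {-L..L}") (auto simp: norm_mult)
    qed
  qed
  have "(CLINT x|\<mu>. g (clip L x)) - (CLINT x|\<nu>. g (clip L x))
    = (CLBINT t. indicator {-L..L} t *\<^sub>R (of_real (cdf \<nu> t) * g' t) - indicator {-L..L} t *\<^sub>R (of_real (cdf \<mu> t) * g' t))"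
    unfolding m.integral_clip_eq[OF L g g'] n.integral_clip_eq[OF L g g']
    by (subst Bochner_Integration.integral_diff[OF int[OF \<nu>] int[OF \<mu>]]) simp
  also have "norm \<dots> \<le> (LBINT t. indicator {-L..L} t * (B * \<epsilon>))"
  proof (rule norm_integral_le)
    show "norm (indicator {-L..L} t *\<^sub>R (of_real (cdf \<nu> t) * g' t) - indicator {-L..L} t *\<^sub>R (of_real (cdf \<mu> t) * g' t))
       \<le> indicator {-L..L} t * (B * \<epsilon>)" for t
    proof (cases "t \<in> {-L..L}")
      case True
      then have "norm (of_real (cdf \<nu> t) * g' t - of_real (cdf \<mu> t) * g' t) = \<bar>cdf \<mu> t - cdf \<nu> t\<bar> * norm (g' t)"
        by (simp flip: left_diff_distrib of_real_diff add: norm_mult abs_minus_commute)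
      also have "\<dots> \<le> \<epsilon> * B" using True d B[of t] \<epsilon>0 by (intro mult_mono) auto
      finally show ?thesis using True by (simp add: mult.commute)
    qed simp
  qed (intro Bochner_Integration.integrable_diff int \<mu> \<nu> indint)+
  also have "\<dots> = 2 * L * B * \<epsilon>" using L by simp
  finally show ?thesis .
qed

text \<open>
  The factor \<open>f\<close> makes the lemma applicable to its own conclusion, which yields the second derivative.
\<close>
lemma (in prob_space) mgf_has_field_derivative:
  assumes [measurable]: "X \<in> borel_measurable M" "f \<in> borel_measurable M"
    and X: "\<And>\<omega>. \<bar>X \<omega>\<bar> \<le> T" and f: "\<And>\<omega>. norm (f \<omega>) \<le> B"
  shows "((\<lambda>z. CLINT \<omega>|M. f \<omega> * exp (z * of_real (X \<omega>))) has_field_derivative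
     (CLINT \<omega>|M. f \<omega> * of_real (X \<omega>) * exp (z * of_real (X \<omega>)))) (at z)"
proof -
  let ?D = "CLINT \<omega>|M. f \<omega> * of_real (X \<omega>) * exp (z * of_real (X \<omega>))"
  have B: "0 \<le> B" using f norm_ge_zero order_trans by blast
  have T: "0 \<le> T" using X abs_ge_zero order_trans by blast
  have ne: "norm (exp (w * of_real (X \<omega>))) \<le> exp (norm w * T)" for w :: complex and \<omega>
  proof -
    have "norm (exp (w * of_real (X \<omega>))) \<le> exp (norm (w * of_real (X \<omega>)))" by (rule norm_exp)
    also have "\<dots> \<le> exp (norm w * T)" using X[of \<omega>] by (simp add: norm_mult mult_left_mono)
    finally show ?thesis .
  qed
  have i1: "integrable M (\<lambda>\<omega>. f \<omega> * exp (w * of_real (X \<omega>)))" for w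
  proof (rule integrable_const_bound[where B = "B * exp (norm w * T)"])
    have "norm (f \<omega> * exp (w * of_real (X \<omega>))) \<le> B * exp (norm w * T)" for \<omega>
      unfolding norm_mult by (intro mult_mono f ne B norm_ge_zero)
    then show "AE \<omega> in M. norm (f \<omega> * exp (w * of_real (X \<omega>))) \<le> B * exp (norm w * T)" by simp
  qed measurable
  have i2: "integrable M (\<lambda>\<omega>. f \<omega> * of_real (X \<omega>) * exp (w * of_real (X \<omega>)))" for w
  proof (rule integrable_const_bound[where B = "B * T * exp (norm w * T)"])
    have "norm (f \<omega> * of_real (X \<omega>) * exp (w * of_real (X \<omega>))) \<le> B * T * exp (norm w * T)" for \<omega>
      unfolding norm_mult using X[of \<omega>] by (intro mult_mono f ne B T norm_ge_zero mult_nonneg_nonneg) auto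
    then show "AE \<omega> in M. norm (f \<omega> * of_real (X \<omega>) * exp (w * of_real (X \<omega>))) \<le> B * T * exp (norm w * T)" by simp
  qed measurable
  define C where "C = B * exp (norm z * T) * (exp T * T\<^sup>2)"
  have bound: "norm (((CLINT \<omega>|M. f \<omega> * exp ((z + h) * of_real (X \<omega>))) - (CLINT \<omega>|M. f \<omega> * exp (z * of_real (X \<omega>)))) / h - ?D)
      \<le> norm h * C" if h: "h \<noteq> 0" "norm h \<le> 1" for h
  proof -
    have "((CLINT \<omega>|M. f \<omega> * exp ((z + h) * of_real (X \<omega>))) - (CLINT \<omega>|M. f \<omega> * exp (z * of_real (X \<omega>)))) - h * ?D
      = (CLINT \<omega>|M. f \<omega> * exp ((z + h) * of_real (X \<omega>)) - f \<omega> * exp (z * of_real (X \<omega>)) - h * (f \<omega> * of_real (X \<omega>) * exp (z * of_real (X \<omega>))))"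
      using i1 i2 by simp
    also have "\<dots> = (CLINT \<omega>|M. f \<omega> * exp (z * of_real (X \<omega>)) * (exp (h * of_real (X \<omega>)) - (1 + h * of_real (X \<omega>))))"
      by (intro Bochner_Integration.integral_cong refl) (simp add: algebra_simps exp_add)
    also have "norm \<dots> \<le> (LINT \<omega>|M. (norm h)\<^sup>2 * C)"
    proof (rule norm_integral_le)
      show "integrable M (\<lambda>\<omega>. f \<omega> * exp (z * of_real (X \<omega>)) * (exp (h * of_real (X \<omega>)) - (1 + h * of_real (X \<omega>))))"
      proof (rule Bochner_Integration.integrable_cong[THEN iffD1, OF refl])
        show "integrable M (\<lambda>\<omega>. f \<omega> * exp ((z + h) * of_real (X \<omega>)) - f \<omega> * exp (z * of_real (X \<omega>)) - h * (f \<omega> * of_real (X \<omega>) * exp (z * of_real (X \<omega>))))"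
          by (intro Bochner_Integration.integrable_diff integrable_mult_right i1 i2)
      qed (simp add: algebra_simps exp_add)
      fix \<omega>
      let ?w = "h * of_real (X \<omega>)"
      have nw: "norm ?w \<le> norm h * T" using X[of \<omega>] by (simp add: norm_mult mult_left_mono)
      have "norm (exp ?w - (\<Sum>k\<le>1. ?w ^ k / fact k)) \<le> exp \<bar>Re ?w\<bar> * norm ?w ^ Suc 1 / fact 1"
        by (rule Taylor_exp)
      then have "norm (exp ?w - (1 + ?w)) \<le> exp \<bar>Re ?w\<bar> * (norm ?w)\<^sup>2" by (simp add: power2_eq_square)
      also have "\<dots> \<le> exp T * (norm h * T)\<^sup>2"
      proof (intro mult_mono power_mono nw)
        have "\<bar>Re ?w\<bar> \<le> norm h * T" using nw abs_Re_le_cmod order_trans by blast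
        also have "\<dots> \<le> 1 * T" using h T by (intro mult_right_mono)
        finally show "exp \<bar>Re ?w\<bar> \<le> exp T" by simp
      qed auto
      finally have "norm (f \<omega>) * norm (exp (z * of_real (X \<omega>))) * norm (exp ?w - (1 + ?w)) \<le> B * exp (norm z * T) * (exp T * (norm h * T)\<^sup>2)"
        using f[of \<omega>] ne[of z \<omega>] B by (intro mult_mono) auto
      then show "norm (f \<omega> * exp (z * of_real (X \<omega>)) * (exp (h * of_real (X \<omega>)) - (1 + h * of_real (X \<omega>)))) \<le> (norm h)\<^sup>2 * C"
        by (simp add: norm_mult C_def power_mult_distrib mult_ac)
    qed simp
    also have "\<dots> = (norm h)\<^sup>2 * C" by (simp add: prob_space)
    finally have "norm ((CLINT \<omega>|M. f \<omega> * exp ((z + h) * of_real (X \<omega>))) - (CLINT \<omega>|M. f \<omega> * exp (z * of_real (X \<omega>))) - h * ?D) \<le> (norm h)\<^sup>2 * C" .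
    moreover have "a / h - ?D = (a - h * ?D) / h" for a using h by (simp add: field_simps)
    ultimately show ?thesis using h by (simp add: norm_divide power2_eq_square divide_le_eq mult_ac)
  qed
  have lim0: "((\<lambda>h. norm h * C) \<longlongrightarrow> 0) (at 0)" by (auto intro!: tendsto_eq_intros)
  have "((\<lambda>h. ((CLINT \<omega>|M. f \<omega> * exp ((z + h) * of_real (X \<omega>))) - (CLINT \<omega>|M. f \<omega> * exp (z * of_real (X \<omega>)))) / h - ?D) \<longlongrightarrow> 0) (at 0)"
  proof (rule Lim_null_comparison[OF _ lim0])
    show "\<forall>\<^sub>F h in at 0. norm (((CLINT \<omega>|M. f \<omega> * exp ((z + h) * of_real (X \<omega>))) - (CLINT \<omega>|M. f \<omega> * exp (z * of_real (X \<omega>)))) / h - ?D) \<le> norm h * C"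
      unfolding eventually_at by (rule exI[of _ 1]) (use bound in \<open>auto simp: dist_norm\<close>)
  qed
  then show ?thesis unfolding DERIV_def by (rule LIM_zero_cancel)
qed

section \<open>The normal law\<close>

text \<open>
  Writing \<open>z = s + i t\<close>, multiplication of the density by \<open>exp (s x)\<close> is a translation by \<open>s\<close> up to a
  constant, and what remains is the characteristic function at \<open>t\<close>.
\<close>
lemma integrable_exp_std_normal:
  fixes z :: complex
  shows "integrable std_normal_distribution (\<lambda>x. exp (z * of_real x))" (is ?int)
    and "(CLINT x|std_normal_distribution. exp (z * of_real x)) = exp (z\<^sup>2 / 2)" (is ?eq)
proof -
  interpret real_distribution std_normal_distribution by (rule real_dist_normal_dist)
  define s t where "s = Re z" and "t = Im z"
  have z: "z = of_real s + \<i> * of_real t" by (simp add: s_def t_def complex_eq_iff)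
  let ?f = "\<lambda>x. std_normal_density x *\<^sub>R exp (z * of_real x)"
  let ?c = "exp (z * of_real s - (of_real s)\<^sup>2 / 2)"
  have shift: "?f (s + 1 * x) = ?c * (std_normal_density x *\<^sub>R iexp (t * x))" for x
  proof -
    have 1: "std_normal_density (s + x) = std_normal_density x * exp (- s * x - s\<^sup>2 / 2)"
      by (simp add: normal_density_def exp_add[symmetric] power2_sum field_simps)
    have "?f (s + 1 * x) = of_real (std_normal_density x) * (exp (of_real (- s * x - s\<^sup>2 / 2)) * exp (z * of_real (s + x)))"
      by (simp add: 1 scaleR_conv_of_real exp_of_real[symmetric] mult.assoc del: exp_of_real)
    also have "exp (of_real (- s * x - s\<^sup>2 / 2)) * exp (z * of_real (s + x)) = ?c * iexp (t * x)"
      by (simp add: exp_add[symmetric] z algebra_simps power2_eq_square)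
    finally show ?thesis by (simp add: scaleR_conv_of_real mult_ac)
  qed
  have ii: "integrable lborel (\<lambda>x. std_normal_density x *\<^sub>R iexp (t * x))"
  proof (rule integrable_density[THEN iffD1])
    show "integrable std_normal_distribution (\<lambda>x. iexp (t * x))" by (intro integrable_iexp) auto
  qed auto
  have "integrable lborel (\<lambda>x. ?f (s + 1 * x))"
    unfolding shift by (intro integrable_mult_right ii)
  then have int: "integrable lborel ?f"
    using lborel_integrable_real_affine_iff[of 1 ?f s] by simp
  then show ?int by (subst integrable_density) auto
  have "(CLINT x|std_normal_distribution. exp (z * of_real x)) = (CLBINT x. ?f x)"
    by (subst integral_density) auto
  also have "\<dots> = (CLBINT x. ?f (s + 1 * x))"
    using lborel_integral_real_affine[of 1 ?f s] by simp
  also have "\<dots> = ?c * (CLBINT x. std_normal_density x *\<^sub>R iexp (t * x))"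
    unfolding shift by (rule integral_mult_right_zero)
  also have "(CLBINT x. std_normal_density x *\<^sub>R iexp (t * x)) = char std_normal_distribution t"
    unfolding char_def by (subst integral_density) auto
  also have "?c * char std_normal_distribution t = exp (z\<^sup>2 / 2)"
  proof -
    have "z * of_real s - (of_real s)\<^sup>2 / 2 + of_real (- (t\<^sup>2) / 2) = z\<^sup>2 / 2"
      by (simp add: complex_eq_iff power2_eq_square s_def t_def)
    then show ?thesis
      unfolding char_std_normal_distribution exp_of_real[symmetric] exp_add[symmetric] by (simp only:)
  qed
  finally show ?eq .
qed

lemma std_normal_exp_real:
  fixes a :: real
  shows "integrable std_normal_distribution (\<lambda>x. exp (a * x))"
    and "(LINT x|std_normal_distribution. exp (a * x)) = exp (a\<^sup>2 / 2)"
proof -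
  have eq: "exp (of_real a * of_real x) = (of_real (exp (a * x)) :: complex)" for x
    by (simp flip: of_real_mult exp_of_real)
  show "integrable std_normal_distribution (\<lambda>x. exp (a * x))"
    using integrable_exp_std_normal(1)[of "of_real a"] unfolding eq complex_of_real_integrable_eq .
  have "of_real (LINT x|std_normal_distribution. exp (a * x)) = (CLINT x|std_normal_distribution. exp (of_real a * of_real x))"
    unfolding eq by (simp only: integral_complex_of_real)
  also have "\<dots> = exp ((of_real a)\<^sup>2 / 2)" by (rule integrable_exp_std_normal(2))
  also have "\<dots> = of_real (exp (a\<^sup>2 / 2))" by (simp flip: exp_of_real)
  finally show "(LINT x|std_normal_distribution. exp (a * x)) = exp (a\<^sup>2 / 2)"
    by (simp only: of_real_eq_iff)
qed

lemma std_normal_exp_clip: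
  fixes z :: complex
  assumes L: "0 \<le> L" and s: "0 \<le> s"
  shows "norm ((CLINT x|std_normal_distribution. exp (z * of_real (clip L x))) - exp (z\<^sup>2 / 2))
    \<le> 4 * exp ((norm z + s)\<^sup>2 / 2 - s * L)"
proof -
  interpret real_distribution std_normal_distribution by (rule real_dist_normal_dist)
  let ?N = std_normal_distribution and ?a = "norm z + s"
  have ne: "norm (exp (z * of_real y)) \<le> exp (norm z * \<bar>x\<bar>)" if "\<bar>y\<bar> \<le> \<bar>x\<bar>" for x y :: real
  proof -
    have "norm (exp (z * of_real y)) \<le> exp (norm (z * of_real y))" by (rule norm_exp)
    also have "\<dots> \<le> exp (norm z * \<bar>x\<bar>)" using that by (simp add: norm_mult mult_left_mono)
    finally show ?thesis .
  qed
  have i1: "integrable ?N (\<lambda>x. exp (z * of_real (clip L x)))"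
  proof (rule integrable_const_bound[where B = "exp (norm z * L)"])
    show "AE x in ?N. norm (exp (z * of_real (clip L x))) \<le> exp (norm z * L)"
      using ne[of "clip L x" L for x] abs_clip_le[OF L] L by (intro always_eventually allI) simp
  qed auto
  have i2: "integrable ?N (\<lambda>x. 2 * exp (- s * L) * (exp (?a * x) + exp (- ?a * x)))"
    by (intro integrable_mult_right Bochner_Integration.integrable_add std_normal_exp_real)
  have "norm ((CLINT x|?N. exp (z * of_real (clip L x))) - (CLINT x|?N. exp (z * of_real x)))
     = norm (CLINT x|?N. exp (z * of_real (clip L x)) - exp (z * of_real x))"
    by (subst Bochner_Integration.integral_diff[OF i1 integrable_exp_std_normal(1)]) simp
  also have "\<dots> \<le> (LINT x|?N. 2 * exp (- s * L) * (exp (?a * x) + exp (- ?a * x)))"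
  proof (rule norm_integral_le[OF Bochner_Integration.integrable_diff[OF i1 integrable_exp_std_normal(1)] i2])
    fix x
    have pos: "0 < exp (- s * L) * (exp (?a * x) + exp (- ?a * x))" by (intro mult_pos_pos add_pos_pos) auto
    show "norm (exp (z * of_real (clip L x)) - exp (z * of_real x)) \<le> 2 * exp (- s * L) * (exp (?a * x) + exp (- ?a * x))"
    proof (cases "\<bar>x\<bar> \<le> L")
      case True
      then show ?thesis using pos by (simp add: clip_eq)
    next
      case False
      have "norm (exp (z * of_real (clip L x)) - exp (z * of_real x)) \<le> norm (exp (z * of_real (clip L x))) + norm (exp (z * of_real x))"
        by (rule norm_triangle_ineq4)
      also have "\<dots> \<le> 2 * exp (norm z * \<bar>x\<bar>)"
      proof -
        have "norm (exp (z * of_real (clip L x))) \<le> exp (norm z * \<bar>x\<bar>)"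
          by (rule ne) (use False abs_clip_le[OF L, of x] in linarith)
        moreover have "norm (exp (z * of_real x)) \<le> exp (norm z * \<bar>x\<bar>)" by (rule ne) simp
        ultimately show ?thesis by linarith
      qed
      also have "\<dots> \<le> 2 * exp (?a * \<bar>x\<bar> - s * L)"
        using False s mult_left_mono[of L "\<bar>x\<bar>" s] by (simp add: algebra_simps)
      also have "\<dots> = 2 * exp (- s * L) * exp (?a * \<bar>x\<bar>)" by (simp add: exp_diff exp_minus field_simps)
      also have "exp (?a * \<bar>x\<bar>) \<le> exp (?a * x) + exp (- ?a * x)"
      proof (cases "0 \<le> x")
        case True
        then have "\<bar>x\<bar> = x" by simp
        then show ?thesis using exp_ge_zero[of "- ?a * x"] by (simp only: le_add_same_cancel1)
      next
        case False
        then have "\<bar>x\<bar> = - x" by simp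
        then have "?a * \<bar>x\<bar> = - ?a * x" by (simp only: mult_minus_left mult_minus_right)
        then show ?thesis using exp_ge_zero[of "?a * x"] by (simp only: le_add_same_cancel2)
      qed
      finally show ?thesis by simp
    qed
  qed
  also have "\<dots> = 2 * exp (- s * L) * (exp (?a\<^sup>2 / 2) + exp ((- ?a)\<^sup>2 / 2))"
    by (subst integral_mult_right_zero, subst Bochner_Integration.integral_add)
       (simp_all only: std_normal_exp_real)
  also have "\<dots> = 4 * exp (?a\<^sup>2 / 2 - s * L)"
  proof -
    have "exp (?a\<^sup>2 / 2 - s * L) = exp (- s * L) * exp (?a\<^sup>2 / 2)"
      by (simp only: exp_add[symmetric]) (simp add: algebra_simps)
    moreover have "2 * e * (A + A) = 4 * (e * A)" for e A :: real by simp
    ultimately show ?thesis by (simp only: power2_minus)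
  qed
  finally show ?thesis by (simp only: integrable_exp_std_normal(2))
qed

lemma std_normal_square:
  "integrable std_normal_distribution (\<lambda>x. x\<^sup>2)" "(LINT x|std_normal_distribution. x\<^sup>2) = 1"
proof -
  show "integrable std_normal_distribution (\<lambda>x. x\<^sup>2)" by (rule integrable_std_normal_distribution_moment)
  show "(LINT x|std_normal_distribution. x\<^sup>2) = 1"
    using std_normal_distribution_even_moments[of 1] by (simp add: numeral_eq_Suc)
qed

text \<open>
  Since \<open>excess T x \<le> 4 exp ((x\<^sup>2 - T\<^sup>2) / 4)\<close> and \<open>exp (x\<^sup>2 / 4)\<close> has expectation \<open>sqrt 2\<close>.
\<close>
lemma std_normal_excess_le:
  "(LINT x|std_normal_distribution. excess T x) \<le> 6 * exp (- T\<^sup>2 / 4)"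
proof -
  interpret real_distribution std_normal_distribution by (rule real_dist_normal_dist)
  have ei: "integrable std_normal_distribution (excess T)"
    by (rule Bochner_Integration.integrable_bound[OF std_normal_square(1)]) (auto simp: excess_def)
  have eq: "std_normal_density x * exp (x\<^sup>2 / 4) = sqrt 2 * normal_density 0 (sqrt 2) x" for x
    by (simp add: normal_density_def real_sqrt_mult field_simps flip: exp_add)
  have i2: "integrable std_normal_distribution (\<lambda>x. exp (x\<^sup>2 / 4))"
    by (subst integrable_density) (auto simp: eq)
  have v2: "(LINT x|std_normal_distribution. exp (x\<^sup>2 / 4)) = sqrt 2"
    by (subst integral_density) (auto simp: eq)
  have "excess T x \<le> 4 * exp (- T\<^sup>2 / 4) * exp (x\<^sup>2 / 4)" for x
  proof -
    have "1 + (x\<^sup>2 - T\<^sup>2) / 4 \<le> exp ((x\<^sup>2 - T\<^sup>2) / 4)" by (rule exp_ge_add_one_self)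
    moreover have "0 < exp ((x\<^sup>2 - T\<^sup>2) / 4)" by simp
    moreover have "u \<le> 4 * e" if "1 + u / 4 \<le> e" for u e :: real using that by simp
    ultimately have "x\<^sup>2 - T\<^sup>2 \<le> 4 * exp ((x\<^sup>2 - T\<^sup>2) / 4)" by blast
    then have "excess T x \<le> 4 * exp ((x\<^sup>2 - T\<^sup>2) / 4)" unfolding excess_def by (intro max.boundedI) simp_all
    also have "exp ((x\<^sup>2 - T\<^sup>2) / 4) = exp (- T\<^sup>2 / 4) * exp (x\<^sup>2 / 4)"
      by (simp add: diff_divide_distrib flip: exp_add)
    finally show ?thesis by simp
  qed
  then have "(LINT x|std_normal_distribution. excess T x) \<le> (LINT x|std_normal_distribution. 4 * exp (- T\<^sup>2 / 4) * exp (x\<^sup>2 / 4))"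
    using ei i2 by (intro integral_mono) auto
  also have "\<dots> = 4 * sqrt 2 * exp (- T\<^sup>2 / 4)" by (simp add: v2)
  also have "\<dots> \<le> 6 * exp (- T\<^sup>2 / 4)"
  proof -
    have "sqrt 2 \<le> sqrt ((3 / 2)\<^sup>2)" by (intro real_sqrt_le_mono) (simp add: power2_eq_square)
    then have "4 * sqrt 2 \<le> 6" by simp
    then show ?thesis by (rule mult_right_mono) simp
  qed
  finally show ?thesis .
qed

section \<open>Two summands with a nearly normal sum\<close>

text \<open>
  The mean value inequality on a half plane.
\<close>
lemma norm_exp_diff_le:
  fixes a b :: complex
  assumes "Re a \<le> c" "Re b \<le> c"
  shows "norm (exp a - exp b) \<le> norm (a - b) * exp c"
proof -
  have "norm (exp a - exp b) \<le> exp c * norm (a - b)"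
  proof (rule field_differentiable_bound[of "{z. Re z \<le> c}" exp exp "exp c" a b])
    show "convex {z. Re z \<le> c}" by (rule convex_halfspace_Re_le)
    show "(exp has_field_derivative exp z) (at z within {z. Re z \<le> c})" for z :: complex
      by (rule has_field_derivative_at_within[OF DERIV_exp])
  qed (use assms in auto)
  then show ?thesis by (simp add: mult.commute)
qed

lemma (in prob_space) indep_var_swap:
  assumes "indep_var S X T Y"
  shows "indep_var T Y S X"
proof -
  have swap: "indep_set B A" if "indep_set A B" for A B
    using that unfolding indep_sets2_eq by (metis Int_commute mult.commute)
  show ?thesis using assms unfolding indep_var_eq by (blast intro: swap)
qed

lemma (in prob_space) abs_expectation_le:
  assumes "integrable M W" "integrable M (\<lambda>\<omega>. (W \<omega>)\<^sup>2)" "expectation (\<lambda>\<omega>. (W \<omega>)\<^sup>2) \<le> d"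
  shows "expectation (\<lambda>\<omega>. \<bar>W \<omega>\<bar>) \<le> sqrt d"
proof -
  have "0 \<le> variance (\<lambda>\<omega>. \<bar>W \<omega>\<bar>)" by (rule variance_positive)
  also have "variance (\<lambda>\<omega>. \<bar>W \<omega>\<bar>) = expectation (\<lambda>\<omega>. (W \<omega>)\<^sup>2) - (expectation (\<lambda>\<omega>. \<bar>W \<omega>\<bar>))\<^sup>2"
    using assms by (subst variance_eq) auto
  finally have "(expectation (\<lambda>\<omega>. \<bar>W \<omega>\<bar>))\<^sup>2 \<le> d" using assms(3) by simp
  then show ?thesis using real_le_rsqrt by blast
qed

lemma real_distribution_normal:
  assumes v: "0 < v"
  shows "real_distribution (density lborel (normal_density 0 v))"
proof -
  interpret prob_space "density lborel (normal_density 0 v)" by (rule prob_space_normal_density[OF v])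
  show ?thesis by unfold_locales auto
qed

lemma char_normal:
  assumes v: "0 < v"
  shows "char (density lborel (normal_density 0 v)) t = exp (- of_real (v\<^sup>2 * t\<^sup>2 / 2))"
proof -
  have d: "v * normal_density 0 v (v * x) = std_normal_density x" for x
    using v by (simp add: normal_density_def real_sqrt_mult power_mult_distrib)
  have "char (density lborel (normal_density 0 v)) t = (CLBINT x. normal_density 0 v x *\<^sub>R iexp (t * x))"
    unfolding char_def by (subst integral_density) auto
  also have "\<dots> = \<bar>v\<bar> *\<^sub>R (CLBINT x. normal_density 0 v (0 + v * x) *\<^sub>R iexp (t * (0 + v * x)))"
    by (rule lborel_integral_real_affine) (use v in simp)
  also have "\<dots> = (CLBINT x. v *\<^sub>R (normal_density 0 v (0 + v * x) *\<^sub>R iexp (t * (0 + v * x))))"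
    using v by (simp only: integral_scaleR_right abs_of_pos)
  also have "\<dots> = (CLBINT x. std_normal_density x *\<^sub>R iexp (t * v * x))"
    by (simp only: scaleR_scaleR d add_0_left mult.assoc)
  also have "\<dots> = char std_normal_distribution (t * v)"
    unfolding char_def by (subst integral_density) auto
  also have "\<dots> = exp (- of_real (v\<^sup>2 * t\<^sup>2 / 2))"
    unfolding char_std_normal_distribution by (simp add: exp_of_real[symmetric] power_mult_distrib mult.commute del: exp_of_real)
  finally show ?thesis .
qed

text \<open>
  The normal density is at most \<open>1 / (v sqrt (2 \<pi>))\<close>.
\<close>
lemma normal_cdf_lipschitz:
  assumes v: "0 < v" and xy: "x \<le> y"
  shows "cdf (density lborel (normal_density 0 v)) y - cdf (density lborel (normal_density 0 v)) x \<le> 1 / v * (y - x)"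
proof (cases "x = y")
  case False
  let ?\<nu> = "density lborel (normal_density 0 v)"
  interpret real_distribution ?\<nu> by (rule real_distribution_normal[OF v])
  have nd: "normal_density 0 v t \<le> 1 / v" for t
  proof -
    have "1 \<le> sqrt (2 * pi)" using pi_gt3 by simp
    then have "v * 1 \<le> v * sqrt (2 * pi)" using v by (intro mult_left_mono) auto
    moreover have "sqrt (2 * pi * v\<^sup>2) = v * sqrt (2 * pi)" using v by (simp add: real_sqrt_mult)
    ultimately have "1 / sqrt (2 * pi * v\<^sup>2) \<le> 1 / v" using v by (simp add: frac_le)
    moreover have "exp (- (t - 0)\<^sup>2 / (2 * v\<^sup>2)) \<le> 1" by simp
    ultimately have "1 / sqrt (2 * pi * v\<^sup>2) * exp (- (t - 0)\<^sup>2 / (2 * v\<^sup>2)) \<le> 1 / v * 1"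
      using v by (intro mult_mono) auto
    then show ?thesis by (simp add: normal_density_def)
  qed
  have "cdf ?\<nu> y - cdf ?\<nu> x = measure ?\<nu> {x<..y}" using False xy by (intro cdf_diff_eq) simp
  also have "\<dots> = (LINT t|?\<nu>. indicator {x<..y} t)" by simp
  also have "\<dots> = (LBINT t. normal_density 0 v t * indicator {x<..y} t)"
    by (subst integral_density) auto
  also have "\<dots> \<le> (LBINT t. 1 / v * indicator {x<..y} t)"
  proof (rule integral_mono)
    show "integrable lborel (\<lambda>t. normal_density 0 v t * indicator {x<..y} t)"
      using integrable_mult_indicator[of "{x<..y}" lborel "normal_density 0 v"] integrable_normal_density[OF v]
      by (simp add: mult.commute)
    show "integrable lborel (\<lambda>t. 1 / v * indicator {x<..y} t)"
      by (intro integrable_mult_right integrable_real_indicator) (use xy in auto)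
    show "normal_density 0 v t * indicator {x<..y} t \<le> 1 / v * indicator {x<..y} t" for t
      by (rule mult_right_mono[OF nd]) simp
  qed
  also have "\<dots> = 1 / v * (y - x)" using xy by simp
  finally show ?thesis .
qed simp

lemma integral_gauss_square:
  fixes v :: real
  assumes v: "0 < v"
  shows "integrable lborel (\<lambda>t. t\<^sup>2 * exp (- (v\<^sup>2 * t\<^sup>2 / 8)))"
    and "(LBINT t. t\<^sup>2 * exp (- (v\<^sup>2 * t\<^sup>2 / 8))) \<le> 24 / v ^ 3"
proof -
  define s where "s = 2 / v"
  have s: "0 < s" using v by (simp add: s_def)
  have eq: "t\<^sup>2 * exp (- (v\<^sup>2 * t\<^sup>2 / 8)) = sqrt (2 * pi) * s * (normal_density 0 s t * (t - 0) ^ (2 * 1))" for t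
  proof -
    have "t\<^sup>2 / (2 * s\<^sup>2) = v\<^sup>2 * t\<^sup>2 / 8" using v by (simp add: s_def power_divide field_simps)
    then show ?thesis using s by (simp add: normal_density_def real_sqrt_mult)
  qed
  show "integrable lborel (\<lambda>t. t\<^sup>2 * exp (- (v\<^sup>2 * t\<^sup>2 / 8)))"
    unfolding eq by (intro integrable_mult_right integrable_normal_moment s)
  have "(LBINT t. t\<^sup>2 * exp (- (v\<^sup>2 * t\<^sup>2 / 8))) = sqrt (2 * pi) * s * s\<^sup>2"
    unfolding eq integral_mult_right_zero integral_normal_moment_even[OF s] using s by (simp add: fact_numeral)
  also have "\<dots> \<le> 3 * (s * s\<^sup>2)"
  proof -
    have "sqrt (2 * pi) \<le> sqrt (3\<^sup>2)" using pi_less_4 by (intro real_sqrt_le_mono) simp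
    then have "sqrt (2 * pi) * (s * s\<^sup>2) \<le> 3 * (s * s\<^sup>2)" using s by (intro mult_right_mono) auto
    then show ?thesis by (simp add: mult.assoc)
  qed
  also have "\<dots> = 24 / v ^ 3" by (simp add: s_def power_divide power2_eq_square power3_eq_cube)
  finally show "(LBINT t. t\<^sup>2 * exp (- (v\<^sup>2 * t\<^sup>2 / 8))) \<le> 24 / v ^ 3" .
qed

text \<open>
  The nontrivial range of the theorem.  The parameter \<open>N\<close> is \<open>sqrt (ln (1 / \<epsilon>))\<close>; it is the natural scale
  both of the clipping level and of the discs on which the moment generating functions are controlled.
\<close>
locale near_normal_sum = prob_space M for M :: "'a measure" +
  fixes X Y :: "'a \<Rightarrow> real" and v N \<epsilon> :: real
  assumes ind: "indep_var borel X borel Y"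
    and X1: "integrable M X" and X2: "integrable M (\<lambda>\<omega>. (X \<omega>)\<^sup>2)"
    and Y1: "integrable M Y" and Y2: "integrable M (\<lambda>\<omega>. (Y \<omega>)\<^sup>2)"
    and EX: "expectation X = 0" and EY: "expectation Y = 0"
    and ES: "expectation (\<lambda>\<omega>. (X \<omega> + Y \<omega>)\<^sup>2) = 1"
    and EX2: "expectation (\<lambda>\<omega>. (X \<omega>)\<^sup>2) = v\<^sup>2"
    and close: "\<And>x. \<bar>cdf (distr M borel (\<lambda>\<omega>. X \<omega> + Y \<omega>)) x - cdf std_normal_distribution x\<bar> \<le> \<epsilon>"
    and \<epsilon>: "\<epsilon> = exp (- N\<^sup>2)" and N: "20000 \<le> N" and vN: "1 \<le> v * N" and v: "0 < v"
begin

lemma X_measurable [measurable]: "X \<in> borel_measurable M" using X1 by simp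
lemma Y_measurable [measurable]: "Y \<in> borel_measurable M" using Y1 by simp

text \<open>
  Bounds the root mean square cost of clipping a summand at \<open>2 N\<close>.
\<close>
definition q :: real where "q = 5 * N * exp (- N\<^sup>2 / 2)"

definition X' :: "'a \<Rightarrow> real" where "X' \<omega> = clip (2 * N) (X \<omega>)"
definition Y' :: "'a \<Rightarrow> real" where "Y' \<omega> = clip (2 * N) (Y \<omega>)"

lemma X'_measurable [measurable]: "X' \<in> borel_measurable M" unfolding X'_def by measurable
lemma Y'_measurable [measurable]: "Y' \<in> borel_measurable M" unfolding Y'_def by measurable

lemma abs_X'_le: "\<bar>X' \<omega>\<bar> \<le> 2 * N" and abs_Y'_le: "\<bar>Y' \<omega>\<bar> \<le> 2 * N"
  using N by (auto simp: X'_def Y'_def intro!: abs_clip_le)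

lemma q_pos: "0 < q"
  using N by (simp add: q_def)

text \<open>
  The inequality \<open>x \<le> exp x\<close> at \<open>x = N\<^sup>2 / 6\<close>, cubed, bounds \<open>exp (N\<^sup>2 / 2)\<close> below by \<open>N\<^sup>6 / 216\<close>, which for
  \<open>N \<ge> 20000\<close> exceeds the required multiple of \<open>N\<^sup>5\<close>.
\<close>
lemma q_small: "q * (10 * N ^ 4) \<le> 1"
proof -
  have N0: "0 < N" using N by simp
  have "N\<^sup>2 / 6 \<le> exp (N\<^sup>2 / 6)" using exp_ge_add_one_self[of "N\<^sup>2 / 6"] by linarith
  then have "(N\<^sup>2 / 6) ^ 3 \<le> (exp (N\<^sup>2 / 6)) ^ 3" by (intro power_mono) auto
  also have "(exp (N\<^sup>2 / 6)) ^ 3 = exp (N\<^sup>2 / 2)" by (simp flip: exp_of_nat_mult)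
  finally have e: "N ^ 6 / 216 \<le> exp (N\<^sup>2 / 2)" by (simp add: power_divide flip: power_mult)
  have "10800 * N ^ 5 \<le> N * N ^ 5" using N by (intro mult_right_mono) auto
  then have "50 * N ^ 5 \<le> N ^ 6 / 216" by (simp add: numeral_eq_Suc)
  with e have "50 * N ^ 5 \<le> exp (N\<^sup>2 / 2)" by linarith
  then have "50 * N ^ 5 * exp (- N\<^sup>2 / 2) \<le> 1" by (simp add: exp_minus field_simps)
  then show ?thesis by (simp add: q_def numeral_eq_Suc mult_ac)
qed

lemma q_le_1: "q \<le> 1"
proof -
  have "1 \<le> N ^ 4" using N by (intro one_le_power) simp
  then have "1 \<le> 10 * N ^ 4" by linarith
  then have "q * 1 \<le> q * (10 * N ^ 4)" using q_pos by (intro mult_left_mono) simp_all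
  then show ?thesis using q_small by linarith
qed

lemma sum_square_integrable: "integrable M (\<lambda>\<omega>. (X \<omega> + Y \<omega>)\<^sup>2)"
  using ES not_integrable_integral_eq by force

lemma excess_integrable:
  "integrable M (\<lambda>\<omega>. (W \<omega>)\<^sup>2) \<Longrightarrow> W \<in> borel_measurable M \<Longrightarrow> integrable M (\<lambda>\<omega>. excess T (W \<omega>))"
  by (rule Bochner_Integration.integrable_bound[where f = "\<lambda>\<omega>. (W \<omega>)\<^sup>2"]) (auto simp: excess_def)

text \<open>
  Closeness to the normal law alone says nothing about large values, but the second moments agree: what
  the clipped sum lacks in second moment is what the clipped normal variable lacks, up to an error of
  order \<open>N\<^sup>2 \<epsilon>\<close>.
\<close>
lemma expectation_excess_sum: "expectation (\<lambda>\<omega>. excess (2 * N) (X \<omega> + Y \<omega>)) \<le> q\<^sup>2"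
proof -
  let ?S = "\<lambda>\<omega>. X \<omega> + Y \<omega>" and ?Z = std_normal_distribution
  interpret Z: real_distribution ?Z by (rule real_dist_normal_dist)
  have [measurable]: "?S \<in> borel_measurable M" by measurable
  have mu: "real_distribution (distr M borel ?S)" by (rule real_distribution_distr) simp
  have N0: "0 \<le> 2 * N" using N by simp
  have "norm ((CLINT x|distr M borel ?S. of_real ((clip (2 * N) x)\<^sup>2)) - (CLINT x|?Z. of_real ((clip (2 * N) x)\<^sup>2)))
      \<le> 2 * (2 * N) * (4 * N) * \<epsilon>"
  proof (rule integral_clip_diff_le[OF mu real_dist_normal_dist close N0, where g = "\<lambda>x. of_real (x\<^sup>2)" and g' = "\<lambda>x. of_real (2 * x)"])
    show "((\<lambda>x. complex_of_real (x\<^sup>2)) has_vector_derivative complex_of_real (2 * x)) (at x)" for x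
    proof -
      have "((\<lambda>x::real. x\<^sup>2) has_real_derivative 2 * x) (at x)"
        by (auto intro!: derivative_eq_intros)
      then show ?thesis by (rule has_vector_derivative_of_real)
    qed
    show "continuous_on UNIV (\<lambda>x. complex_of_real (2 * x))" by (intro continuous_intros)
    show "norm (complex_of_real (2 * x)) \<le> 4 * N" if "\<bar>x\<bar> \<le> 2 * N" for x using that by simp
  qed
  also have "2 * (2 * N) * (4 * N) * \<epsilon> = 16 * N\<^sup>2 * \<epsilon>" by (simp add: power2_eq_square)
  finally have "\<bar>(LINT x|distr M borel ?S. (clip (2 * N) x)\<^sup>2) - (LINT x|?Z. (clip (2 * N) x)\<^sup>2)\<bar> \<le> 16 * N\<^sup>2 * \<epsilon>"
    by (simp only: integral_complex_of_real norm_of_real flip: of_real_diff)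
  moreover have "(LINT x|distr M borel ?S. (clip (2 * N) x)\<^sup>2) = 1 - expectation (\<lambda>\<omega>. excess (2 * N) (?S \<omega>))"
    using ES sum_square_integrable excess_integrable[OF sum_square_integrable] by (subst integral_distr) (auto simp: square_clip[OF N0])
  moreover have "(LINT x|?Z. (clip (2 * N) x)\<^sup>2) = 1 - (LINT x|?Z. excess (2 * N) x)"
  proof -
    have "integrable ?Z (excess (2 * N))"
      by (rule Bochner_Integration.integrable_bound[OF std_normal_square(1)]) (auto simp: excess_def)
    then show ?thesis using std_normal_square by (simp add: square_clip[OF N0])
  qed
  ultimately have "expectation (\<lambda>\<omega>. excess (2 * N) (?S \<omega>)) \<le> 16 * N\<^sup>2 * \<epsilon> + (LINT x|?Z. excess (2 * N) x)"
    by linarith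
  also have "(LINT x|?Z. excess (2 * N) x) \<le> 6 * \<epsilon>"
    using std_normal_excess_le[of "2 * N"] by (simp add: \<epsilon> power_mult_distrib)
  also have "6 * \<epsilon> \<le> 6 * N\<^sup>2 * \<epsilon>"
    using N one_le_power[of N 2] by (intro mult_right_mono) (auto simp: \<epsilon>)
  also have "16 * N\<^sup>2 * \<epsilon> + 6 * N\<^sup>2 * \<epsilon> \<le> q\<^sup>2"
  proof -
    have "(exp (- N\<^sup>2 / 2))\<^sup>2 = \<epsilon>" by (simp add: \<epsilon> flip: exp_double)
    then have "q\<^sup>2 = 25 * N\<^sup>2 * \<epsilon>" by (simp add: q_def power_mult_distrib)
    then show ?thesis by (simp add: \<epsilon>)
  qed
  finally show ?thesis by simp
qed

lemma expectation_excess: 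
  "expectation (\<lambda>\<omega>. excess (2 * N) (X \<omega>)) \<le> q\<^sup>2" "expectation (\<lambda>\<omega>. excess (2 * N) (Y \<omega>)) \<le> q\<^sup>2"
proof -
  show "expectation (\<lambda>\<omega>. excess (2 * N) (X \<omega>)) \<le> q\<^sup>2"
    using expectation_excess_mono[OF ind X2 Y1 Y2 X1 EY sum_square_integrable] expectation_excess_sum by (rule order_trans)
  have "expectation (\<lambda>\<omega>. excess (2 * N) (Y \<omega>)) \<le> expectation (\<lambda>\<omega>. excess (2 * N) (Y \<omega> + X \<omega>))"
    using expectation_excess_mono[OF indep_var_swap[OF ind] Y2 X1 X2 Y1 EX] sum_square_integrable by (simp add: add.commute)
  then show "expectation (\<lambda>\<omega>. excess (2 * N) (Y \<omega>)) \<le> q\<^sup>2"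
    using expectation_excess_sum by (simp add: add.commute)
qed

text \<open>
  The case \<open>T = 0\<close> of \<open>expectation_excess_mono\<close> is the inequality \<open>E X\<^sup>2 \<le> E (X + Y)\<^sup>2\<close>.
\<close>
lemma v_le_1: "v \<le> 1"
proof -
  have "v\<^sup>2 \<le> 1\<^sup>2"
    using expectation_excess_mono[OF ind X2 Y1 Y2 X1 EY sum_square_integrable, of 0] EX2 ES by (simp add: excess_def)
  then show ?thesis by (rule power2_le_imp_le) simp
qed

lemma clip_error:
  assumes W1: "integrable M W" and W2: "integrable M (\<lambda>\<omega>. (W \<omega>)\<^sup>2)"
    and le: "expectation (\<lambda>\<omega>. excess (2 * N) (W \<omega>)) \<le> q\<^sup>2"
  shows "integrable M (\<lambda>\<omega>. W \<omega> - clip (2 * N) (W \<omega>))"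
    and "expectation (\<lambda>\<omega>. \<bar>W \<omega> - clip (2 * N) (W \<omega>)\<bar>) \<le> q"
proof -
  have N0: "0 \<le> 2 * N" using N by simp
  have [measurable]: "W \<in> borel_measurable M" using W1 by simp
  have "integrable M (\<lambda>\<omega>. clip (2 * N) (W \<omega>))"
    by (rule integrable_const_bound[where B = "2 * N"]) (use abs_clip_le[OF N0] in auto)
  then show i: "integrable M (\<lambda>\<omega>. W \<omega> - clip (2 * N) (W \<omega>))" using W1 by simp
  have sq: "integrable M (\<lambda>\<omega>. (W \<omega> - clip (2 * N) (W \<omega>))\<^sup>2)"
    by (rule Bochner_Integration.integrable_bound[OF excess_integrable[OF W2, of "2 * N"]])
       (use square_diff_clip_le[OF N0] excess_nonneg in auto)
  have "expectation (\<lambda>\<omega>. (W \<omega> - clip (2 * N) (W \<omega>))\<^sup>2) \<le> expectation (\<lambda>\<omega>. excess (2 * N) (W \<omega>))"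
    by (intro integral_mono sq excess_integrable W2 square_diff_clip_le N0) measurable
  with le have "expectation (\<lambda>\<omega>. (W \<omega> - clip (2 * N) (W \<omega>))\<^sup>2) \<le> q\<^sup>2" by simp
  from abs_expectation_le[OF i sq this] show "expectation (\<lambda>\<omega>. \<bar>W \<omega> - clip (2 * N) (W \<omega>)\<bar>) \<le> q"
    using q_pos by simp
qed

text \<open>
  Mean and variance of the clipped summand.
\<close>
definition a :: real where "a = expectation X'"
definition w :: real where "w = expectation (\<lambda>\<omega>. (X' \<omega>)\<^sup>2) - a\<^sup>2"

lemma X'_error: "integrable M (\<lambda>\<omega>. X \<omega> - X' \<omega>)" "expectation (\<lambda>\<omega>. \<bar>X \<omega> - X' \<omega>\<bar>) \<le> q"
  using clip_error[OF X1 X2 expectation_excess(1)] by (simp_all add: X'_def)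

lemma Y'_error: "integrable M (\<lambda>\<omega>. Y \<omega> - Y' \<omega>)" "expectation (\<lambda>\<omega>. \<bar>Y \<omega> - Y' \<omega>\<bar>) \<le> q"
  using clip_error[OF Y1 Y2 expectation_excess(2)] by (simp_all add: Y'_def)

lemma X'_integrable: "integrable M X'"
  by (rule integrable_const_bound[where B = "2 * N"]) (use abs_X'_le in auto)

lemma abs_a_le: "\<bar>a\<bar> \<le> q"
proof -
  have "\<bar>a\<bar> = \<bar>expectation (\<lambda>\<omega>. X \<omega> - X' \<omega>)\<bar>" using X1 X'_integrable EX by (simp add: a_def)
  also have "\<dots> \<le> expectation (\<lambda>\<omega>. \<bar>X \<omega> - X' \<omega>\<bar>)" by (rule integral_abs_bound)
  finally show ?thesis using X'_error by simp
qed

lemma w_bounds: "w \<le> v\<^sup>2" "v\<^sup>2 - 2 * q\<^sup>2 \<le> w" "v\<^sup>2 / 2 \<le> w" "0 < w"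
proof -
  have N0: "0 \<le> 2 * N" using N by simp
  have eq: "expectation (\<lambda>\<omega>. (X' \<omega>)\<^sup>2) = v\<^sup>2 - expectation (\<lambda>\<omega>. excess (2 * N) (X \<omega>))"
    using X2 EX2 excess_integrable[OF X2] by (simp add: X'_def square_clip[OF N0])
  have "0 \<le> expectation (\<lambda>\<omega>. excess (2 * N) (X \<omega>))" by (intro integral_nonneg_AE) (auto simp: excess_nonneg)
  then show "w \<le> v\<^sup>2" unfolding w_def eq using zero_le_power2[of a] by linarith
  have "a\<^sup>2 \<le> q\<^sup>2" using abs_a_le q_pos by (metis abs_le_square_iff abs_of_pos)
  then show 1: "v\<^sup>2 - 2 * q\<^sup>2 \<le> w" using expectation_excess(1) unfolding w_def eq by linarith
  have "2 * q \<le> v"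
  proof -
    have "2 * q * N \<le> q * (10 * N ^ 4)"
    proof -
      have "1 \<le> N ^ 3" using N by (intro one_le_power) simp
      then have "2 \<le> 10 * N ^ 3" by linarith
      then have "q * N * 2 \<le> q * N * (10 * N ^ 3)" by (rule mult_left_mono) (use q_pos N in simp)
      then show ?thesis by (simp add: numeral_eq_Suc mult_ac)
    qed
    also have "\<dots> \<le> v * N" using q_small vN by linarith
    finally show ?thesis using N by (simp add: mult_le_cancel_right)
  qed
  then have "(2 * q)\<^sup>2 \<le> v\<^sup>2" using q_pos by (intro power_mono) auto
  then show 2: "v\<^sup>2 / 2 \<le> w" using 1 by (simp add: power_mult_distrib)
  have "0 < v\<^sup>2" using v by simp
  then show "0 < w" using 2 by linarith
qed

definition mX :: "complex \<Rightarrow> complex" where "mX z = (CLINT \<omega>|M. exp (z * of_real (X' \<omega>)))"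
definition mY :: "complex \<Rightarrow> complex" where "mY z = (CLINT \<omega>|M. exp (z * of_real (Y' \<omega>)))"

lemma norm_exp_le:
  fixes z :: complex
  assumes "\<bar>x\<bar> \<le> L" shows "norm (exp (z * of_real x)) \<le> exp (norm z * L)"
proof -
  have "norm (exp (z * of_real x)) \<le> exp (norm (z * of_real x))" by (rule norm_exp)
  also have "\<dots> \<le> exp (norm z * L)" using assms by (simp add: norm_mult mult_left_mono)
  finally show ?thesis .
qed

lemma exp_integrable:
  fixes z :: complex
  assumes [measurable]: "W \<in> borel_measurable M" and "\<And>\<omega>. \<bar>W \<omega>\<bar> \<le> L"
  shows "integrable M (\<lambda>\<omega>. exp (z * of_real (W \<omega>)))"
proof (rule integrable_const_bound[where B = "exp (norm z * L)"])
  show "AE \<omega> in M. norm (exp (z * of_real (W \<omega>))) \<le> exp (norm z * L)"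
    by (intro always_eventually allI norm_exp_le assms)
qed measurable

lemma mX_mult_mY: "mX z * mY z = (CLINT \<omega>|M. exp (z * of_real (X' \<omega> + Y' \<omega>)))"
proof -
  let ?f = "\<lambda>x. exp (z * of_real (clip (2 * N) x))"
  have "indep_var borel (?f \<circ> X) borel (?f \<circ> Y)"
    by (rule indep_var_compose[OF ind]) measurable
  from indep_var_lebesgue_integral[OF this]
  have "(CLINT \<omega>|M. ?f (X \<omega>) * ?f (Y \<omega>)) = (CLINT \<omega>|M. ?f (X \<omega>)) * (CLINT \<omega>|M. ?f (Y \<omega>))"
    using exp_integrable[OF X'_measurable abs_X'_le] exp_integrable[OF Y'_measurable abs_Y'_le]
    by (simp add: o_def X'_def Y'_def)
  then show ?thesis by (simp add: mX_def mY_def X'_def Y'_def exp_add[symmetric] distrib_left)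
qed

text \<open>
  Three replacements: the clipped summands by the clipped sum, which costs the \<open>L\<^sup>1\<close> clipping errors; the
  sum by a normal variable, which costs \<open>\<epsilon>\<close> times the derivative of the exponential on the clipping
  range; and the clipped normal variable by the normal variable.  For \<open>norm z \<le> N / 16\<close> the growth
  \<open>exp (4 N norm z) \<le> exp (N\<^sup>2 / 4)\<close> is beaten by \<open>q\<close> and by \<open>\<epsilon>\<close>.
\<close>
lemma mX_mult_mY_near:
  assumes z: "norm z \<le> N / 16"
  shows "norm (mX z * mY z - exp (z\<^sup>2 / 2)) \<le> 3 * (N\<^sup>2 * exp (- N\<^sup>2 / 4))"
proof -
  let ?L = "4 * N" and ?Z = std_normal_distribution
  let ?S = "\<lambda>\<omega>. X \<omega> + Y \<omega>"
  have N0: "0 \<le> ?L" "0 < N" using N by auto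
  have [measurable]: "?S \<in> borel_measurable M" by measurable
  have mu: "real_distribution (distr M borel ?S)" by (rule real_distribution_distr) simp
  have "norm z * ?L \<le> N / 16 * ?L" using z N0 by (intro mult_right_mono) auto
  then have zL: "norm z * ?L \<le> N\<^sup>2 / 4" by (simp add: power2_eq_square)
  have cl: "\<bar>X' \<omega> + Y' \<omega>\<bar> \<le> ?L" for \<omega> using abs_X'_le[of \<omega>] abs_Y'_le[of \<omega>] by linarith
  have clS: "\<bar>clip ?L (?S \<omega>)\<bar> \<le> ?L" for \<omega> using abs_clip_le[OF N0(1)] .
  have i1: "integrable M (\<lambda>\<omega>. exp (z * of_real (X' \<omega> + Y' \<omega>)))"
    by (rule exp_integrable[OF _ cl]) measurable
  have i2: "integrable M (\<lambda>\<omega>. exp (z * of_real (clip ?L (?S \<omega>))))"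
    by (rule exp_integrable[OF _ clS]) measurable
  have "norm (mX z * mY z - (CLINT \<omega>|M. exp (z * of_real (clip ?L (?S \<omega>)))))
      = norm (CLINT \<omega>|M. exp (z * of_real (X' \<omega> + Y' \<omega>)) - exp (z * of_real (clip ?L (?S \<omega>))))"
    unfolding mX_mult_mY by (simp only: Bochner_Integration.integral_diff[OF i1 i2])
  also have "\<dots> \<le> (LINT \<omega>|M. norm z * exp (N\<^sup>2 / 4) * (\<bar>X \<omega> - X' \<omega>\<bar> + \<bar>Y \<omega> - Y' \<omega>\<bar>))"
  proof (rule norm_integral_le)
    show "integrable M (\<lambda>\<omega>. exp (z * of_real (X' \<omega> + Y' \<omega>)) - exp (z * of_real (clip ?L (?S \<omega>))))"
      by (rule Bochner_Integration.integrable_diff[OF i1 i2])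
    show "integrable M (\<lambda>\<omega>. norm z * exp (N\<^sup>2 / 4) * (\<bar>X \<omega> - X' \<omega>\<bar> + \<bar>Y \<omega> - Y' \<omega>\<bar>))"
      using X'_error Y'_error by (intro integrable_mult_right Bochner_Integration.integrable_add integrable_abs)
    fix \<omega>
    let ?p = "X' \<omega> + Y' \<omega>" and ?r = "clip ?L (?S \<omega>)"
    have Re: "Re (z * of_real x) \<le> N\<^sup>2 / 4" if "\<bar>x\<bar> \<le> ?L" for x
    proof -
      have "Re (z * of_real x) \<le> norm (z * of_real x)" by (rule complex_Re_le_cmod)
      also have "\<dots> \<le> norm z * ?L" using that by (simp add: norm_mult mult_left_mono)
      finally show ?thesis using zL by simp
    qed
    have "norm (exp (z * of_real ?p) - exp (z * of_real ?r)) \<le> norm (z * of_real ?p - z * of_real ?r) * exp (N\<^sup>2 / 4)"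
      by (rule norm_exp_diff_le[OF Re[OF cl] Re[OF clS]])
    also have "norm (z * of_real ?p - z * of_real ?r) = norm z * \<bar>?p - ?r\<bar>"
      by (simp only: right_diff_distrib[symmetric] of_real_diff[symmetric] norm_mult norm_of_real)
    also have "\<bar>?p - ?r\<bar> \<le> \<bar>?p - ?S \<omega>\<bar>"
      using clip_lipschitz[of ?L ?p "?S \<omega>"] clip_eq[OF cl] by simp
    also have "\<dots> \<le> \<bar>X \<omega> - X' \<omega>\<bar> + \<bar>Y \<omega> - Y' \<omega>\<bar>" by linarith
    finally show "norm (exp (z * of_real ?p) - exp (z * of_real ?r)) \<le> norm z * exp (N\<^sup>2 / 4) * (\<bar>X \<omega> - X' \<omega>\<bar> + \<bar>Y \<omega> - Y' \<omega>\<bar>)"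
      by (simp add: mult_ac mult_left_mono mult_right_mono)
  qed
  also have "\<dots> = norm z * exp (N\<^sup>2 / 4) * (expectation (\<lambda>\<omega>. \<bar>X \<omega> - X' \<omega>\<bar>) + expectation (\<lambda>\<omega>. \<bar>Y \<omega> - Y' \<omega>\<bar>))"
    using X'_error Y'_error by simp
  also have "\<dots> \<le> N / 16 * exp (N\<^sup>2 / 4) * (q + q)"
    using X'_error Y'_error z N0 by (intro mult_mono add_mono) (auto intro!: add_nonneg_nonneg integral_nonneg_AE)
  also have "\<dots> = 10 / 16 * (N\<^sup>2 * (exp (N\<^sup>2 / 4) * exp (- N\<^sup>2 / 2)))" by (simp add: q_def power2_eq_square)
  also have "exp (N\<^sup>2 / 4) * exp (- N\<^sup>2 / 2) = exp (- N\<^sup>2 / 4)" by (simp flip: exp_add)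
  also have "10 / 16 * (N\<^sup>2 * exp (- N\<^sup>2 / 4)) \<le> N\<^sup>2 * exp (- N\<^sup>2 / 4)" by simp
  finally have t1: "norm (mX z * mY z - (CLINT \<omega>|M. exp (z * of_real (clip ?L (?S \<omega>))))) \<le> N\<^sup>2 * exp (- N\<^sup>2 / 4)" .
  have "norm ((CLINT x|distr M borel ?S. exp (z * of_real (clip ?L x))) - (CLINT x|?Z. exp (z * of_real (clip ?L x))))
      \<le> 2 * ?L * (norm z * exp (N\<^sup>2 / 4)) * \<epsilon>"
  proof (rule integral_clip_diff_le[OF mu real_dist_normal_dist close N0(1), where g = "\<lambda>x. exp (z * of_real x)" and g' = "\<lambda>x. z * exp (z * of_real x)"])
    show "((\<lambda>x. exp (z * complex_of_real x)) has_vector_derivative z * exp (z * of_real x)) (at x)" for x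
    proof -
      have "((\<lambda>w. exp (z * w)) has_field_derivative z * exp (z * of_real x)) (at (of_real x))"
        by (auto intro!: derivative_eq_intros)
      then show ?thesis by (rule has_vector_derivative_real_field)
    qed
    show "continuous_on UNIV (\<lambda>x. z * exp (z * complex_of_real x))" by (intro continuous_intros)
    show "norm (z * exp (z * complex_of_real x)) \<le> norm z * exp (N\<^sup>2 / 4)" if "\<bar>x\<bar> \<le> ?L" for x
    proof -
      have "norm (exp (z * complex_of_real x)) \<le> exp (norm z * ?L)" by (rule norm_exp_le[OF that])
      also have "\<dots> \<le> exp (N\<^sup>2 / 4)" using zL by simp
      finally show ?thesis unfolding norm_mult by (rule mult_left_mono) simp
    qed
  qed
  also have "(CLINT x|distr M borel ?S. exp (z * of_real (clip ?L x))) = (CLINT \<omega>|M. exp (z * of_real (clip ?L (?S \<omega>))))"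
    by (subst integral_distr) auto
  also have "2 * ?L * (norm z * exp (N\<^sup>2 / 4)) * \<epsilon> \<le> N\<^sup>2 * exp (- N\<^sup>2 / 4)"
  proof -
    have "2 * ?L * (norm z * exp (N\<^sup>2 / 4)) * \<epsilon> \<le> 2 * ?L * (N / 16 * exp (N\<^sup>2 / 4)) * \<epsilon>"
      using z N0 by (intro mult_right_mono mult_left_mono) (auto simp: \<epsilon>)
    also have "\<dots> = 1 / 2 * (N\<^sup>2 * (exp (N\<^sup>2 / 4) * \<epsilon>))" by (simp add: power2_eq_square)
    also have "exp (N\<^sup>2 / 4) * \<epsilon> = exp (N\<^sup>2 / 4 - N\<^sup>2)" by (simp only: \<epsilon> exp_add[symmetric] diff_conv_add_uminus)
    also have "1 / 2 * (N\<^sup>2 * exp (N\<^sup>2 / 4 - N\<^sup>2)) \<le> 1 * (N\<^sup>2 * exp (- N\<^sup>2 / 4))" by (intro mult_mono) auto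
    finally show ?thesis by simp
  qed
  finally have t2: "norm ((CLINT \<omega>|M. exp (z * of_real (clip ?L (?S \<omega>)))) - (CLINT x|?Z. exp (z * of_real (clip ?L x)))) \<le> N\<^sup>2 * exp (- N\<^sup>2 / 4)" .
  have "norm ((CLINT x|?Z. exp (z * of_real (clip ?L x))) - exp (z\<^sup>2 / 2)) \<le> 4 * exp ((norm z + N)\<^sup>2 / 2 - N * ?L)"
    by (rule std_normal_exp_clip[OF N0(1)]) (use N0 in simp)
  also have "\<dots> \<le> N\<^sup>2 * exp (- N\<^sup>2 / 4)"
  proof (rule mult_mono)
    have "2 * 2 \<le> N * N" using N by (intro mult_mono) auto
    then show "4 \<le> N\<^sup>2" by (simp add: power2_eq_square)
    have "(norm z + N)\<^sup>2 \<le> (2 * N)\<^sup>2" using z N0 by (intro power_mono) auto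
    then have "(norm z + N)\<^sup>2 \<le> 4 * N\<^sup>2" by (simp add: power_mult_distrib)
    moreover have "N * ?L = 4 * N\<^sup>2" by (simp add: power2_eq_square)
    ultimately have "(norm z + N)\<^sup>2 / 2 - N * ?L \<le> - N\<^sup>2 / 4" using zero_le_power2[of N] by linarith
    then show "exp ((norm z + N)\<^sup>2 / 2 - N * ?L) \<le> exp (- N\<^sup>2 / 4)" by simp
  qed auto
  finally have t3: "norm ((CLINT x|?Z. exp (z * of_real (clip ?L x))) - exp (z\<^sup>2 / 2)) \<le> N\<^sup>2 * exp (- N\<^sup>2 / 4)" .
  let ?A = "CLINT \<omega>|M. exp (z * of_real (clip ?L (?S \<omega>)))" and ?B = "CLINT x|?Z. exp (z * of_real (clip ?L x))"
  have "norm (mX z * mY z - exp (z\<^sup>2 / 2)) \<le> norm (mX z * mY z - ?A) + norm (?A - ?B) + norm (?B - exp (z\<^sup>2 / 2))"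
    using norm_triangle_ineq[of "mX z * mY z - ?A" "?A - ?B"] norm_triangle_ineq[of "mX z * mY z - ?B" "?B - exp (z\<^sup>2 / 2)"] by simp
  then show ?thesis using t1 t2 t3 by linarith
qed

text \<open>
  On this disc \<open>exp (z\<^sup>2 / 2)\<close> is at least \<open>exp (- N\<^sup>2 / 8)\<close> in modulus, so the product of the two moment
  generating functions does not vanish.  This is the step in which the hypothesis on the sum excludes
  zeros, as in the proof of Cramer's theorem.
\<close>
lemma mX_nonzero:
  assumes z: "norm z \<le> N / 16"
  shows "mX z \<noteq> 0"
proof
  assume "mX z = 0"
  then have "norm (exp (z\<^sup>2 / 2)) \<le> 3 * (N\<^sup>2 * exp (- N\<^sup>2 / 4))"
    using mX_mult_mY_near[OF z] by (simp del: norm_exp_eq_Re)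
  moreover have "exp (- N\<^sup>2 / 8) \<le> norm (exp (z\<^sup>2 / 2))"
  proof -
    have "(norm z)\<^sup>2 \<le> (N / 16)\<^sup>2" using z by (intro power_mono) auto
    then have "(norm z)\<^sup>2 \<le> N\<^sup>2 / 256" by (simp add: power_divide)
    then have "(norm z)\<^sup>2 / 2 \<le> N\<^sup>2 / 8" using zero_le_power2[of N] by linarith
    moreover have "- Re (z\<^sup>2 / 2) \<le> norm (z\<^sup>2 / 2)" using abs_Re_le_cmod[of "z\<^sup>2 / 2"] by linarith
    ultimately have "- N\<^sup>2 / 8 \<le> Re (z\<^sup>2 / 2)" by (simp add: norm_divide norm_power)
    then show ?thesis by (simp only: norm_exp_eq_Re exp_le_cancel_iff)
  qed
  moreover have "3 * (N\<^sup>2 * exp (- N\<^sup>2 / 4)) < exp (- N\<^sup>2 / 8)"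
  proof -
    have "N\<^sup>2 / 16 \<le> exp (N\<^sup>2 / 16)" using exp_ge_add_one_self[of "N\<^sup>2 / 16"] by linarith
    then have "(N\<^sup>2 / 16)\<^sup>2 \<le> (exp (N\<^sup>2 / 16))\<^sup>2" by (intro power_mono) auto
    also have "\<dots> = exp (N\<^sup>2 / 8)" by (simp flip: exp_double)
    finally have 1: "(N\<^sup>2 / 16)\<^sup>2 \<le> exp (N\<^sup>2 / 8)" .
    have "20000\<^sup>2 \<le> N\<^sup>2" using N by (intro power_mono) auto
    then have "3 * 256 * N\<^sup>2 < N\<^sup>2 * N\<^sup>2" using N by (intro mult_strict_right_mono) auto
    then have "3 * N\<^sup>2 < (N\<^sup>2 / 16)\<^sup>2" by (simp add: power2_eq_square)
    with 1 have "3 * N\<^sup>2 < exp (N\<^sup>2 / 8)" by linarith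
    then have "3 * N\<^sup>2 * exp (- N\<^sup>2 / 4) < exp (N\<^sup>2 / 8) * exp (- N\<^sup>2 / 4)" by (rule mult_strict_right_mono) simp
    also have "\<dots> = exp (- N\<^sup>2 / 8)" by (simp flip: exp_add)
    finally show ?thesis by simp
  qed
  ultimately show False by linarith
qed

lemma mX_deriv: "(mX has_field_derivative (CLINT \<omega>|M. of_real (X' \<omega>) * exp (z * of_real (X' \<omega>)))) (at z)"
  using mgf_has_field_derivative[of X' "\<lambda>_. 1" "2 * N" 1 z] abs_X'_le unfolding mX_def[abs_def] by simp

lemma mX_deriv2:
  "((\<lambda>z. CLINT \<omega>|M. of_real (X' \<omega>) * exp (z * of_real (X' \<omega>))) has_field_derivative
     (CLINT \<omega>|M. (of_real (X' \<omega>))\<^sup>2 * exp (z * of_real (X' \<omega>)))) (at z)"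
  using mgf_has_field_derivative[of X' "\<lambda>\<omega>. of_real (X' \<omega>)" "2 * N" "2 * N" z] abs_X'_le
  by (simp add: power2_eq_square)

lemma mX_holomorphic: "mX holomorphic_on A"
  using mX_deriv by (meson DERIV_subset UNIV_I field_differentiable_def holomorphic_onI
      field_differentiable_at_within)

lemma mX_0: "mX 0 = 1" by (simp add: mX_def prob_space)

lemma mX_real: "mX (of_real s) = of_real (expectation (\<lambda>\<omega>. exp (s * X' \<omega>)))"
proof -
  have "mX (of_real s) = (CLINT \<omega>|M. of_real (exp (s * X' \<omega>)))"
    unfolding mX_def by (simp flip: of_real_mult exp_of_real)
  then show ?thesis by (simp only: integral_complex_of_real)
qed

lemma norm_mX_le_real: "norm (mX z) \<le> norm (mX (of_real (Re z)))"
proof -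
  have "norm (mX z) \<le> expectation (\<lambda>\<omega>. norm (exp (z * of_real (X' \<omega>))))"
    unfolding mX_def by (rule integral_norm_bound)
  also have "\<dots> = expectation (\<lambda>\<omega>. exp (Re z * X' \<omega>))" by (simp add: norm_exp_eq_Re)
  also have "\<dots> \<le> norm (mX (of_real (Re z)))" unfolding mX_real by simp
  finally show ?thesis .
qed

lemma norm_mX_le: "norm (mX z) \<le> exp (norm z * (2 * N))"
proof -
  have "norm (mX z) \<le> expectation (\<lambda>\<omega>. norm (exp (z * of_real (X' \<omega>))))"
    unfolding mX_def by (rule integral_norm_bound)
  also have "\<dots> \<le> expectation (\<lambda>\<omega>. exp (norm z * (2 * N)))"
  proof (rule integral_mono)
    show "integrable M (\<lambda>\<omega>. norm (exp (z * of_real (X' \<omega>))))"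
      by (rule integrable_norm[OF exp_integrable[OF X'_measurable abs_X'_le]])
    show "norm (exp (z * of_real (X' \<omega>))) \<le> exp (norm z * (2 * N))" for \<omega>
      by (rule norm_exp_le[OF abs_X'_le])
  qed simp
  finally show ?thesis by (simp add: prob_space)
qed

text \<open>
  Without zeros \<open>mX\<close> has a holomorphic logarithm.  Removing the linear term \<open>a z\<close> leaves a double zero at
  the origin, and half the second derivative there is half the variance.
\<close>
lemma log_mX_exists:
  obtains h where "ridge (N / 16) h" "h 0 = of_real (w / 2)"
    "\<And>z. norm z < N / 16 \<Longrightarrow> mX z = exp (z\<^sup>2 * h z + of_real a * z)"
proof -
  let ?R = "N / 16"
  let ?B = "ball (0::complex) ?R"
  define m1 where "m1 z = (CLINT \<omega>|M. of_real (X' \<omega>) * exp (z * of_real (X' \<omega>)))" for z :: complex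
  have R: "0 < ?R" using N by simp
  have nz: "mX z \<noteq> 0" if "z \<in> ?B" for z using mX_nonzero that by simp
  obtain u where u: "u holomorphic_on ?B" and eu: "\<And>z. z \<in> ?B \<Longrightarrow> exp (u z) = mX z"
  proof (rule holomorphic_logarithm_exists[OF convex_ball open_ball mX_holomorphic nz])
    show "(0::complex) \<in> ?B" using R by simp
  qed (assumption | rule that)+
  define U where "U z = u z - u 0 - of_real a * z" for z
  have U: "U holomorphic_on ?B" unfolding U_def by (intro holomorphic_intros u)
  have U0: "U 0 = 0" by (simp add: U_def)
  have eU: "mX z = exp (U z + of_real a * z)" if "z \<in> ?B" for z
  proof -
    have "exp (u 0) = 1" using eu[of 0] R mX_0 by simp
    then have "exp (U z + of_real a * z) = exp (u z)" by (simp add: U_def exp_diff)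
    then show ?thesis using eu[OF that] by simp
  qed
  have dU: "(U has_field_derivative m1 z / mX z - of_real a) (at z)" if z: "z \<in> ?B" for z
  proof -
    have du: "(u has_field_derivative deriv u z) (at z)" using u z by (rule holomorphic_derivI[OF _ open_ball])
    have "((\<lambda>z. exp (u z)) has_field_derivative exp (u z) * deriv u z) (at z)"
      using du by (auto intro!: derivative_eq_intros)
    then have "(mX has_field_derivative exp (u z) * deriv u z) (at z)"
      by (rule has_field_derivative_transform_within_open[OF _ open_ball z]) (use eu in auto)
    then have "exp (u z) * deriv u z = m1 z" using mX_deriv DERIV_unique unfolding m1_def by blast
    then have "deriv u z = m1 z / mX z" using eu[OF z] nz[OF z] by (simp add: field_simps)
    with du have "(u has_field_derivative m1 z / mX z) (at z)" by simp
    then show ?thesis unfolding U_def by (auto intro!: derivative_eq_intros)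
  qed
  have m10: "m1 0 = of_real a" unfolding m1_def a_def by (simp add: integral_complex_of_real)
  have dU0: "deriv U 0 = 0" using dU[of 0] R by (simp add: DERIV_imp_deriv m10 mX_0)
  obtain g where g: "g holomorphic_on ?B" and Ug: "\<And>z. norm z < ?R \<Longrightarrow> U z = z * g z" and g0: "deriv U 0 = g 0"
    using Schwarz3[OF U U0] by blast
  have "g 0 = 0" using g0 dU0 by simp
  then obtain h where h: "h holomorphic_on ?B" and gh: "\<And>z. norm z < ?R \<Longrightarrow> g z = z * h z" and h0: "deriv g 0 = h 0"
    using Schwarz3[OF g] by blast
  have Uh: "U z = z\<^sup>2 * h z" if "norm z < ?R" for z using Ug gh that by (simp add: power2_eq_square)
  have "h 0 = of_real (w / 2)"
  proof -
    let ?D = "\<lambda>z. m1 z / mX z - of_real a"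
    have "((\<lambda>z. m1 z / mX z - of_real a) has_field_derivative
        ((CLINT \<omega>|M. (of_real (X' \<omega>))\<^sup>2 * exp (0 * of_real (X' \<omega>))) * mX 0 - m1 0 * m1 0) / (mX 0 * mX 0) - 0) (at 0)"
      unfolding m1_def by (intro derivative_intros mX_deriv mX_deriv2) (simp add: mX_0)
    moreover have "(CLINT \<omega>|M. (of_real (X' \<omega>))\<^sup>2 * exp (0 * of_real (X' \<omega>))) = of_real (expectation (\<lambda>\<omega>. (X' \<omega>)\<^sup>2))"
      by (simp flip: of_real_power integral_complex_of_real)
    \<comment> \<open>The derivative of the exponent is the logarithmic derivative minus the mean, so its slope at the origin is the variance.\<close>
    ultimately have D1: "(?D has_field_derivative of_real w) (at 0)"
      by (simp add: mX_0 m10 w_def power2_eq_square)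
    have D2: "((\<lambda>z. 2 * z * h z + z\<^sup>2 * deriv h z) has_field_derivative of_real w) (at 0)"
    proof (rule has_field_derivative_transform_within_open[OF D1 open_ball[of 0 ?R]])
      fix z assume z: "z \<in> ?B"
      have "((\<lambda>z. z\<^sup>2 * h z) has_field_derivative 2 * z * h z + z\<^sup>2 * deriv h z) (at z)"
        using holomorphic_derivI[OF h open_ball z] by (auto intro!: derivative_eq_intros)
      then have "(U has_field_derivative 2 * z * h z + z\<^sup>2 * deriv h z) (at z)"
        by (rule has_field_derivative_transform_within_open[OF _ open_ball z]) (use Uh in auto)
      then show "?D z = 2 * z * h z + z\<^sup>2 * deriv h z" using dU[OF z] DERIV_unique by blast
    qed (use R in auto)
    have "(h has_field_derivative deriv h 0) (at 0)" using h R by (intro holomorphic_derivI[OF _ open_ball]) auto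
    moreover have "(deriv h has_field_derivative deriv (deriv h) 0) (at 0)"
      using holomorphic_deriv[OF h open_ball] R by (intro holomorphic_derivI[OF _ open_ball]) auto
    ultimately have "((\<lambda>z. 2 * z * h z + z\<^sup>2 * deriv h z) has_field_derivative 2 * h 0) (at 0)"
      by (auto intro!: derivative_eq_intros)
    then have eq: "2 * h 0 = of_real w" using D2 DERIV_unique by blast
    have "h 0 = (2 * h 0) / 2" by simp
    also have "\<dots> = of_real (w / 2)" unfolding eq by simp
    finally show ?thesis .
  qed
  moreover have "ridge ?R h"
    unfolding ridge_def
  proof (intro conjI ballI h)
    fix z assume z: "z \<in> ?B"
    have z': "of_real (Re z) \<in> ?B" using z abs_Re_le_cmod[of z] by simp
    have "exp (Re (U z + of_real a * z)) \<le> exp (Re (U (of_real (Re z)) + of_real a * of_real (Re z)))"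
      using norm_mX_le_real[of z] unfolding eU[OF z] eU[OF z'] norm_exp_eq_Re .
    then have "Re (U z) \<le> Re (U (of_real (Re z)))" by simp
    then show "Re (z\<^sup>2 * h z) \<le> Re ((of_real (Re z))\<^sup>2 * h (of_real (Re z)))"
      using Uh[of z] Uh[of "of_real (Re z)"] z z' by simp
  qed
  moreover have "mX z = exp (z\<^sup>2 * h z + of_real a * z)" if "norm z < ?R" for z
    using eU[of z] Uh[of z] that by simp
  ultimately show ?thesis using that by blast
qed

text \<open>
  Radius of the disc on which \<open>ridge_constant C\<close> bounds the exponent by a multiple of its value at \<open>0\<close>.
  The factor \<open>N / 32\<close> rescales to the unit disc, and \<open>w / 2048\<close> is the value at \<open>0\<close> after normalising
  the bound \<open>1024\<close> there to \<open>1\<close>.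
\<close>
definition \<rho> :: "real \<Rightarrow> real" where "\<rho> C = N / (32 * C * (1 + ln (2048 / w)))"

lemma ln_w_nonneg: "0 \<le> ln (2048 / w)"
proof -
  have "v\<^sup>2 \<le> 1\<^sup>2" using v v_le_1 by (intro power_mono) auto
  then have "w \<le> 1" using w_bounds by simp
  then show ?thesis using w_bounds by (intro ln_ge_zero) (simp add: field_simps)
qed

lemma rho_bounds:
  assumes C: "1 \<le> C"
  shows "0 < \<rho> C" "\<rho> C \<le> N / 32"
proof -
  have "1 * 1 \<le> C * (1 + ln (2048 / w))" using C ln_w_nonneg by (intro mult_mono) auto
  then have l: "32 \<le> 32 * C * (1 + ln (2048 / w))" by simp
  then show "0 < \<rho> C" using N by (auto simp: \<rho>_def intro!: divide_pos_pos)
  show "\<rho> C \<le> N / 32" unfolding \<rho>_def using l N by (intro divide_left_mono) auto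
qed

text \<open>
  The trivial bound \<open>norm (mX z) \<le> exp (2 N norm z)\<close> makes \<open>Re (z\<^sup>2 h z)\<close> at most of order \<open>N\<^sup>2\<close>, and
  Harnack's inequality turns this into \<open>norm h \<le> 1024\<close> on the disc of radius \<open>N / 32\<close>.  Then \<open>h\<close> is of
  order \<open>h 0 = w / 2\<close> on the smaller disc of radius \<open>\<rho> C\<close>, and the Schwarz lemma makes \<open>h - h 0\<close> linearly small.
\<close>
lemma log_mX_near:
  assumes rc: "ridge_constant C"
  obtains h where "\<And>z. norm z < \<rho> C \<Longrightarrow> mX z = exp (z\<^sup>2 * h z + of_real a * z)"
    "\<And>z. norm z < \<rho> C \<Longrightarrow> norm (h z - of_real (w / 2)) \<le> 2 * C * w * norm z / \<rho> C"
proof -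
  have C: "1 \<le> C" using rc by (simp add: ridge_constant_def)
  obtain h where rh: "ridge (N / 16) h" and h0: "h 0 = of_real (w / 2)"
    and mX: "\<And>z. norm z < N / 16 \<Longrightarrow> mX z = exp (z\<^sup>2 * h z + of_real a * z)"
    using log_mX_exists by blast
  define r where "r = N / 32"
  have N0: "0 < N" and r: "0 < r" "N / 16 = 2 * r" using N by (auto simp: r_def)
  have hol: "h holomorphic_on ball 0 (2 * r)" using ridgeD(1)[OF rh] r by simp
  have Re_le: "Re (z\<^sup>2 * h z) \<le> N\<^sup>2 / 4" if z: "norm z < N / 16" for z
  proof -
    have "exp (Re (z\<^sup>2 * h z + of_real a * z)) \<le> exp (norm z * (2 * N))"
      using norm_mX_le[of z] unfolding mX[OF z] norm_exp_eq_Re .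
    then have "Re (z\<^sup>2 * h z) + a * Re z \<le> norm z * (2 * N)" by simp
    moreover have "- (a * Re z) \<le> norm z * (2 * N)"
    proof -
      have "\<bar>a\<bar> \<le> 2 * N" using abs_a_le q_le_1 N by linarith
      then have "\<bar>Re z\<bar> * \<bar>a\<bar> \<le> norm z * (2 * N)" using abs_Re_le_cmod by (intro mult_mono) auto
      then show ?thesis using abs_ge_minus_self[of "a * Re z"] by (simp add: abs_mult mult.commute)
    qed
    moreover have "norm z * (2 * N) \<le> N / 16 * (2 * N)" using z N0 by (intro mult_right_mono) auto
    ultimately show ?thesis by (simp add: power2_eq_square)
  qed
  have U_le: "norm (z\<^sup>2 * h z) \<le> N\<^sup>2" if z: "norm z \<le> r" for z
  proof -
    have "norm (of_real (N\<^sup>2 / 4) - z\<^sup>2 * h z) \<le> 3 * norm (of_real (N\<^sup>2 / 4) - 0\<^sup>2 * h 0)"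
    proof (rule harnack_half_ball[where c = 0 and r = "2 * r" and G = "\<lambda>z. of_real (N\<^sup>2 / 4) - z\<^sup>2 * h z"])
      show "(\<lambda>z. of_real (N\<^sup>2 / 4) - z\<^sup>2 * h z) holomorphic_on ball 0 (2 * r)" by (intro holomorphic_intros hol)
      show "0 \<le> Re (of_real (N\<^sup>2 / 4) - z\<^sup>2 * h z)" if "z \<in> ball 0 (2 * r)" for z
        using Re_le[of z] that r by (simp only: minus_complex.sel Re_complex_of_real) simp
    qed (use z r in auto)
    also have "norm (of_real (N\<^sup>2 / 4) - 0\<^sup>2 * h 0 :: complex) = N\<^sup>2 / 4"
      by (simp add: norm_divide norm_power)
    finally have "norm (of_real (N\<^sup>2 / 4) - z\<^sup>2 * h z) \<le> 3 * (N\<^sup>2 / 4)" .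
    moreover have "norm (z\<^sup>2 * h z) \<le> norm (of_real (N\<^sup>2 / 4) :: complex) + norm (of_real (N\<^sup>2 / 4) - z\<^sup>2 * h z)"
      using norm_triangle_ineq4[of "of_real (N\<^sup>2 / 4)" "of_real (N\<^sup>2 / 4) - z\<^sup>2 * h z"] by simp
    moreover have "norm (of_real (N\<^sup>2 / 4) :: complex) = N\<^sup>2 / 4" by (simp add: norm_divide norm_power)
    ultimately show ?thesis by linarith
  qed
  have h_le: "norm (h z) \<le> 1024" if z: "norm z \<le> r" for z
  proof (rule maximum_modulus_frontier[of h "cball 0 r"])
    have sub: "cball (0::complex) r \<subseteq> ball 0 (2 * r)" using r by auto
    show "h holomorphic_on interior (cball 0 r)" using holomorphic_on_subset[OF hol] sub interior_subset by blast
    show "continuous_on (closure (cball 0 r)) h"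
      using holomorphic_on_imp_continuous_on[OF holomorphic_on_subset[OF hol sub]] by simp
    show "norm (h \<zeta>) \<le> 1024" if "\<zeta> \<in> frontier (cball 0 r)" for \<zeta>
    proof -
      have \<zeta>: "norm \<zeta> = r" using that by simp
      have "r\<^sup>2 * norm (h \<zeta>) \<le> N\<^sup>2" using U_le[of \<zeta>] \<zeta> by (simp add: norm_mult norm_power)
      also have "N\<^sup>2 = r\<^sup>2 * 1024" by (simp add: r_def power_divide)
      finally show ?thesis using r by simp
    qed
  qed (use z in auto)
  define h1 where "h1 z = h (of_real r * z) / of_real 1024" for z
  have "ridge (N / 16 / r) h1" unfolding h1_def by (rule ridge_rescale[OF rh r(1)]) simp
  then have "ridge 2 h1" using r by simp
  then have r1: "ridge 1 h1" unfolding ridge_def using holomorphic_on_subset[of h1 "ball 0 2" "ball 0 1"] by auto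
  have h1_le: "norm (h1 w) \<le> 1" if "norm w < 1" for w
  proof -
    have "norm (of_real r * w) \<le> r" using that r by (simp add: norm_mult mult_left_le)
    from h_le[OF this] show ?thesis by (simp add: h1_def norm_divide)
  qed
  have h10: "norm (h1 0) = w / 2048" using w_bounds by (simp add: h1_def h0 norm_divide)
  then have h1nz: "h1 0 \<noteq> 0" using w_bounds by auto
  note \<rho> = rho_bounds[OF C]
  have hC: "norm (h z) \<le> C * w / 2" if z: "norm z \<le> \<rho> C" for z
  proof -
    have l: "0 < 1 + ln (2048 / w)" using ln_w_nonneg by simp
    have "norm (z / of_real r) \<le> \<rho> C / r" using z r by (simp add: norm_divide divide_right_mono)
    also have "\<rho> C / r = 1 / (C * (1 + ln (2048 / w)))" using N0 by (simp add: \<rho>_def r_def)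
    finally have "C * (1 + ln (2048 / w)) * norm (z / of_real r) \<le> C * (1 + ln (2048 / w)) * (1 / (C * (1 + ln (2048 / w))))"
      using C l by (intro mult_left_mono) auto
    also have "\<dots> = 1" using C l by simp
    finally have "C * norm (z / of_real r) * (1 + ln (1 / norm (h1 0))) \<le> 1"
      unfolding h10 by (simp add: mult_ac)
    then have "norm (h1 (z / of_real r)) \<le> C * norm (h1 0)"
      using rc r1 h1_le h1nz unfolding ridge_constant_def by blast
    then show ?thesis unfolding h10 using r by (simp add: h1_def norm_divide)
  qed
  have near: "norm (h z - of_real (w / 2)) \<le> 2 * C * w * norm z / \<rho> C" if z: "norm z < \<rho> C" for z
  proof -
    define p where "p \<zeta> = (h (of_real (\<rho> C) * \<zeta>) - of_real (w / 2)) / of_real (2 * C * w)" for \<zeta>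
    have in1: "norm (of_real (\<rho> C) * \<zeta>) \<le> \<rho> C" if "norm \<zeta> < 1" for \<zeta> :: complex
      using that \<rho> by (simp add: norm_mult mult_left_le)
    have Cw: "0 < 2 * C * w" using C w_bounds by simp
    have hp: "p holomorphic_on ball 0 1"
    proof -
      have "(\<lambda>\<zeta>. h (of_real (\<rho> C) * \<zeta>)) holomorphic_on ball 0 1"
      proof (rule holomorphic_on_compose_gen[OF _ hol, unfolded o_def])
        show "(\<lambda>\<zeta>::complex. of_real (\<rho> C) * \<zeta>) holomorphic_on ball 0 1" by (intro holomorphic_intros)
        show "(\<lambda>\<zeta>::complex. of_real (\<rho> C) * \<zeta>) ` ball 0 1 \<subseteq> ball 0 (2 * r)"
        proof (rule image_subsetI)
          fix \<zeta> :: complex assume "\<zeta> \<in> ball 0 1"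
          then have "norm (of_real (\<rho> C) * \<zeta>) \<le> \<rho> C" by (intro in1) simp
          then show "of_real (\<rho> C) * \<zeta> \<in> ball 0 (2 * r)" using \<rho> r by (simp add: r_def)
        qed
      qed
      then show ?thesis unfolding p_def using Cw by (intro holomorphic_intros) auto
    qed
    have p0: "p 0 = 0" by (simp add: p_def h0)
    have p1: "norm (p \<zeta>) < 1" if "norm \<zeta> < 1" for \<zeta>
    proof -
      have "norm (h (of_real (\<rho> C) * \<zeta>) - of_real (w / 2)) \<le> C * w / 2 + w / 2"
        using norm_triangle_ineq4[of "h (of_real (\<rho> C) * \<zeta>)" "of_real (w / 2)"] hC[OF in1[OF that]] w_bounds by simp
      also have "\<dots> < 2 * C * w"
      proof -
        have "1 * w \<le> C * w" using C w_bounds by (intro mult_right_mono) auto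
        then show ?thesis using w_bounds by linarith
      qed
      finally have "norm (h (of_real (\<rho> C) * \<zeta>) - of_real (w / 2)) < 2 * C * w" .
      then show ?thesis using Cw unfolding p_def norm_divide norm_of_real by simp
    qed
    have "norm (z / of_real (\<rho> C)) < 1" using z \<rho> by (simp add: norm_divide)
    from Schwarz_Lemma(1)[OF hp p0 p1 this]
    have "norm (p (z / of_real (\<rho> C))) \<le> norm (z / of_real (\<rho> C))" .
    moreover have "of_real (\<rho> C) * (z / of_real (\<rho> C)) = z" using \<rho> by simp
    ultimately have "norm (h z - of_real (w / 2)) / (2 * C * w) \<le> norm z / \<rho> C"
      using Cw \<rho> unfolding p_def norm_divide norm_of_real by simp
    then show ?thesis using Cw by (simp add: pos_divide_le_eq mult_ac)
  qed
  show ?thesis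
    by (rule that[of h]) (use mX near \<rho> N0 in auto)
qed

text \<open>
  On the imaginary axis the exponent of \<open>mX\<close> is \<open>- w t\<^sup>2 / 2\<close> up to an error of order \<open>v\<^sup>2 \<bar>t\<bar>\<^sup>3 / \<rho>\<close>, which
  for \<open>\<bar>t\<bar> \<le> \<rho> / (8 C)\<close> still leaves Gaussian decay.  The terms with \<open>q\<close> come from clipping and from the
  differences between \<open>a\<close> and \<open>0\<close> and between \<open>w\<close> and \<open>v\<^sup>2\<close>.
\<close>
lemma char_near_normal:
  assumes rc: "ridge_constant C"
    and t: "\<bar>t\<bar> \<le> \<rho> C / (8 * C)"
  shows "norm (char (distr M borel X) t - exp (- of_real (v\<^sup>2 * t\<^sup>2 / 2)))
     \<le> \<bar>t\<bar> * (2 * C * v\<^sup>2 / \<rho> C * (t\<^sup>2 * exp (- (v\<^sup>2 * t\<^sup>2 / 8))) + (2 * q + q\<^sup>2 * \<bar>t\<bar>))"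
proof -
  have C: "1 \<le> C" using rc by (simp add: ridge_constant_def)
  obtain h where mX: "\<And>z. norm z < \<rho> C \<Longrightarrow> mX z = exp (z\<^sup>2 * h z + of_real a * z)"
    and near: "\<And>z. norm z < \<rho> C \<Longrightarrow> norm (h z - of_real (w / 2)) \<le> 2 * C * w * norm z / \<rho> C"
    using log_mX_near[OF rc] by blast
  note \<rho> = rho_bounds[OF C]
  have "\<rho> C / (8 * C) < \<rho> C" using \<rho> C by (simp add: divide_less_eq)
  then have tr: "\<bar>t\<bar> < \<rho> C" using t by linarith
  let ?z = "\<i> * of_real t :: complex"
  have nz: "norm ?z = \<bar>t\<bar>" by (simp add: norm_mult)
  define d where "d = h ?z - of_real (w / 2)"
  have d: "norm d \<le> 2 * C * w * \<bar>t\<bar> / \<rho> C" using near[of ?z] tr unfolding d_def nz by simp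
  define A where "A = ?z\<^sup>2 * h ?z + of_real a * ?z"
  have A: "A = - of_real (t\<^sup>2) * (of_real (w / 2) + d) + \<i> * of_real (a * t)"
    by (simp add: A_def d_def power_mult_distrib algebra_simps)
  have mA: "mX ?z = exp A" using mX[of ?z] tr unfolding nz A_def by simp
  have t1: "norm (char (distr M borel X) t - mX ?z) \<le> \<bar>t\<bar> * q"
  proof -
    have iX: "integrable M (\<lambda>\<omega>. iexp (t * X \<omega>))" "integrable M (\<lambda>\<omega>. iexp (t * X' \<omega>))"
      by (intro integrable_iexp; simp)+
    have e1: "char (distr M borel X) t = (CLINT \<omega>|M. iexp (t * X \<omega>))"
      unfolding char_def by (subst integral_distr) auto
    have e2: "mX ?z = (CLINT \<omega>|M. iexp (t * X' \<omega>))"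
      unfolding mX_def by (simp add: mult.assoc)
    have "char (distr M borel X) t - mX ?z = (CLINT \<omega>|M. iexp (t * X \<omega>) - iexp (t * X' \<omega>))"
      unfolding e1 e2 by (simp only: Bochner_Integration.integral_diff[OF iX])
    also have "norm \<dots> \<le> (LINT \<omega>|M. \<bar>t\<bar> * \<bar>X \<omega> - X' \<omega>\<bar>)"
    proof (rule norm_integral_le)
      show "integrable M (\<lambda>\<omega>. iexp (t * X \<omega>) - iexp (t * X' \<omega>))" by (rule Bochner_Integration.integrable_diff[OF iX])
      show "integrable M (\<lambda>\<omega>. \<bar>t\<bar> * \<bar>X \<omega> - X' \<omega>\<bar>)" using X'_error(1) by (intro integrable_mult_right integrable_abs)
      fix \<omega>
      have "norm (iexp (t * X \<omega>) - iexp (t * X' \<omega>)) \<le> norm (\<i> * of_real (t * X \<omega>) - \<i> * of_real (t * X' \<omega>)) * exp 0"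
        by (rule norm_exp_diff_le) auto
      also have "\<dots> = \<bar>t\<bar> * \<bar>X \<omega> - X' \<omega>\<bar>"
        by (simp only: right_diff_distrib[symmetric] of_real_diff[symmetric] norm_mult norm_of_real abs_mult) simp
      finally show "norm (iexp (t * X \<omega>) - iexp (t * X' \<omega>)) \<le> \<bar>t\<bar> * \<bar>X \<omega> - X' \<omega>\<bar>" .
    qed
    also have "\<dots> = \<bar>t\<bar> * expectation (\<lambda>\<omega>. \<bar>X \<omega> - X' \<omega>\<bar>)" by simp
    also have "\<dots> \<le> \<bar>t\<bar> * q" using X'_error(2) by (rule mult_left_mono) simp
    finally show ?thesis .
  qed
  have w0: "0 < w" by (rule w_bounds)
  have dq: "norm d \<le> w / 4"
  proof -
    have "2 * C * w * \<bar>t\<bar> / \<rho> C \<le> 2 * C * w * (\<rho> C / (8 * C)) / \<rho> C"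
      using t C w0 \<rho> by (intro divide_right_mono mult_left_mono) auto
    also have "\<dots> = w / 4" using C \<rho> by simp
    finally show ?thesis using d by linarith
  qed
  let ?B = "- of_real (v\<^sup>2 * t\<^sup>2 / 2) :: complex"
  have ReA: "Re A \<le> - (v\<^sup>2 * t\<^sup>2 / 8)"
  proof -
    have "Re A = - (t\<^sup>2 * (w / 2 + Re d))" by (simp add: A)
    moreover have "v\<^sup>2 / 8 \<le> w / 2 + Re d" using dq abs_Re_le_cmod[of d] w_bounds by linarith
    then have "t\<^sup>2 * (v\<^sup>2 / 8) \<le> t\<^sup>2 * (w / 2 + Re d)" by (rule mult_left_mono) simp
    ultimately show ?thesis by (simp add: mult.commute)
  qed
  have ReB: "Re ?B \<le> - (v\<^sup>2 * t\<^sup>2 / 8)" by simp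
  have diff: "norm (A - ?B) \<le> \<bar>t\<bar> * (2 * C * v\<^sup>2 / \<rho> C * t\<^sup>2 + (q + q\<^sup>2 * \<bar>t\<bar>))"
  proof -
    have "A - ?B = of_real (t\<^sup>2 * ((v\<^sup>2 - w) / 2)) - of_real (t\<^sup>2) * d + \<i> * of_real (a * t)"
      by (simp add: A field_simps)
    also have "norm \<dots> \<le> norm (of_real (t\<^sup>2 * ((v\<^sup>2 - w) / 2)) - of_real (t\<^sup>2) * d) + norm (\<i> * of_real (a * t))"
      by (rule norm_triangle_ineq)
    also have "norm (of_real (t\<^sup>2 * ((v\<^sup>2 - w) / 2)) - of_real (t\<^sup>2) * d) \<le> norm (of_real (t\<^sup>2 * ((v\<^sup>2 - w) / 2)) :: complex) + norm (of_real (t\<^sup>2) * d)"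
      by (rule norm_triangle_ineq4)
    also have "norm (of_real (t\<^sup>2 * ((v\<^sup>2 - w) / 2)) :: complex) \<le> t\<^sup>2 * q\<^sup>2"
      unfolding norm_of_real abs_mult using w_bounds by (intro mult_mono) auto
    also have "norm (of_real (t\<^sup>2) * d) \<le> t\<^sup>2 * (2 * C * v\<^sup>2 * \<bar>t\<bar> / \<rho> C)"
    proof -
      have "2 * C * w * \<bar>t\<bar> / \<rho> C \<le> 2 * C * v\<^sup>2 * \<bar>t\<bar> / \<rho> C"
        using w_bounds C \<rho> by (intro divide_right_mono mult_right_mono mult_left_mono) auto
      then have "norm d \<le> 2 * C * v\<^sup>2 * \<bar>t\<bar> / \<rho> C" using d by linarith
      then show ?thesis unfolding norm_mult norm_of_real by (intro mult_mono) auto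
    qed
    also have "norm (\<i> * of_real (a * t)) \<le> q * \<bar>t\<bar>"
      using abs_a_le by (simp add: norm_mult abs_mult mult_right_mono)
    also have "t\<^sup>2 * q\<^sup>2 + t\<^sup>2 * (2 * C * v\<^sup>2 * \<bar>t\<bar> / \<rho> C) + q * \<bar>t\<bar>
       = \<bar>t\<bar> * (2 * C * v\<^sup>2 / \<rho> C * t\<^sup>2 + (q + q\<^sup>2 * \<bar>t\<bar>))"
    proof -
      have "t\<^sup>2 = \<bar>t\<bar> * \<bar>t\<bar>" by (simp add: power2_eq_square)
      then show ?thesis by (simp only:) (simp add: algebra_simps)
    qed
    finally show ?thesis by simp
  qed
  let ?e = "exp (- (v\<^sup>2 * t\<^sup>2 / 8))"
  have "norm (mX ?z - exp ?B) \<le> norm (A - ?B) * ?e"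
    unfolding mA by (rule norm_exp_diff_le[OF ReA ReB])
  also have "\<dots> \<le> \<bar>t\<bar> * (2 * C * v\<^sup>2 / \<rho> C * t\<^sup>2 + (q + q\<^sup>2 * \<bar>t\<bar>)) * ?e"
    using diff by (rule mult_right_mono) simp
  also have "\<dots> = \<bar>t\<bar> * (2 * C * v\<^sup>2 / \<rho> C * (t\<^sup>2 * ?e) + (q + q\<^sup>2 * \<bar>t\<bar>) * ?e)"
    by (simp only: distrib_right mult.assoc)
  also have "\<dots> \<le> \<bar>t\<bar> * (2 * C * v\<^sup>2 / \<rho> C * (t\<^sup>2 * ?e) + (q + q\<^sup>2 * \<bar>t\<bar>) * 1)"
    using q_pos by (intro mult_left_mono add_left_mono) auto
  finally have t2: "norm (mX ?z - exp ?B) \<le> \<bar>t\<bar> * (2 * C * v\<^sup>2 / \<rho> C * (t\<^sup>2 * ?e) + (q + q\<^sup>2 * \<bar>t\<bar>) * 1)" .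
  have "norm (char (distr M borel X) t - exp ?B) \<le> norm (char (distr M borel X) t - mX ?z) + norm (mX ?z - exp ?B)"
    using norm_triangle_ineq[of "char (distr M borel X) t - mX ?z" "mX ?z - exp ?B"] by simp
  also have "\<dots> \<le> \<bar>t\<bar> * q + \<bar>t\<bar> * (2 * C * v\<^sup>2 / \<rho> C * (t\<^sup>2 * ?e) + (q + q\<^sup>2 * \<bar>t\<bar>) * 1)"
    using t1 t2 by (rule add_mono)
  also have "\<dots> = \<bar>t\<bar> * (2 * C * v\<^sup>2 / \<rho> C * (t\<^sup>2 * ?e) + (2 * q + q\<^sup>2 * \<bar>t\<bar>))"
    by (simp add: distrib_left)
  finally show ?thesis .
qed

lemma inverse_rho_le:
  assumes C: "1 \<le> C"
  shows "1 / \<rho> C \<le> 416 * C * (1 + ln (1 / v)) / N"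
proof -
  have L: "0 \<le> ln (1 / v)" using v v_le_1 by simp
  have "2048 / w \<le> 4096 * (1 / v)\<^sup>2" using w_bounds v by (simp add: field_simps)
  then have "ln (2048 / w) \<le> ln (4096 * (1 / v)\<^sup>2)" using w_bounds v by (subst ln_le_cancel_iff) auto
  also have "\<dots> = ln (2 ^ 12) + 2 * ln (1 / v)" using v by (simp add: ln_mult ln_realpow power_divide ln_div)
  also have "ln (2 ^ 12 :: real) = 12 * ln 2" by (subst ln_realpow) auto
  also have "12 * ln 2 \<le> (12 :: real)" using ln_2_less_1 by simp
  finally have "1 + ln (2048 / w) \<le> 13 * (1 + ln (1 / v))" using L by simp
  then have "32 * C * (1 + ln (2048 / w)) \<le> 32 * C * (13 * (1 + ln (1 / v)))"
    using C by (intro mult_left_mono) auto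
  then have "32 * C * (1 + ln (2048 / w)) / N \<le> 32 * C * (13 * (1 + ln (1 / v))) / N"
    using N by (intro divide_right_mono) auto
  then show ?thesis by (simp add: \<rho>_def mult_ac)
qed

text \<open>
  The smoothing inequality at frequency \<open>T = \<rho> / (8 C)\<close>: the Gaussian integral contributes
  \<open>(v\<^sup>2 / \<rho>) / v\<^sup>3\<close>, the smoothness of the normal law contributes \<open>1 / (v T)\<close>, and both are of order
  \<open>1 / (v \<rho>)\<close>.
\<close>
lemma cdf_near_normal:
  assumes rc: "ridge_constant C"
    and sc: "smoothing_constant A"
  shows "\<bar>cdf (distr M borel X) x - cdf (density lborel (normal_density 0 v)) x\<bar>
     \<le> A * (57 * C) * (416 * C) * (1 + ln (1 / v)) / (v * N)"
proof -
  have C: "1 \<le> C" using rc by (simp add: ridge_constant_def)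
  have A: "0 < A" using sc by (simp add: smoothing_constant_def)
  define T where "T = \<rho> C / (8 * C)"
  note \<rho> = rho_bounds[OF C]
  have T: "0 < T" "T \<le> N"
  proof -
    show "0 < T" using \<rho> C by (simp add: T_def)
    have "\<rho> C / (8 * C) \<le> \<rho> C / 1" using \<rho> C by (intro divide_left_mono) auto
    then show "T \<le> N" using \<rho> N unfolding T_def by linarith
  qed
  define c where "c = 2 * q + q\<^sup>2 * T"
  have c0: "0 \<le> c" using q_pos T by (simp add: c_def)
  define H where "H t = 2 * C * v\<^sup>2 / \<rho> C * (t\<^sup>2 * exp (- (v\<^sup>2 * t\<^sup>2 / 8))) + c * indicator {-T..T} t" for t
  have i2: "integrable lborel (\<lambda>t. c * indicator {-T..T} t)"
    using T by (intro integrable_mult_right integrable_real_indicator) auto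
  have i1: "integrable lborel (\<lambda>t. 2 * C * v\<^sup>2 / \<rho> C * (t\<^sup>2 * exp (- (v\<^sup>2 * t\<^sup>2 / 8))))"
    by (intro integrable_mult_right integral_gauss_square v)
  have "integral\<^sup>L lborel H = (LBINT t. 2 * C * v\<^sup>2 / \<rho> C * (t\<^sup>2 * exp (- (v\<^sup>2 * t\<^sup>2 / 8)))) + (LBINT t. c * indicator {-T..T} t)"
    unfolding H_def by (rule Bochner_Integration.integral_add[OF i1 i2])
  also have "(LBINT t. 2 * C * v\<^sup>2 / \<rho> C * (t\<^sup>2 * exp (- (v\<^sup>2 * t\<^sup>2 / 8)))) = 2 * C * v\<^sup>2 / \<rho> C * (LBINT t. t\<^sup>2 * exp (- (v\<^sup>2 * t\<^sup>2 / 8)))"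
    by (rule integral_mult_right_zero)
  also have "\<dots> \<le> 2 * C * v\<^sup>2 / \<rho> C * (24 / v ^ 3)"
    using C v \<rho> by (intro mult_left_mono integral_gauss_square) auto
  also have "\<dots> = 48 * C / (v * \<rho> C)" using v by (simp add: power2_eq_square power3_eq_cube)
  also have "(LBINT t. c * indicator {-T..T} t) = c * (2 * T)" using T by simp
  also have "c * (2 * T) \<le> 1 / (v * \<rho> C)"
  proof -
    have N1: "1 \<le> N" using N by simp
    have "q\<^sup>2 * T \<le> q * N"
      unfolding power2_eq_square using q_le_1 q_pos T mult_left_le[of q q] by (intro mult_mono) auto
    moreover have "2 * q \<le> 2 * (q * N)" using q_pos N1 by simp
    ultimately have "c \<le> 3 * (q * N)" by (simp add: c_def)
    then have "c * (2 * T) \<le> 3 * (q * N) * (2 * N)" using T q_pos N1 by (intro mult_mono) auto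
    also have "\<dots> = q * (6 * N\<^sup>2)" by (simp add: power2_eq_square)
    also have "\<dots> \<le> q * (10 * N ^ 3)"
      using q_pos N1 by (intro mult_left_mono mult_mono power_increasing) auto
    also have "\<dots> \<le> 1 / N"
      using q_small N1 by (simp add: le_divide_eq numeral_eq_Suc mult_ac)
    also have "1 / N \<le> 1 / (v * \<rho> C)"
    proof (rule divide_left_mono)
      have "v * \<rho> C \<le> 1 * N" using v v_le_1 \<rho> N by (intro mult_mono) auto
      then show "v * \<rho> C \<le> N" by simp
    qed (use N v \<rho> in auto)
    finally show ?thesis .
  qed
  finally have HI: "integral\<^sup>L lborel H \<le> 48 * C / (v * \<rho> C) + 1 / (v * \<rho> C)" by simp
  have "\<bar>cdf (distr M borel X) x - cdf (density lborel (normal_density 0 v)) x\<bar> \<le> A * (integral\<^sup>L lborel H + (1 / v) / T)"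
  proof (rule sc[unfolded smoothing_constant_def, THEN conjunct2, rule_format])
    show "real_distribution (distr M borel X)" by (rule real_distribution_distr) simp
    show "real_distribution (density lborel (normal_density 0 v))" by (rule real_distribution_normal[OF v])
    show "cdf (density lborel (normal_density 0 v)) y - cdf (density lborel (normal_density 0 v)) x \<le> 1 / v * (y - x)" if "x \<le> y" for x y
      by (rule normal_cdf_lipschitz[OF v that])
    show "integrable lborel H" unfolding H_def by (rule Bochner_Integration.integrable_add[OF i1 i2])
    show "0 \<le> H s" for s unfolding H_def using C \<rho> c0 by (intro add_nonneg_nonneg mult_nonneg_nonneg) auto
    show "norm (char (distr M borel X) s - char (density lborel (normal_density 0 v)) s) \<le> \<bar>s\<bar> * H s" if s: "\<bar>s\<bar> \<le> T" for s
    proof -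
      have "norm (char (distr M borel X) s - exp (- of_real (v\<^sup>2 * s\<^sup>2 / 2)))
        \<le> \<bar>s\<bar> * (2 * C * v\<^sup>2 / \<rho> C * (s\<^sup>2 * exp (- (v\<^sup>2 * s\<^sup>2 / 8))) + (2 * q + q\<^sup>2 * \<bar>s\<bar>))"
        by (rule char_near_normal[OF rc s[unfolded T_def]])
      also have "\<dots> \<le> \<bar>s\<bar> * H s"
      proof (rule mult_left_mono)
        have "q\<^sup>2 * \<bar>s\<bar> \<le> q\<^sup>2 * T" using s by (rule mult_left_mono) simp
        then have "2 * q + q\<^sup>2 * \<bar>s\<bar> \<le> c" by (simp add: c_def)
        moreover have "indicator {-T..T} s = (1::real)" using s by (auto simp: indicator_def abs_le_iff)
        ultimately show "2 * C * v\<^sup>2 / \<rho> C * (s\<^sup>2 * exp (- (v\<^sup>2 * s\<^sup>2 / 8))) + (2 * q + q\<^sup>2 * \<bar>s\<bar>) \<le> H s"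
          unfolding H_def by simp
      qed simp
      finally show ?thesis unfolding char_normal[OF v] .
    qed
  qed (use v T in auto)
  also have "\<dots> \<le> A * (57 * C / (v * \<rho> C))"
  proof (rule mult_left_mono)
    have "(1 / v) / T = 8 * C / (v * \<rho> C)" by (simp add: T_def)
    moreover have "1 / (v * \<rho> C) \<le> C / (v * \<rho> C)" using C v \<rho> by (intro divide_right_mono) auto
    moreover have "57 * C / (v * \<rho> C) = 48 * C / (v * \<rho> C) + C / (v * \<rho> C) + 8 * C / (v * \<rho> C)"
      by (simp flip: add_divide_distrib)
    moreover have "I + b \<le> g" if "b = e" "p \<le> k" "g = f + k + e" "I \<le> f + p" for I b p k e f g :: real
      using that by linarith
    ultimately show "integral\<^sup>L lborel H + (1 / v) / T \<le> 57 * C / (v * \<rho> C)" using HI by blast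
  qed (use A in simp)
  also have "\<dots> = A * (57 * C) / v * (1 / \<rho> C)" by simp
  also have "\<dots> \<le> A * (57 * C) / v * (416 * C * (1 + ln (1 / v)) / N)"
    using A C v by (intro mult_left_mono inverse_rho_le[OF C]) auto
  also have "\<dots> = A * (57 * C) * (416 * C) * (1 + ln (1 / v)) / (v * N)" by simp
  finally show ?thesis .
qed

end

section \<open>Stability of the decomposition\<close>

text \<open>
  The proof yields the factor \<open>1 + ln (1 / v)\<close>, which is below both terms of the minimum up to a constant:
  \<open>ln x \<le> x - 1\<close> at \<open>x = 1 / sqrt v\<close> gives the first, and \<open>1 / v \<le> sqrt (ln (1 / \<epsilon>))\<close> the second.
\<close>
lemma m_fun_bounds:
  assumes v: "0 < v" "v \<le> 1" and \<epsilon>: "0 < \<epsilon>" "\<epsilon> < 1"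
  shows "1 \<le> m_fun v \<epsilon>"
    and "1 \<le> v * sqrt (ln (1 / \<epsilon>)) \<Longrightarrow> 1 + ln (1 / v) \<le> 2 * m_fun v \<epsilon>"
proof -
  define N where "N = sqrt (ln (1 / \<epsilon>))"
  have l: "0 < ln (1 / \<epsilon>)" using \<epsilon> by simp
  have N: "0 < N" "N\<^sup>2 = ln (1 / \<epsilon>)" using l by (auto simp: N_def)
  define r where "r = 1 / sqrt v"
  have sv: "0 < sqrt v" "sqrt v \<le> 1" using v by auto
  have r1: "1 \<le> r" using sv by (simp add: r_def)
  have e: "ln (exp (exp 1) / \<epsilon>) = exp 1 + N\<^sup>2"
    using \<epsilon> by (simp add: ln_div N(2))
  define m where "m = ln (exp 1 + N\<^sup>2)"
  have m1: "1 \<le> m"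
  proof -
    have "ln (exp 1) \<le> ln (exp 1 + N\<^sup>2)" by (rule ln_mono) auto
    then show ?thesis by (simp add: m_def)
  qed
  have mf: "m_fun v \<epsilon> = min r m" unfolding m_fun_def e by (simp add: r_def m_def)
  show "1 \<le> m_fun v \<epsilon>" unfolding mf using r1 m1 by simp
  assume "1 \<le> v * sqrt (ln (1 / \<epsilon>))"
  then have vN: "1 \<le> v * N" by (simp add: N_def)
  have "1 / v = r\<^sup>2" using v by (simp add: r_def power_divide)
  then have "ln (1 / v) = 2 * ln r" using r1 by (simp add: ln_realpow)
  moreover have "ln r \<le> r - 1" using r1 by (intro ln_le_minus_one) simp
  ultimately have 1: "1 + ln (1 / v) \<le> 2 * r" by linarith
  have "1 / v \<le> N" using vN v by (simp add: field_simps)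
  then have "ln (1 / v) \<le> ln N" by (rule ln_mono) (use v in simp)
  moreover have "2 * ln N = ln (N\<^sup>2)" using N(1) by (simp add: ln_realpow)
  moreover have "ln (N\<^sup>2) \<le> m" unfolding m_def by (rule ln_mono) (use N(1) in auto)
  ultimately have 2: "1 + ln (1 / v) \<le> 2 * m" using m1 by linarith
  show "1 + ln (1 / v) \<le> 2 * m_fun v \<epsilon>" unfolding mf using 1 2 by (simp add: min_def)
qed

lemma kolmogorov_dist_upper:
  assumes "real_distribution \<mu>" "real_distribution \<nu>"
  shows "\<bar>cdf \<mu> x - cdf \<nu> x\<bar> \<le> kolmogorov_dist (cdf \<mu>) (cdf \<nu>)"
proof -
  have "\<bar>cdf \<mu> y - cdf \<nu> y\<bar> \<le> 1" for y by (rule abs_cdf_diff_le_1[OF assms])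
  then have "bdd_above (range (\<lambda>y. \<bar>cdf \<mu> y - cdf \<nu> y\<bar>))" by (auto intro!: bdd_aboveI)
  then show ?thesis unfolding kolmogorov_dist_def by (rule cSUP_upper[OF UNIV_I])
qed

lemma kolmogorov_dist_least:
  assumes "\<And>x. \<bar>F x - G x\<bar> \<le> c"
  shows "kolmogorov_dist F G \<le> c"
  unfolding kolmogorov_dist_def by (rule cSUP_least) (use assms in auto)

text \<open>
  If \<open>v N < 20000\<close>, the right-hand side exceeds \<open>1\<close> and nothing is to be proved; otherwise \<open>v \<le> 1\<close>
  forces \<open>N \<ge> 20000\<close> as well and the estimates of the locale apply.
\<close>
lemma (in prob_space) component_near_normal:
  fixes X Y :: "'a \<Rightarrow> real"
  assumes rc: "ridge_constant C" and sc: "smoothing_constant A"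
    and ind: "indep_var borel X borel Y"
    and X1: "integrable M X" and X2: "integrable M (\<lambda>\<omega>. (X \<omega>)\<^sup>2)"
    and Y1: "integrable M Y" and Y2: "integrable M (\<lambda>\<omega>. (Y \<omega>)\<^sup>2)"
    and EX: "expectation X = 0" and EY: "expectation Y = 0"
    and ES: "variance (\<lambda>\<omega>. X \<omega> + Y \<omega>) = 1"
    and v: "0 < v" and vX: "v\<^sup>2 = variance X" and eps: "0 < \<epsilon>" "\<epsilon> < 1"
    and close: "kolmogorov_dist (cdf (distr M borel (\<lambda>\<omega>. X \<omega> + Y \<omega>))) (normal_cdf 1) \<le> \<epsilon>"
  shows "kolmogorov_dist (cdf (distr M borel X)) (normal_cdf v)
    \<le> (20000 + 2 * (A * (57 * C) * (416 * C))) * m_fun v \<epsilon> / (v * sqrt (ln (1 / \<epsilon>)))"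
proof (rule kolmogorov_dist_least)
  fix x
  have [measurable]: "X \<in> borel_measurable M" "Y \<in> borel_measurable M" using X1 Y1 by auto
  define N where "N = sqrt (ln (1 / \<epsilon>))"
  have l: "0 < ln (1 / \<epsilon>)" using eps by simp
  have N: "0 < N" "N\<^sup>2 = ln (1 / \<epsilon>)" using l by (auto simp: N_def)
  have ES2: "expectation (\<lambda>\<omega>. (X \<omega> + Y \<omega>)\<^sup>2) = 1" using ES X1 Y1 EX EY by simp
  have EX2: "expectation (\<lambda>\<omega>. (X \<omega>)\<^sup>2) = v\<^sup>2" using vX EX by simp
  have S2: "integrable M (\<lambda>\<omega>. (X \<omega> + Y \<omega>)\<^sup>2)" using ES2 not_integrable_integral_eq by force
  have "v\<^sup>2 \<le> 1\<^sup>2"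
    using expectation_excess_mono[OF ind X2 Y1 Y2 X1 EY S2, of 0] EX2 ES2 by (simp add: excess_def)
  then have v1: "v \<le> 1" by (rule power2_le_imp_le) simp
  note m1 = m_fun_bounds(1)[OF v v1 eps]
  define D where "D = A * (57 * C) * (416 * C)"
  have D: "0 < D" using rc sc by (simp add: D_def ridge_constant_def smoothing_constant_def)
  have mu: "real_distribution (distr M borel X)" by (rule real_distribution_distr) simp
  have sm: "real_distribution (distr M borel (\<lambda>\<omega>. X \<omega> + Y \<omega>))" by (rule real_distribution_distr) simp
  have vN0: "0 < v * N" using v N by simp
  show "\<bar>cdf (distr M borel X) x - normal_cdf v x\<bar> \<le> (20000 + 2 * (A * (57 * C) * (416 * C))) * m_fun v \<epsilon> / (v * sqrt (ln (1 / \<epsilon>)))"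
    unfolding N_def[symmetric] D_def[symmetric]
  proof (cases "20000 \<le> v * N")
    case True
    then have vN: "1 \<le> v * N" by simp
    have "v * N \<le> 1 * N" using v1 N by (intro mult_right_mono) auto
    then have N2: "20000 \<le> N" using True by simp
    have "near_normal_sum M X Y v N \<epsilon>"
    proof (unfold_locales; (fact ind X1 X2 Y1 Y2 EX EY ES2 EX2 N2 vN v)?)
      fix y
      have "\<bar>cdf (distr M borel (\<lambda>\<omega>. X \<omega> + Y \<omega>)) y - cdf std_normal_distribution y\<bar>
        \<le> kolmogorov_dist (cdf (distr M borel (\<lambda>\<omega>. X \<omega> + Y \<omega>))) (cdf std_normal_distribution)"
        by (rule kolmogorov_dist_upper[OF sm real_dist_normal_dist])
      also have "\<dots> \<le> \<epsilon>" using close unfolding normal_cdf_def .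
      finally show "\<bar>cdf (distr M borel (\<lambda>\<omega>. X \<omega> + Y \<omega>)) y - cdf std_normal_distribution y\<bar> \<le> \<epsilon>" .
      show "\<epsilon> = exp (- N\<^sup>2)" unfolding N(2) using eps by (simp add: ln_div)
    qed
    then interpret near_normal_sum M X Y v N \<epsilon> .
    have "\<bar>cdf (distr M borel X) x - normal_cdf v x\<bar> \<le> D * (1 + ln (1 / v)) / (v * N)"
      unfolding normal_cdf_def D_def by (rule cdf_near_normal[OF rc sc])
    also have "\<dots> \<le> D * (2 * m_fun v \<epsilon>) / (v * N)"
      using m_fun_bounds(2)[OF v v1 eps] vN vN0 D unfolding N_def by (intro divide_right_mono mult_left_mono) auto
    also have "\<dots> \<le> (20000 + 2 * D) * m_fun v \<epsilon> / (v * N)"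
      using vN0 m1 by (intro divide_right_mono) (auto simp: algebra_simps)
    finally show "\<bar>cdf (distr M borel X) x - normal_cdf v x\<bar> \<le> (20000 + 2 * D) * m_fun v \<epsilon> / (v * N)" .
  next
    case False
    have "\<bar>cdf (distr M borel X) x - normal_cdf v x\<bar> \<le> 1"
      unfolding normal_cdf_def by (rule abs_cdf_diff_le_1[OF mu real_distribution_normal[OF v]])
    also have "1 \<le> 20000 * 1 / (v * N)" using False vN0 by (simp add: field_simps)
    also have "\<dots> \<le> (20000 + 2 * D) * m_fun v \<epsilon> / (v * N)"
      using vN0 m1 D by (intro divide_right_mono mult_mono) auto
    finally show "\<bar>cdf (distr M borel X) x - normal_cdf v x\<bar> \<le> (20000 + 2 * D) * m_fun v \<epsilon> / (v * N)" .
  qed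
qed

text \<open>
  A pair of laws is realised by the coordinates of the product space, so that the version for laws follows
  from the one for random variables.
\<close>
lemma independent_coordinates:
  fixes P Q :: "real measure"
  assumes P: "real_distribution P" and Q: "real_distribution Q"
  shows "prob_space (P \<Otimes>\<^sub>M Q)" "distr (P \<Otimes>\<^sub>M Q) borel fst = P" "distr (P \<Otimes>\<^sub>M Q) borel snd = Q"
    "prob_space.indep_var (P \<Otimes>\<^sub>M Q) borel fst borel snd"
    "distr (P \<Otimes>\<^sub>M Q) borel (\<lambda>z. fst z + snd z) = (P \<star> Q)"
proof -
  interpret P: real_distribution P by fact
  interpret Q: real_distribution Q by fact
  interpret PQ: pair_prob_space P Q ..
  have sP: "sets P = sets borel" and sQ: "sets Q = sets borel" by simp_all
  have sPQ: "sets (P \<Otimes>\<^sub>M Q) = sets (borel \<Otimes>\<^sub>M borel)" by (rule sets_pair_measure_cong[OF sP sQ])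
  show ps: "prob_space (P \<Otimes>\<^sub>M Q)"
    by (rule prob_space_pair[OF P.prob_space_axioms Q.prob_space_axioms])
  have f: "distr (P \<Otimes>\<^sub>M Q) P fst = P" by (rule Q.distr_pair_fst)
  show 1: "distr (P \<Otimes>\<^sub>M Q) borel fst = P"
    using f distr_cong[of "P \<Otimes>\<^sub>M Q" "P \<Otimes>\<^sub>M Q" borel P fst fst] sP by simp
  have g: "distr (Q \<Otimes>\<^sub>M P) Q fst = Q" by (rule P.distr_pair_fst)
  have "distr (P \<Otimes>\<^sub>M Q) Q snd = distr (distr (Q \<Otimes>\<^sub>M P) (P \<Otimes>\<^sub>M Q) (\<lambda>(x, y). (y, x))) Q snd"
    by (subst PQ.distr_pair_swap) simp
  also have "\<dots> = distr (Q \<Otimes>\<^sub>M P) Q fst"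
    by (subst distr_distr) (auto intro!: distr_cong simp: o_def)
  finally have s: "distr (P \<Otimes>\<^sub>M Q) Q snd = Q" using g by simp
  show 2: "distr (P \<Otimes>\<^sub>M Q) borel snd = Q"
    using s distr_cong[of "P \<Otimes>\<^sub>M Q" "P \<Otimes>\<^sub>M Q" borel Q snd snd] sQ by simp
  have m: "fst \<in> borel_measurable (P \<Otimes>\<^sub>M Q)" "snd \<in> borel_measurable (P \<Otimes>\<^sub>M Q)"
    using measurable_fst[of P Q] measurable_snd[of P Q] measurable_cong_sets[OF refl sP] measurable_cong_sets[OF refl sQ] by auto
  show "prob_space.indep_var (P \<Otimes>\<^sub>M Q) borel fst borel snd"
    unfolding prob_space.indep_var_distribution_eq[OF ps] 1 2
    using m distr_id2[OF sPQ[symmetric]] by (simp add: id_def)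
  show "distr (P \<Otimes>\<^sub>M Q) borel (\<lambda>z. fst z + snd z) = (P \<star> Q)"
    unfolding convolution_def by (simp add: case_prod_beta')
qed

theorem theorem2p3:
  shows "\<exists>C::real.
    (\<forall>(P :: real measure) (Q :: real measure) (v1 :: real) (v2 :: real) (\<epsilon> :: real).
       real_distribution P \<longrightarrow> real_distribution Q \<longrightarrow>
       integrable P (\<lambda>x. x) \<longrightarrow> integrable P (\<lambda>x. x\<^sup>2) \<longrightarrow>
       integrable Q (\<lambda>y. y) \<longrightarrow> integrable Q (\<lambda>y. y\<^sup>2) \<longrightarrow>
       prob_space.expectation P (\<lambda>x. x) = 0 \<longrightarrow>
       prob_space.expectation Q (\<lambda>y. y) = 0 \<longrightarrow>
       prob_space.variance (P \<star> Q) (\<lambda>z. z) = 1 \<longrightarrow>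
       v1 > 0 \<longrightarrow> v2 > 0 \<longrightarrow>
       v1\<^sup>2 = prob_space.variance P (\<lambda>x. x) \<longrightarrow>
       v2\<^sup>2 = prob_space.variance Q (\<lambda>y. y) \<longrightarrow>
       0 < \<epsilon> \<longrightarrow> \<epsilon> < 1 \<longrightarrow>
       kolmogorov_dist (cdf (P \<star> Q)) (normal_cdf 1) \<le> \<epsilon> \<longrightarrow>
         kolmogorov_dist (cdf P) (normal_cdf v1) \<le> C * m_fun v1 \<epsilon> / (v1 * sqrt (ln (1 / \<epsilon>))) \<and>
         kolmogorov_dist (cdf Q) (normal_cdf v2) \<le> C * m_fun v2 \<epsilon> / (v2 * sqrt (ln (1 / \<epsilon>))))
    \<and>
    (\<forall>(M :: 'a measure) (X :: 'a \<Rightarrow> real) (Y :: 'a \<Rightarrow> real) (v1 :: real) (v2 :: real) (\<epsilon> :: real).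
       prob_space M \<longrightarrow>
       prob_space.indep_var M borel X borel Y \<longrightarrow>
       integrable M X \<longrightarrow> integrable M (\<lambda>\<omega>. (X \<omega>)\<^sup>2) \<longrightarrow>
       integrable M Y \<longrightarrow> integrable M (\<lambda>\<omega>. (Y \<omega>)\<^sup>2) \<longrightarrow>
       prob_space.expectation M X = 0 \<longrightarrow>
       prob_space.expectation M Y = 0 \<longrightarrow>
       prob_space.variance M (\<lambda>\<omega>. X \<omega> + Y \<omega>) = 1 \<longrightarrow>
       v1 > 0 \<longrightarrow> v2 > 0 \<longrightarrow>
       v1\<^sup>2 = prob_space.variance M X \<longrightarrow>
       v2\<^sup>2 = prob_space.variance M Y \<longrightarrow>
       0 < \<epsilon> \<longrightarrow> \<epsilon> < 1 \<longrightarrow>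
       kolmogorov_dist (cdf (distr M borel (\<lambda>\<omega>. X \<omega> + Y \<omega>))) (normal_cdf 1) \<le> \<epsilon> \<longrightarrow>
         kolmogorov_dist (cdf (distr M borel X)) (normal_cdf v1)
           \<le> C * m_fun v1 \<epsilon> / (v1 * sqrt (ln (1 / \<epsilon>))) \<and>
         kolmogorov_dist (cdf (distr M borel Y)) (normal_cdf v2)
           \<le> C * m_fun v2 \<epsilon> / (v2 * sqrt (ln (1 / \<epsilon>))))"
proof -
  obtain C where rc: "ridge_constant C" using ridge_constant_exists by blast
  obtain A where sc: "smoothing_constant A" using smoothing_constant_exists by blast
  define B where "B = 20000 + 2 * (A * (57 * C) * (416 * C))"
  note component = prob_space.component_near_normal[OF _ rc sc, folded B_def]
  show ?thesis
  proof (rule exI[of _ B], intro conjI allI impI)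
    fix P Q :: "real measure" and v1 v2 \<epsilon> :: real
    assume P: "real_distribution P" and Q: "real_distribution Q"
      and P1: "integrable P (\<lambda>x. x)" and P2: "integrable P (\<lambda>x. x\<^sup>2)"
      and Q1: "integrable Q (\<lambda>y. y)" and Q2: "integrable Q (\<lambda>y. y\<^sup>2)"
      and EP: "prob_space.expectation P (\<lambda>x. x) = 0" and EQ: "prob_space.expectation Q (\<lambda>y. y) = 0"
      and VS: "prob_space.variance (P \<star> Q) (\<lambda>z. z) = 1" and v: "0 < v1" "0 < v2"
      and v1: "v1\<^sup>2 = prob_space.variance P (\<lambda>x. x)" and v2: "v2\<^sup>2 = prob_space.variance Q (\<lambda>y. y)"
      and \<epsilon>: "0 < \<epsilon>" "\<epsilon> < 1" and close: "kolmogorov_dist (cdf (P \<star> Q)) (normal_cdf 1) \<le> \<epsilon>"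
    let ?M = "P \<Otimes>\<^sub>M Q"
    note ic = independent_coordinates[OF P Q]
    interpret M: prob_space ?M by (rule ic(1))
    have ind: "M.indep_var borel fst borel snd" by (rule ic(4))
    then have m: "fst \<in> borel_measurable ?M" "snd \<in> borel_measurable ?M" by (auto dest: M.indep_var_rv1 M.indep_var_rv2)
    have mS: "(\<lambda>z. fst z + snd z) \<in> borel_measurable ?M" using m by (rule borel_measurable_add)
    have tP: "integrable P f \<longleftrightarrow> integrable ?M (\<lambda>z. f (fst z))" "integral\<^sup>L P f = integral\<^sup>L ?M (\<lambda>z. f (fst z))"
      if "f \<in> borel_measurable borel" for f :: "real \<Rightarrow> real"
      using integrable_distr_eq[OF m(1) that] integral_distr[OF m(1) that] unfolding ic(2) by auto
    have tQ: "integrable Q f \<longleftrightarrow> integrable ?M (\<lambda>z. f (snd z))" "integral\<^sup>L Q f = integral\<^sup>L ?M (\<lambda>z. f (snd z))"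
      if "f \<in> borel_measurable borel" for f :: "real \<Rightarrow> real"
      using integrable_distr_eq[OF m(2) that] integral_distr[OF m(2) that] unfolding ic(3) by auto
    have tS: "integral\<^sup>L (P \<star> Q) f = integral\<^sup>L ?M (\<lambda>z. f (fst z + snd z))"
      if "f \<in> borel_measurable borel" for f :: "real \<Rightarrow> real"
      using integral_distr[OF mS that] unfolding ic(5) .
    have X1: "integrable ?M (\<lambda>z. fst z)" by (rule tP(1)[THEN iffD1, OF _ P1]) simp
    have X2: "integrable ?M (\<lambda>z. (fst z)\<^sup>2)" by (rule tP(1)[THEN iffD1, OF _ P2]) simp
    have Y1: "integrable ?M (\<lambda>z. snd z)" by (rule tQ(1)[THEN iffD1, OF _ Q1]) simp
    have Y2: "integrable ?M (\<lambda>z. (snd z)\<^sup>2)" by (rule tQ(1)[THEN iffD1, OF _ Q2]) simp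
    have EX: "M.expectation (\<lambda>z. fst z) = 0" using tP(2)[of "\<lambda>x. x", OF measurable_ident_sets[OF refl]] EP by (simp only:)
    have EY: "M.expectation (\<lambda>z. snd z) = 0" using tQ(2)[of "\<lambda>x. x", OF measurable_ident_sets[OF refl]] EQ by (simp only:)
    have vX: "v1\<^sup>2 = M.variance (\<lambda>z. fst z)"
      unfolding v1 EP EX by (rule tP(2)) simp
    have vY: "v2\<^sup>2 = M.variance (\<lambda>z. snd z)"
      unfolding v2 EQ EY by (rule tQ(2)) simp
    have ES: "integral\<^sup>L (P \<star> Q) (\<lambda>z. z) = M.expectation (\<lambda>z. fst z + snd z)" by (rule tS) simp
    have VM: "M.variance (\<lambda>z. fst z + snd z) = 1"
      unfolding VS[unfolded ES, symmetric] by (rule tS[symmetric]) simp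
    have c1: "kolmogorov_dist (cdf (distr ?M borel (\<lambda>z. fst z + snd z))) (normal_cdf 1) \<le> \<epsilon>"
      unfolding ic(5) by (rule close)
    show "kolmogorov_dist (cdf P) (normal_cdf v1) \<le> B * m_fun v1 \<epsilon> / (v1 * sqrt (ln (1 / \<epsilon>)))"
      using component[OF ic(1) ind X1 X2 Y1 Y2 EX EY VM v(1) vX \<epsilon> c1] unfolding ic(2) .
    have VM': "M.variance (\<lambda>z. snd z + fst z) = 1" using VM by (simp only: add.commute)
    have c2: "kolmogorov_dist (cdf (distr ?M borel (\<lambda>z. snd z + fst z))) (normal_cdf 1) \<le> \<epsilon>"
      using c1 by (simp only: add.commute)
    show "kolmogorov_dist (cdf Q) (normal_cdf v2) \<le> B * m_fun v2 \<epsilon> / (v2 * sqrt (ln (1 / \<epsilon>)))"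
      using component[OF ic(1) M.indep_var_swap[OF ind] Y1 Y2 X1 X2 EY EX VM' v(2) vY \<epsilon> c2] unfolding ic(3) .
  next
    fix M :: "'a measure" and X Y :: "'a \<Rightarrow> real" and v1 v2 \<epsilon> :: real
    assume M: "prob_space M" and ind: "prob_space.indep_var M borel X borel Y"
      and X1: "integrable M X" and X2: "integrable M (\<lambda>\<omega>. (X \<omega>)\<^sup>2)"
      and Y1: "integrable M Y" and Y2: "integrable M (\<lambda>\<omega>. (Y \<omega>)\<^sup>2)"
      and EX: "prob_space.expectation M X = 0" and EY: "prob_space.expectation M Y = 0"
      and VS: "prob_space.variance M (\<lambda>\<omega>. X \<omega> + Y \<omega>) = 1" and v: "0 < v1" "0 < v2"
      and v1: "v1\<^sup>2 = prob_space.variance M X" and v2: "v2\<^sup>2 = prob_space.variance M Y"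
      and \<epsilon>: "0 < \<epsilon>" "\<epsilon> < 1"
      and close: "kolmogorov_dist (cdf (distr M borel (\<lambda>\<omega>. X \<omega> + Y \<omega>))) (normal_cdf 1) \<le> \<epsilon>"
    show "kolmogorov_dist (cdf (distr M borel X)) (normal_cdf v1) \<le> B * m_fun v1 \<epsilon> / (v1 * sqrt (ln (1 / \<epsilon>)))"
      by (rule component[OF M ind X1 X2 Y1 Y2 EX EY VS v(1) v1 \<epsilon> close])
    have VS': "prob_space.variance M (\<lambda>\<omega>. Y \<omega> + X \<omega>) = 1" using VS by (simp only: add.commute)
    have close': "kolmogorov_dist (cdf (distr M borel (\<lambda>\<omega>. Y \<omega> + X \<omega>))) (normal_cdf 1) \<le> \<epsilon>"
      using close by (simp only: add.commute)
    show "kolmogorov_dist (cdf (distr M borel Y)) (normal_cdf v2) \<le> B * m_fun v2 \<epsilon> / (v2 * sqrt (ln (1 / \<epsilon>)))"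
      by (rule component[OF M prob_space.indep_var_swap[OF M ind] Y1 Y2 X1 X2 EY EX VS' v(2) v2 \<epsilon> close'])
  qed
qed

end
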